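(* Let $a,b\in\mathbb C^2$, $a\neq b$. (A) Suppose that one of the points $a,b$ is contained in $B$. (A1) If $\langle a|b\rangle\neq 1$, then $\mathcal L(a)\cup\mathcal L(b)$ is a test family for holomorphic extendibility for $C^\infty(bB)$. (A2) If $\langle a|b\rangle=1$, then there is a function $f\in C^\infty(bB)$ which extends holomorphically along every complex line in $\mathcal L(a)\cup\mathcal L(b)$ that meets $B$, yet $f$ does not extend holomorphically through $B$. (B) Suppose that both points $a,b$ are contained in $\mathbb C^2\setminus B$. (B1) If $\Lambda(a,b)$ meets $B$, then $\mathcal L(a)\cup\mathcal L(b)$ is a test family for holomorphic extendibility for $C^\infty(bB)$. (B2) If $\Lambda(a,b)$ misses $\overline B$, then there is a function $f\in C^\infty(bB)$ which extends holomorphically along every complex line in $\mathcal L(a)\cup\mathcal L(b)$ that meets $B$, yet $f$ does not extend holomorphically through $B$.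
   Context: $B$ is the open unit ball in $\mathbb C^2$, $\overline B$ its closure and $bB$ its boundary (the unit sphere); $\langle z|w\rangle=z_1\overline{w_1}+z_2\overline{w_2}$ is the standard Hermitian inner product. Functions are complex valued. Complex lines are affine complex lines in $\mathbb C^2$; for $a\in\mathbb C^2$, $\mathcal L(a)$ denotes the family of all complex lines passing through $a$, and for $a\ne b$, $\Lambda(a,b)$ denotes the complex line passing through $a$ and $b$. If $f$ is a continuous function on $bB$ and $L$ is a complex line that meets $B$, then $f$ extends holomorphically along $L$ if $f|_{L\cap bB}$ has a continuous extension to $L\cap\overline B$ which is holomorphic on $L\cap B$. A continuous function $f$ on $bB$ extends holomorphically through $B$ if it has a continuous extension to $\overline B$ which is holomorphic on $B$. A family $\mathcal F$ of complex lines is a test family for holomorphic extendibility for $C^\infty(bB)$ if every $f\in C^\infty(bB)$ which extends holomorphically along each complex line in $\mathcal F$ that meets $B$ extends holomorphically through $B$. *)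

theory Defs
  imports "HOL-Analysis.Analysis"
begin

text \<open>
  \<^typ>\<open>complex^2\<close> carries the Euclidean norm, so \<^term>\<open>ball 0 1\<close>, \<^term>\<open>cball 0 1\<close> and
  \<^term>\<open>sphere 0 1\<close> are the open unit ball, its closure and its boundary. Complex scalar
  multiplication is \<^term>\<open>(*s)\<close>; functions on the sphere are total functions whose values off
  the sphere are irrelevant.
\<close>

definition hermitian_inner :: "complex^2 \<Rightarrow> complex^2 \<Rightarrow> complex" where
  "hermitian_inner z w = z $ 1 * cnj (w $ 1) + z $ 2 * cnj (w $ 2)"


subsection \<open>Complex lines\<close>

definition complex_line :: "(complex^2) set \<Rightarrow> bool" where
  "complex_line L \<longleftrightarrow> (\<exists>p v. v \<noteq> 0 \<and> L = range (\<lambda>\<zeta>. p + \<zeta> *s v))"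

definition lines_through :: "complex^2 \<Rightarrow> (complex^2) set set" where
  "lines_through a = {L. complex_line L \<and> a \<in> L}"

definition line_joining :: "complex^2 \<Rightarrow> complex^2 \<Rightarrow> (complex^2) set" where
  "line_joining a b = range (\<lambda>\<zeta>. a + \<zeta> *s (b - a))"

lemma line_joining_unique:
  assumes "a \<noteq> b"
  shows "complex_line L \<and> a \<in> L \<and> b \<in> L \<longleftrightarrow> L = line_joining a b"
proof
  assume "complex_line L \<and> a \<in> L \<and> b \<in> L"
  then obtain p v s t where v: "v \<noteq> 0" and L: "L = range (\<lambda>\<zeta>. p + \<zeta> *s v)"
    and a: "a = p + s *s v" and b: "b = p + t *s v"
    unfolding complex_line_def by blast
  have st: "t - s \<noteq> 0" using a b assms by auto
  have ba: "b - a = (t - s) *s v" by (simp add: a b vec_eq_iff algebra_simps)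
  have 1: "a + \<zeta> *s (b - a) = p + (s + \<zeta> * (t - s)) *s v" for \<zeta>
    unfolding ba unfolding a by (simp add: vec_eq_iff algebra_simps)
  have 2: "p + \<zeta> *s v = a + ((\<zeta> - s) / (t - s)) *s (b - a)" for \<zeta>
    using 1[of "(\<zeta> - s) / (t - s)"] st by simp
  show "L = line_joining a b"
    unfolding L line_joining_def
  proof (intro equalityI image_subsetI)
    show "p + \<zeta> *s v \<in> range (\<lambda>\<zeta>. a + \<zeta> *s (b - a))" for \<zeta>
      by (subst 2) (rule rangeI)
    show "a + \<zeta> *s (b - a) \<in> range (\<lambda>\<zeta>. p + \<zeta> *s v)" for \<zeta>
      by (subst 1) (rule rangeI)
  qed
next
  assume L: "L = line_joining a b"
  have "a = a + 0 *s (b - a)" "b = a + 1 *s (b - a)" by simp_all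
  then have "a \<in> L" "b \<in> L" unfolding L line_joining_def by blast+
  moreover have "complex_line L"
    unfolding complex_line_def L line_joining_def using assms
    by (metis right_minus_eq)
  ultimately show "complex_line L \<and> a \<in> L \<and> b \<in> L" by blast
qed


subsection \<open>Holomorphic extension\<close>

text \<open>
  Holomorphy on an open set of \<open>\<complex>\<^sup>2\<close>: the real Frechet derivative exists at every point and is
  complex linear.
\<close>

definition holomorphic2_on :: "(complex^2 \<Rightarrow> complex) \<Rightarrow> (complex^2) set \<Rightarrow> bool" where
  "holomorphic2_on f U \<longleftrightarrow>
     (\<forall>z\<in>U. \<exists>f'. (f has_derivative f') (at z) \<and> (\<forall>c h. f' (c *s h) = c * f' h))"

text \<open>
  On a relatively open subset \<open>S\<close> of a complex line \<open>L\<close>, holomorphy is holomorphy in an affine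
  coordinate of \<open>L\<close>. The choice of the coordinate does not matter.
\<close>

definition holomorphic_on_line ::
    "(complex^2 \<Rightarrow> complex) \<Rightarrow> (complex^2) set \<Rightarrow> (complex^2) set \<Rightarrow> bool" where
  "holomorphic_on_line f L S \<longleftrightarrow>
     (\<forall>p v. v \<noteq> 0 \<and> L = range (\<lambda>\<zeta>. p + \<zeta> *s v) \<longrightarrow>
        (\<lambda>\<zeta>. f (p + \<zeta> *s v)) holomorphic_on {\<zeta>. p + \<zeta> *s v \<in> S})"

lemma holomorphic_on_line_iff:
  assumes v: "v \<noteq> 0" and L: "L = range (\<lambda>\<zeta>. p + \<zeta> *s v)"
  shows "holomorphic_on_line f L S \<longleftrightarrow>
           (\<lambda>\<zeta>. f (p + \<zeta> *s v)) holomorphic_on {\<zeta>. p + \<zeta> *s v \<in> S}"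
proof
  assume hol: "(\<lambda>\<zeta>. f (p + \<zeta> *s v)) holomorphic_on {\<zeta>. p + \<zeta> *s v \<in> S}"
  show "holomorphic_on_line f L S"
    unfolding holomorphic_on_line_def
  proof (intro allI impI, elim conjE)
    fix q w assume w: "w \<noteq> 0" and Lq: "L = range (\<lambda>\<zeta>. q + \<zeta> *s w)"
    have "q + 0 *s w \<in> L" "q + 1 *s w \<in> L" unfolding Lq by blast+
    then obtain s t where "q + 0 *s w = p + s *s v" "q + 1 *s w = p + t *s v"
      unfolding L by blast
    then have s: "q = p + s *s v" and "q + w = p + t *s v" by simp_all
    then have t: "w = (t - s) *s v" by (simp add: vec_eq_iff algebra_simps)
    have eq: "q + \<zeta> *s w = p + (s + \<zeta> * (t - s)) *s v" for \<zeta>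
      unfolding s t by (simp add: vec_eq_iff algebra_simps)
    have "((\<lambda>\<zeta>. f (p + \<zeta> *s v)) \<circ> (\<lambda>\<zeta>. s + \<zeta> * (t - s))) holomorphic_on
             {\<zeta>. q + \<zeta> *s w \<in> S}"
      by (rule holomorphic_on_compose_gen[OF _ hol]) (auto simp: eq intro!: holomorphic_intros)
    then show "(\<lambda>\<zeta>. f (q + \<zeta> *s w)) holomorphic_on {\<zeta>. q + \<zeta> *s w \<in> S}"
      by (simp add: o_def eq)
  qed
next
  assume "holomorphic_on_line f L S"
  then show "(\<lambda>\<zeta>. f (p + \<zeta> *s v)) holomorphic_on {\<zeta>. p + \<zeta> *s v \<in> S}"
    using v L unfolding holomorphic_on_line_def by blast
qed

definition extends_holomorphically_along ::
    "(complex^2 \<Rightarrow> complex) \<Rightarrow> (complex^2) set \<Rightarrow> bool" where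
  "extends_holomorphically_along f L \<longleftrightarrow>
     (\<exists>g. continuous_on (L \<inter> cball 0 1) g \<and> (\<forall>z\<in>L \<inter> sphere 0 1. g z = f z) \<and>
          holomorphic_on_line g L (L \<inter> ball 0 1))"

definition extends_holomorphically_through_ball :: "(complex^2 \<Rightarrow> complex) \<Rightarrow> bool" where
  "extends_holomorphically_through_ball f \<longleftrightarrow>
     (\<exists>g. continuous_on (cball 0 1) g \<and> (\<forall>z\<in>sphere 0 1. g z = f z) \<and>
          holomorphic2_on g (ball 0 1))"


subsection \<open>Smooth functions on the sphere\<close>

text \<open>
  \<open>C_k_on k f U\<close> is meant for open \<open>U\<close>: \<open>f\<close> has continuous real partial derivatives up to
  order \<open>k\<close> on \<open>U\<close>.
\<close>

primrec C_k_on ::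
    "nat \<Rightarrow> ('a::euclidean_space \<Rightarrow> 'b::real_normed_vector) \<Rightarrow> 'a set \<Rightarrow> bool" where
  "C_k_on 0 f U \<longleftrightarrow> continuous_on U f"
| "C_k_on (Suc k) f U \<longleftrightarrow>
     (\<forall>x\<in>U. f differentiable (at x)) \<and>
     (\<forall>v. C_k_on k (\<lambda>x. frechet_derivative f (at x) v) U)"

text \<open>
  A function on the (compact, embedded) sphere is smooth iff it is the restriction of a smooth
  function, in the real sense, on an open neighbourhood of the sphere.
\<close>

definition smooth_on_sphere :: "(complex^2 \<Rightarrow> complex) \<Rightarrow> bool" where
  "smooth_on_sphere f \<longleftrightarrow>
     (\<exists>U g. open U \<and> sphere 0 1 \<subseteq> U \<and> (\<forall>k. C_k_on k g U) \<and> (\<forall>z\<in>sphere 0 1. g z = f z))"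

definition test_family :: "(complex^2) set set \<Rightarrow> bool" where
  "test_family F \<longleftrightarrow>
     (\<forall>f. smooth_on_sphere f \<and>
          (\<forall>L\<in>F. L \<inter> ball 0 1 \<noteq> {} \<longrightarrow> extends_holomorphically_along f L) \<longrightarrow>
          extends_holomorphically_through_ball f)"

end

theory Submission
  imports Defs "HOL-Complex_Analysis.Conformal_Mappings"
begin

text \<open>
  Projective automorphisms of the ball reduce (A1) and (B1) to \<open>a = (\<alpha>, 0)\<close> and
  \<open>b = (\<beta>, 0)\<close> with real \<open>\<beta> < 0 < \<alpha>\<close>. There each Fourier coefficient of \<open>f\<close> in the
  argument of \<open>z\<^sub>2\<close> is a power of \<open>z\<^sub>2\<close> or of its conjugate times a continuous function \<open>h\<close> of \<open>z\<^sub>1\<close>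
  on the closed disc, and the lines through \<open>a\<close> and \<open>b\<close> project to two families of circles along
  which \<open>h\<close>, multiplied by \<open>(z - \<alpha>) ^ n * (z - \<beta>) ^ n\<close>, satisfies all Cauchy moment conditions.
  Both families sweep out the disc with the same area integral. Testing that integral of \<open>h\<close>
  against \<open>1 / (1 - y * (z - u))\<close> gives a function of \<open>y\<close> that one family extends to a half plane
  and the other to the opposite half plane, boundedly. By Liouville's theorem it is constant, and
  the resulting moment identities make \<open>h\<close> holomorphic. The negative coefficients vanish by the
  maximum principle, and the remaining ones sum to the extension of \<open>f\<close>.

  For (A2) the quotient \<open>\<bar>1 - \<langle>z|b\<rangle>\<bar>\<^sup>2 / \<bar>1 - \<langle>z|a\<rangle>\<bar>\<^sup>2\<close> is constant on the part of the sphere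
  in each line through \<open>a\<close> or \<open>b\<close>, with different values on different lines through \<open>a\<close>. For (B2) the
  line \<open>{z. \<langle>z|p\<rangle> = 1}\<close> through \<open>a\<close> and \<open>b\<close> has its pole \<open>p\<close> in the ball. Writing
  \<open>z = x p + y a + w b\<close> in barycentric coordinates, the function
  \<open>cnj w * (\<langle>z|b\<rangle> - 1) / (\<bar>x\<bar>\<^sup>2 * (1 - \<bar>p\<bar>\<^sup>2))\<close> extends along the two pencils but
  takes the values 0 and 1 on the sphere in two lines through \<open>p\<close>.
\<close>


subsection \<open>Continuously differentiable functions\<close>

text \<open>The test integrals carry a weight \<open>1 / (1 - u * cnj z)\<^sup>2\<close> with small
  real \<open>u\<close>, up to a constant the Bergman kernel of the disc at \<open>u\<close>. On a
  circle \<open>cnj z\<close> is rational in \<open>z\<close>, so along one circle of a pencil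
  weight times Jacobian continues inside with a pole only at the reflection of \<open>1 / u\<close>.
  The moment conditions on \<open>h\<close> leave only the principal part at that point, which as a
  function of \<open>y\<close> is singular only at \<open>1 / \<delta>\<close>,
  \<open>\<delta>\<close> being the offset of the reflected point from \<open>u\<close>. For small
  \<open>u\<close> the sign of \<open>\<delta>\<close> is that of the base point of the pencil. Base
  points on opposite sides of the origin thus have their singularities on opposite rays, as
  Liouville's theorem requires. Constancy in \<open>y\<close> says that the Bergman projection of
  \<open>h * z ^ n\<close> is \<open>z ^ n\<close> times that of \<open>h\<close>, which forces
  \<open>h\<close> to be its own projection. Smoothness of \<open>f\<close> enters at the rim
  \<open>z\<^sub>2 = 0\<close>, where the coefficient of frequency \<open>n\<close> must vanish to
  order \<open>n\<close> for its quotient by \<open>z\<^sub>2 ^ n\<close> to stay bounded.\<close>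

lemma C_k_on_cong:
  assumes "open U" "\<And>x. x \<in> U \<Longrightarrow> f x = g x"
  shows "C_k_on k f U \<longleftrightarrow> C_k_on k g U"
  using assms(2)
proof (induction k arbitrary: f g)
  case 0
  then show ?case by (auto intro: continuous_on_cong)
next
  case (Suc k)
  have d: "(f has_derivative D) (at x) \<longleftrightarrow> (g has_derivative D) (at x)" if "x \<in> U" for x D
    using has_derivative_transform_within_open[OF _ \<open>open U\<close> that, of f D UNIV g]
      has_derivative_transform_within_open[OF _ \<open>open U\<close> that, of g D UNIV f] Suc.prems by auto
  then have "f differentiable (at x) \<longleftrightarrow> g differentiable (at x)"
    and "frechet_derivative f (at x) = frechet_derivative g (at x)" if "x \<in> U" for x
    using that by (auto simp: differentiable_def frechet_derivative_def)
  then show ?case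
    using Suc.IH[of "\<lambda>x. frechet_derivative f (at x) v" "\<lambda>x. frechet_derivative g (at x) v" for v]
    by auto
qed

text \<open>The closure properties below go through this rule: an explicit candidate for the
  derivative is supplied, and \<open>frechet_derivative\<close> never has to be computed.\<close>

lemma C_k_on_SucI:
  assumes "open U" "\<And>x. x \<in> U \<Longrightarrow> (f has_derivative f' x) (at x)"
    and "\<And>v. C_k_on k (\<lambda>x. f' x v) U"
  shows "C_k_on (Suc k) f U"
proof -
  have "frechet_derivative f (at x) = f' x" if "x \<in> U" for x
    using assms(2)[OF that] by (rule frechet_derivative_at[symmetric])
  then have "C_k_on k (\<lambda>x. frechet_derivative f (at x) v) U" for v
    using assms(3)[of v] C_k_on_cong[OF assms(1), of "\<lambda>x. frechet_derivative f (at x) v" "\<lambda>x. f' x v"]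
    by simp
  then show ?thesis
    using assms(2) by (auto simp: differentiable_def)
qed

lemma C_k_on_SucD:
  assumes "C_k_on (Suc k) f U" "x \<in> U"
  shows "(f has_derivative frechet_derivative f (at x)) (at x)"
  using assms by (auto simp: frechet_derivative_works)

lemma C_k_on_imp_continuous_on: "C_k_on k f U \<Longrightarrow> continuous_on U f"
  by (cases k) (auto intro!: differentiable_imp_continuous_on
      simp: differentiable_on_def differentiable_at_withinI)

lemma C_k_on_Suc_imp: "C_k_on (Suc k) f U \<Longrightarrow> C_k_on k f U"
proof (induction k arbitrary: f)
  case 0
  then show ?case using C_k_on_imp_continuous_on[OF 0] by simp
next
  case (Suc k)
  from Suc.prems have "f differentiable (at x)" if "x \<in> U" for x using that by simp
  moreover have "C_k_on k (\<lambda>x. frechet_derivative f (at x) v) U" for v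
    by (rule Suc.IH) (use Suc.prems in simp)
  ultimately show ?case by simp
qed

lemma C_k_on_const: "open U \<Longrightarrow> C_k_on k (\<lambda>x. c) U"
proof (induction k arbitrary: c)
  case (Suc k)
  show ?case
    by (rule C_k_on_SucI[where f' = "\<lambda>x v. 0"]) (use Suc in auto)
qed auto

lemma C_k_on_bounded_linear:
  assumes "open U" "bounded_linear f"
  shows "C_k_on k f U"
proof (cases k)
  case 0
  then show ?thesis using assms(2) by (simp add: linear_continuous_on)
next
  case (Suc j)
  show ?thesis unfolding Suc
    by (rule C_k_on_SucI[where f' = "\<lambda>x. f"])
      (use assms C_k_on_const in \<open>auto intro: bounded_linear_imp_has_derivative\<close>)
qed

lemma C_k_on_compose_bounded_linear:
  assumes "open U" "bounded_linear L" "C_k_on k f U"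
  shows "C_k_on k (\<lambda>x. L (f x)) U"
  using assms(3)
proof (induction k arbitrary: f)
  case 0
  then show ?case
    using assms(2) bounded_linear.continuous_on by auto
next
  case (Suc k)
  show ?case
    by (rule C_k_on_SucI[OF assms(1), where f' = "\<lambda>x v. L (frechet_derivative f (at x) v)"])
      (use Suc in \<open>auto intro!: bounded_linear.has_derivative[OF assms(2)] C_k_on_SucD[OF Suc.prems]\<close>)
qed

lemma C_k_on_add:
  assumes "open U" "C_k_on k f U" "C_k_on k g U"
  shows "C_k_on k (\<lambda>x. f x + g x) U"
  using assms(2,3)
proof (induction k arbitrary: f g)
  case 0
  then show ?case by (auto intro: continuous_intros)
next
  case (Suc k)
  show ?case
    by (rule C_k_on_SucI[OF assms(1),
          where f' = "\<lambda>x v. frechet_derivative f (at x) v + frechet_derivative g (at x) v"])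
      (use Suc in \<open>auto intro!: has_derivative_add C_k_on_SucD[OF Suc.prems(1)] C_k_on_SucD[OF Suc.prems(2)]\<close>)
qed

lemma C_k_on_sum:
  assumes "open U" "finite I" "\<And>i. i \<in> I \<Longrightarrow> C_k_on k (f i) U"
  shows "C_k_on k (\<lambda>x. \<Sum>i\<in>I. f i x) U"
  using assms(2,3) by (induction I rule: finite_induct) (auto intro: C_k_on_const C_k_on_add assms(1))

lemma C_k_on_bilinear:
  assumes "open U" "bounded_bilinear b" "C_k_on k f U" "C_k_on k g U"
  shows "C_k_on k (\<lambda>x. b (f x) (g x)) U"
  using assms(3,4)
proof (induction k arbitrary: f g)
  case 0
  then show ?case
    using bounded_bilinear.continuous_on[OF assms(2)] by auto
next
  case (Suc k)
  note C = Suc.prems[THEN C_k_on_Suc_imp]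
  show ?case
    by (rule C_k_on_SucI[OF assms(1),
          where f' = "\<lambda>x v. b (f x) (frechet_derivative g (at x) v) + b (frechet_derivative f (at x) v) (g x)"])
      (use Suc C in \<open>auto intro!: bounded_bilinear.FDERIV[OF assms(2)] C_k_on_add[OF assms(1)] C_k_on_SucD[OF Suc.prems(1)] C_k_on_SucD[OF Suc.prems(2)]\<close>)
qed

lemmas C_k_on_mult = C_k_on_bilinear[OF _ bounded_bilinear_mult]

lemma C_k_on_inverse:
  fixes f :: "'a::euclidean_space \<Rightarrow> 'b::real_normed_field"
  assumes "open U" "C_k_on k f U" "\<And>x. x \<in> U \<Longrightarrow> f x \<noteq> 0"
  shows "C_k_on k (\<lambda>x. inverse (f x)) U"
  using assms(2)
proof (induction k)
  case 0
  then show ?case using assms(3) by (auto intro: continuous_intros)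
next
  case (Suc k)
  have "C_k_on k (\<lambda>x. - (inverse (f x) * frechet_derivative f (at x) v * inverse (f x))) U" for v
    by (intro C_k_on_compose_bounded_linear[OF assms(1) bounded_linear_minus[OF bounded_linear_ident]]
        C_k_on_mult assms(1) Suc.IH C_k_on_Suc_imp[OF Suc.prems]) (use Suc.prems in auto)
  then show ?case
    by (intro C_k_on_SucI[OF assms(1), where f' = "\<lambda>x v. - (inverse (f x) * frechet_derivative f (at x) v * inverse (f x))"])
      (use assms(3) in \<open>auto intro!: Deriv.has_derivative_inverse C_k_on_SucD[OF Suc.prems]\<close>)
qed

text \<open>By the chain rule a directional derivative of the composition is a sum of components of
  the derivative of \<open>S\<close> times partial derivatives of \<open>f\<close> taken along
  \<open>S\<close>. The latter are again of the form treated, so the induction generalizes over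
  \<open>f\<close>; assuming all orders of both maps avoids bookkeeping of orders.\<close>

lemma C_k_on_compose:
  fixes f :: "'b::euclidean_space \<Rightarrow> 'c::real_normed_vector" and S :: "'a::euclidean_space \<Rightarrow> 'b"
  assumes "open U" "open V" "S ` V \<subseteq> U" "\<And>k. C_k_on k f U" "\<And>k. C_k_on k S V"
  shows "C_k_on k (\<lambda>x. f (S x)) V"
  using assms(4)
proof (induction k arbitrary: f)
  case 0
  have "continuous_on V S" "continuous_on U f"
    using assms(5)[of 0] 0[of 0] by auto
  then show ?case using assms(3) by (auto intro: continuous_on_compose2)
next
  case (Suc k)
  have der: "((\<lambda>x. f (S x)) has_derivative
      (\<lambda>v. \<Sum>b\<in>Basis. (frechet_derivative S (at x) v \<bullet> b) *\<^sub>R frechet_derivative f (at (S x)) b)) (at x)"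
    if "x \<in> V" for x
  proof -
    have 1: "(S has_derivative frechet_derivative S (at x)) (at x)"
      by (rule C_k_on_SucD[OF assms(5) that])
    have 2: "(f has_derivative frechet_derivative f (at (S x))) (at (S x))"
      by (rule C_k_on_SucD[OF Suc.prems]) (use that assms(3) in auto)
    have "linear (frechet_derivative f (at (S x)))"
      using 2 has_derivative_linear by blast
    then have eq: "frechet_derivative f (at (S x)) w = (\<Sum>b\<in>Basis. (w \<bullet> b) *\<^sub>R frechet_derivative f (at (S x)) b)" for w
      by (subst (1) euclidean_representation[of w, symmetric])
        (simp only: linear_sum linear_scale)
    show ?thesis
      using has_derivative_compose[OF 1 2] by (subst (asm) eq)
  qed
  show ?case
  proof (rule C_k_on_SucI[OF assms(2) der])
    fix v
    have "C_k_on k (\<lambda>x. frechet_derivative S (at x) v \<bullet> b) V" for b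
      by (rule C_k_on_compose_bounded_linear[OF assms(2) bounded_linear_inner_left])
        (use assms(5)[of "Suc k"] in auto)
    moreover have "C_k_on k (\<lambda>x. frechet_derivative f (at (S x)) b) V" for b
      by (rule Suc.IH) (use Suc.prems[of "Suc k" for k] in auto)
    ultimately show "C_k_on k (\<lambda>x. \<Sum>b\<in>Basis. (frechet_derivative S (at x) v \<bullet> b) *\<^sub>R frechet_derivative f (at (S x)) b) V"
      by (intro C_k_on_sum C_k_on_bilinear[OF assms(2) bounded_bilinear_scaleR] assms(2)) auto
  qed
qed

subsection \<open>Fourier coefficients and moments on circles\<close>

text \<open>One full turn has length 1, as for \<open>circlepath\<close>, so that integrals over
  \<open>{0..1}\<close> are averages over the circle.\<close>

definition ecis :: "real \<Rightarrow> complex" where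
  "ecis t = exp (2 * of_real pi * \<i> * of_real t)"

lemma ecis_eq_cis: "ecis t = cis (2 * pi * t)"
  by (simp add: ecis_def cis_conv_exp mult_ac)

lemma norm_ecis [simp]: "norm (ecis t) = 1"
  by (simp add: ecis_eq_cis)

lemma ecis_nonzero [simp]: "ecis t \<noteq> 0"
  by (simp add: ecis_eq_cis)

lemma ecis_mult_cnj [simp]: "ecis t * cnj (ecis t) = 1" "cnj (ecis t) * ecis t = 1"
  by (simp_all add: complex_norm_square[symmetric] mult.commute)

lemma cnj_ecis: "cnj (ecis t) = ecis (- t)"
  by (simp add: ecis_eq_cis cis_cnj)

lemma ecis_add: "ecis (s + t) = ecis s * ecis t"
  by (simp add: ecis_eq_cis cis_mult algebra_simps)

lemma ecis_0 [simp]: "ecis 0 = 1" and ecis_1 [simp]: "ecis 1 = 1"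
  by (simp_all add: ecis_eq_cis)

lemma ecis_power: "ecis t ^ n = ecis (real n * t)"
  by (simp add: ecis_eq_cis Complex.DeMoivre mult_ac)

lemma continuous_on_ecis [continuous_intros]:
  "continuous_on S f \<Longrightarrow> continuous_on S (\<lambda>x. ecis (f x))"
  unfolding ecis_def by (intro continuous_intros)

lemma ecis_has_vector_derivative:
  "(ecis has_vector_derivative 2 * pi * \<i> * ecis t) (at t within S)"
proof -
  have "((\<lambda>z. exp (2 * of_real pi * \<i> * z)) has_field_derivative
      exp (2 * of_real pi * \<i> * of_real t) * (2 * of_real pi * \<i>)) (at (of_real t))"
    by (auto intro!: derivative_eq_intros)
  from has_vector_derivative_real_field[OF this]
  show ?thesis by (simp add: ecis_def[abs_def] mult_ac)
qed

lemma ecis_surj: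
  assumes "norm z = 1"
  obtains t where "t \<in> {0..1}" "z = ecis t"
proof -
  have z: "z = cis (Arg2pi z)"
    using assms complex_norm_eq_1_exp_eq[of z] Arg2pi_eq[of z] by (simp add: cis_conv_exp mult.commute)
  moreover have "Arg2pi z / (2 * pi) \<in> {0..1}"
    using Arg2pi[of z] by (auto simp: field_simps)
  ultimately show thesis
    using that[of "Arg2pi z / (2 * pi)"] by (simp add: ecis_eq_cis)
qed

lemma circlepath_eq_ecis: "circlepath z r t = z + of_real r * ecis t"
  by (simp add: circlepath ecis_def)

text \<open>Two natural exponents stand in for one integer frequency because the integrands arise as
  products of powers of \<open>z\<close> and \<open>cnj z\<close>.\<close>

lemma integral_ecis_power:
  "integral {0..1} (\<lambda>t. ecis t ^ p * cnj (ecis t) ^ q) = (if p = q then 1 else 0)"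
proof (cases "p = q")
  case True
  then show ?thesis by (simp add: power_mult_distrib[symmetric])
next
  case False
  define a where "a = real p - real q"
  have a: "a \<noteq> 0" using False by (simp add: a_def)
  have eq: "ecis t ^ p * cnj (ecis t) ^ q = ecis (a * t)" for t
    by (simp add: cnj_ecis ecis_power ecis_add[symmetric] a_def algebra_simps)
  have "((\<lambda>t. ecis (a * t)) has_integral (ecis (a * 1) / (2 * pi * \<i> * a) - ecis (a * 0) / (2 * pi * \<i> * a))) {0..1}"
  proof (rule fundamental_theorem_of_calculus)
    fix x :: real
    have "((\<lambda>t. a * t) has_vector_derivative a) (at x within {0..1})"
      by (auto intro!: derivative_eq_intros simp: has_real_derivative_iff_has_vector_derivative[symmetric])
    from vector_diff_chain_within[OF this ecis_has_vector_derivative]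
    have "(ecis \<circ> (\<lambda>t. a * t) has_vector_derivative a *\<^sub>R (2 * pi * \<i> * ecis (a * x))) (at x within {0..1})" .
    then have "((\<lambda>t. (ecis \<circ> (\<lambda>t. a * t)) t / (2 * pi * \<i> * a)) has_vector_derivative
        (a *\<^sub>R (2 * pi * \<i> * ecis (a * x))) / (2 * pi * \<i> * a)) (at x within {0..1})"
      by (rule has_vector_derivative_divide)
    then show "((\<lambda>t. ecis (a * t) / (2 * pi * \<i> * a)) has_vector_derivative ecis (a * x)) (at x within {0..1})"
      using a by (simp add: scaleR_conv_of_real field_simps)
  qed auto
  moreover have "ecis a = 1"
  proof -
    have "ecis (real p) = 1" "ecis (- real q) = 1" for p q
      using ecis_power[of 1 p] ecis_power[of 1 q] cnj_ecis[of "real q"] by auto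
    then show ?thesis using ecis_add[of "real p" "- real q"] by (simp add: a_def)
  qed
  ultimately show ?thesis using False by (simp add: eq integral_unique)
qed

text \<open>The closure properties make \<open>A\<close> stable under multiplication by polynomials in \<open>z\<close> and
  \<open>cnj z\<close>, so that polynomials never have to be expanded into monomials.\<close>

lemma real_polynomial_function_mult_closed:
  fixes A :: "(complex \<Rightarrow> complex) \<Rightarrow> bool"
  assumes add: "\<And>f g. A f \<Longrightarrow> A g \<Longrightarrow> A (\<lambda>z. f z + g z)"
    and scale: "\<And>c f. A f \<Longrightarrow> A (\<lambda>z. c * f z)"
    and z: "\<And>f. A f \<Longrightarrow> A (\<lambda>z. z * f z)"
    and cnj: "\<And>f. A f \<Longrightarrow> A (\<lambda>z. cnj z * f z)"
    and "real_polynomial_function p" "A q"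
  shows "A (\<lambda>z. of_real (p z) * q z)"
  using assms(5,6)
proof (induction p arbitrary: q)
  case (linear f)
  have rep: "of_real (f z) = (of_real (f 1) / 2 - \<i> * of_real (f \<i>) / 2) * z
      + (of_real (f 1) / 2 + \<i> * of_real (f \<i>) / 2) * cnj z" for z
  proof -
    have "f z = f (Re z *\<^sub>R 1 + Im z *\<^sub>R \<i>)"
      by (rule arg_cong[where f = f]) (simp add: complex_eq_iff)
    also have "\<dots> = Re z * f 1 + Im z * f \<i>"
      using bounded_linear.linear[OF linear(1)] by (simp add: linear_add linear_scale)
    finally show ?thesis by (simp add: complex_eq_iff field_simps)
  qed
  have lin: "of_real (f z) * q z = (of_real (f 1) / 2 - \<i> * of_real (f \<i>) / 2) * (z * q z)
      + (of_real (f 1) / 2 + \<i> * of_real (f \<i>) / 2) * (cnj z * q z)" for z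
    by (subst rep) (simp only: distrib_right mult.assoc)
  show ?case
    by (subst lin) (intro add scale z cnj linear(2))
next
  case (add f g)
  have "A (\<lambda>z. of_real (f z) * q z + of_real (g z) * q z)"
    by (rule assms(1)[OF add.IH(1)[OF add.prems] add.IH(2)[OF add.prems]])
  then show ?case by (simp only: of_real_add distrib_right)
next
  case (mult f g)
  have "A (\<lambda>z. of_real (f z) * (of_real (g z) * q z))"
    by (rule mult.IH(1)[OF mult.IH(2)[OF mult.prems]])
  then show ?case by (simp only: of_real_mult mult.assoc)
next
  case (const c)
  then show ?case by (rule scale)
qed

text \<open>A property that holds for 1 and survives linear combinations and multiplication by
  \<open>z\<close> and \<open>cnj z\<close> holds for a uniform approximant of every continuous
  function. In the applications \<open>A\<close> quantifies over all monomial factors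
  \<open>z ^ i * cnj z ^ j\<close>, which turns the last two closure conditions into index
  shifts.\<close>

lemma complex_Stone_Weierstrass:
  fixes A :: "(complex \<Rightarrow> complex) \<Rightarrow> bool"
  assumes add: "\<And>f g. A f \<Longrightarrow> A g \<Longrightarrow> A (\<lambda>z. f z + g z)"
    and scale: "\<And>c f. A f \<Longrightarrow> A (\<lambda>z. c * f z)"
    and z: "\<And>f. A f \<Longrightarrow> A (\<lambda>z. z * f z)"
    and cnj: "\<And>f. A f \<Longrightarrow> A (\<lambda>z. cnj z * f z)"
    and one: "A (\<lambda>z. 1)"
    and S: "compact S" "continuous_on S g" and e: "e > 0"
  shows "\<exists>f. A f \<and> continuous_on S f \<and> (\<forall>z\<in>S. norm (g z - f z) < e)"
proof -
  obtain f where f: "polynomial_function f" "\<forall>z\<in>S. norm (g z - f z) < e"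
    using Stone_Weierstrass_polynomial_function[OF S e] by blast
  have "real_polynomial_function (Re \<circ> f)" "real_polynomial_function (Im \<circ> f)"
    using f(1) bounded_linear_Re bounded_linear_Im unfolding polynomial_function_def by blast+
  moreover have "A (\<lambda>z. of_real (p z) * 1)" if "real_polynomial_function p" for p
    by (rule real_polynomial_function_mult_closed[where A = A and q = "\<lambda>z. 1", OF _ _ _ _ that one])
      (rule add scale z cnj; assumption)+
  ultimately have "A (\<lambda>z. of_real ((Re \<circ> f) z) * 1)" "A (\<lambda>z. of_real ((Im \<circ> f) z) * 1)"
    by blast+
  then have "A (\<lambda>z. of_real ((Re \<circ> f) z) * 1 + \<i> * (of_real ((Im \<circ> f) z) * 1))"
    by (rule add[OF _ scale])
  moreover have "(\<lambda>z. of_real ((Re \<circ> f) z) * 1 + \<i> * (of_real ((Im \<circ> f) z) * 1)) = f"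
    by (simp add: fun_eq_iff complex_eq_iff)
  ultimately have "A f"
    by simp
  moreover have "continuous_on S f"
    using f(1) by (rule continuous_on_polymonial_function)
  ultimately show ?thesis using f(2) by blast
qed

text \<open>The function is orthogonal to all polynomials in \<open>z\<close> and
  \<open>cnj z\<close>, hence to uniform approximants of its own conjugate. So its squared modulus
  integrates to zero, and by continuity it vanishes at every point.\<close>

lemma circle_fourier_unique:
  assumes "continuous_on (sphere 0 1) \<phi>"
    and "\<And>i j. integral {0..1} (\<lambda>t. \<phi> (ecis t) * (ecis t ^ i * cnj (ecis t) ^ j)) = 0"
    and "norm z = 1"
  shows "\<phi> z = 0"
proof -
  have cont: "continuous_on {0..1} (\<lambda>t. q (ecis t))" if "continuous_on (sphere 0 1) q" for q :: "complex \<Rightarrow> complex"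
    by (rule continuous_on_compose2[OF that]) (auto intro: continuous_intros)
  define A where "A q \<longleftrightarrow> continuous_on (sphere 0 1) q \<and>
    (\<forall>i j. integral {0..1} (\<lambda>t. \<phi> (ecis t) * q (ecis t) * (ecis t ^ i * cnj (ecis t) ^ j)) = 0)"
    for q :: "complex \<Rightarrow> complex"
  have int: "(\<lambda>t. \<phi> (ecis t) * q (ecis t) * (ecis t ^ i * cnj (ecis t) ^ j)) integrable_on {0..1}"
    if "continuous_on (sphere 0 1) q" for q i j
    by (intro integrable_continuous_real continuous_intros cont assms(1) that)
  have Aadd: "A (\<lambda>z. f z + g z)" if "A f" "A g" for f g
  proof -
    have eq: "\<phi> z * (f z + g z) * w = \<phi> z * f z * w + \<phi> z * g z * w" for z w
      by (simp add: algebra_simps)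
    show ?thesis
      using that unfolding A_def eq by (simp add: integral_add int continuous_on_add)
  qed
  have Ascale: "A (\<lambda>z. c * f z)" if "A f" for f c
  proof -
    have eq: "\<phi> z * (c * f z) * w = c * (\<phi> z * f z * w)" for z w
      by (simp add: mult_ac)
    show ?thesis
      using that unfolding A_def eq by (simp add: continuous_on_mult)
  qed
  have Az: "A (\<lambda>z. z * f z)" if "A f" for f
  proof -
    have "\<phi> z * (z * f z) * (z ^ i * cnj z ^ j) = \<phi> z * f z * (z ^ Suc i * cnj z ^ j)" for z i j
      by (simp add: mult_ac)
    then show ?thesis
      using that unfolding A_def by (simp only: continuous_on_mult continuous_on_id) blast
  qed
  have Acnj: "A (\<lambda>z. cnj z * f z)" if "A f" for f
  proof -
    have "\<phi> z * (cnj z * f z) * (z ^ i * cnj z ^ j) = \<phi> z * f z * (z ^ i * cnj z ^ Suc j)" for z i j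
      by (simp add: mult_ac)
    then show ?thesis
      using that unfolding A_def by (simp only: continuous_on_mult continuous_on_cnj continuous_on_id) blast
  qed
  have A1: "A (\<lambda>z. 1)" using assms(2) by (simp add: A_def)
  define I where "I = integral {0..1} (\<lambda>t. norm (\<phi> (ecis t)) ^ 2)"
  define M where "M = integral {0..1} (\<lambda>t. norm (\<phi> (ecis t)))"
  \<comment> \<open>The pairing of \<open>\<phi>\<close> with the approximant is zero; only the
    approximation error contributes to \<open>I\<close>.\<close>
  have I: "I \<le> e * M" if e: "e > 0" for e
  proof -
    have "\<exists>q. A q \<and> continuous_on (sphere 0 1) q \<and> (\<forall>z\<in>sphere 0 1. norm (cnj (\<phi> z) - q z) < e)"
    proof (rule complex_Stone_Weierstrass[where A = A, OF _ _ _ _ A1 compact_sphere _ e])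
      show "continuous_on (sphere 0 1) (\<lambda>z. cnj (\<phi> z))"
        by (intro continuous_intros assms(1))
    qed (rule Aadd Ascale Az Acnj; assumption)+
    then obtain q where q: "A q" "continuous_on (sphere 0 1) q"
      "\<And>z. z \<in> sphere 0 1 \<Longrightarrow> norm (cnj (\<phi> z) - q z) < e"
      by blast
    have "((\<lambda>t. norm (\<phi> (ecis t)) ^ 2) has_integral I) {0..1}"
      unfolding I_def by (intro integrable_integral integrable_continuous_real continuous_intros cont assms(1))
    from has_integral_of_real[OF this, where 'b = complex]
    have "of_real I = integral {0..1} (\<lambda>t. \<phi> (ecis t) * cnj (\<phi> (ecis t)))"
      by (simp add: complex_norm_square[symmetric] integral_unique)
    also have "\<dots> = integral {0..1} (\<lambda>t. \<phi> (ecis t) * cnj (\<phi> (ecis t))) -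
        integral {0..1} (\<lambda>t. \<phi> (ecis t) * q (ecis t))"
      using q(1)[unfolded A_def, THEN conjunct2, rule_format, of 0 0] by simp
    also have "\<dots> = integral {0..1} (\<lambda>t. \<phi> (ecis t) * (cnj (\<phi> (ecis t)) - q (ecis t)))"
      by (subst integral_diff[symmetric])
        (auto intro!: integrable_continuous_real continuous_intros cont assms(1) q(2) simp: algebra_simps)
    finally have "norm (complex_of_real I) = norm (integral {0..1} (\<lambda>t. \<phi> (ecis t) * (cnj (\<phi> (ecis t)) - q (ecis t))))"
      by simp
    also have "\<dots> \<le> integral {0..1} (\<lambda>t. e * norm (\<phi> (ecis t)))"
    proof (rule integral_norm_bound_integral)
      show "(\<lambda>t. \<phi> (ecis t) * (cnj (\<phi> (ecis t)) - q (ecis t))) integrable_on {0..1}"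
        by (intro integrable_continuous_real continuous_intros cont assms(1) q(2))
      show "(\<lambda>t. e * norm (\<phi> (ecis t))) integrable_on {0..1}"
        by (intro integrable_continuous_real continuous_intros cont assms(1))
      fix t :: real
      have "norm (cnj (\<phi> (ecis t)) - q (ecis t)) \<le> e" using q(3)[of "ecis t"] by simp
      then show "norm (\<phi> (ecis t) * (cnj (\<phi> (ecis t)) - q (ecis t))) \<le> e * norm (\<phi> (ecis t))"
        unfolding norm_mult by (subst mult.commute) (rule mult_right_mono, auto)
    qed
    finally show ?thesis by (simp add: M_def)
  qed
  have M0: "M \<ge> 0" unfolding M_def by (rule integral_nonneg)
      (auto intro!: integrable_continuous_real continuous_intros cont assms(1))
  have "I \<le> 0"
  proof (rule field_le_epsilon)
    fix e :: real assume "e > 0"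
    then have "I \<le> e / (M + 1) * M" using M0 by (intro I) auto
    also have "\<dots> \<le> e" using M0 \<open>e > 0\<close> by (simp add: field_simps)
    finally show "I \<le> 0 + e" by simp
  qed
  obtain t0 where t0: "t0 \<in> {0..1}" "z = ecis t0" using ecis_surj assms(3) by blast
  have c: "continuous_on (cbox 0 1) (\<lambda>t. norm (\<phi> (ecis t)) ^ 2)"
    by (auto intro!: continuous_intros cont assms(1))
  then have "((\<lambda>t. norm (\<phi> (ecis t)) ^ 2) has_integral I) (cbox 0 1)"
    unfolding I_def by (simp add: integrable_integral integrable_continuous_real)
  moreover have "I = 0"
  proof (rule antisym[OF \<open>I \<le> 0\<close>])
    show "0 \<le> I" unfolding I_def
      by (rule integral_nonneg) (auto intro!: integrable_continuous_real continuous_intros cont assms(1))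
  qed
  ultimately have "norm (\<phi> (ecis t0)) ^ 2 = 0"
    using has_integral_0_cbox_imp_0[OF c, of t0] t0(1) by auto
  then show ?thesis using t0(2) by simp
qed

text \<open>The argument of \<open>circle_fourier_unique\<close> with Weierstrass approximation on
  the interval, applied to real and imaginary part.\<close>

lemma moments_unique:
  fixes f :: "real \<Rightarrow> complex"
  assumes "continuous_on {0..1} f"
    and "\<And>p. integral {0..1} (\<lambda>s. f s * of_real (s ^ p)) = 0"
    and "s \<in> {0..1}"
  shows "f s = 0"
proof -
  have zero: "g s = 0" if g: "continuous_on {0..1} g" and
    mom: "\<And>p. integral {0..1} (\<lambda>s. g s * s ^ p) = 0" for g :: "real \<Rightarrow> real"
  proof -
    define I where "I = integral {0..1} (\<lambda>s. g s ^ 2)"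
    define M where "M = integral {0..1} (\<lambda>s. \<bar>g s\<bar>)"
    have I: "I \<le> e * M" if "e > 0" for e
    proof -
      obtain q where q: "real_polynomial_function q" "\<And>x. x \<in> {0..1} \<Longrightarrow> \<bar>g x - q x\<bar> < e"
        using Stone_Weierstrass_real_polynomial_function[of "{0..1}" g e] g \<open>e > 0\<close> by blast
      obtain a n where qs: "q = (\<lambda>x. \<Sum>i\<le>n. a i * x ^ i)"
        using q(1) real_polynomial_function_iff_sum by blast
      have "integral {0..1} (\<lambda>s. g s * q s) = integral {0..1} (\<lambda>s. \<Sum>i\<le>n. a i * (g s * s ^ i))"
        unfolding qs sum_distrib_left by (simp only: mult.left_commute)
      also have "\<dots> = (\<Sum>i\<le>n. a i * integral {0..1} (\<lambda>s. g s * s ^ i))"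
        by (subst integral_sum) (auto intro!: integrable_continuous_real continuous_intros g)
      finally have z: "integral {0..1} (\<lambda>s. g s * q s) = 0" by (simp add: mom)
      have cq: "continuous_on {0..1} q" unfolding qs by (intro continuous_intros)
      have "I = integral {0..1} (\<lambda>s. g s * (g s - q s))"
        unfolding I_def right_diff_distrib power2_eq_square using z
        by (subst integral_diff) (auto intro!: integrable_continuous_real continuous_on_mult g cq)
      also have "\<dots> \<le> integral {0..1} (\<lambda>s. e * \<bar>g s\<bar>)"
      proof (rule integral_le)
        fix x :: real assume "x \<in> {0..1}"
        have "g x * (g x - q x) \<le> \<bar>g x\<bar> * \<bar>g x - q x\<bar>" by (simp add: abs_mult[symmetric])
        also have "\<dots> \<le> \<bar>g x\<bar> * e" using q(2)[OF \<open>x \<in> {0..1}\<close>] by (intro mult_left_mono) auto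
        finally show "g x * (g x - q x) \<le> e * \<bar>g x\<bar>" by (simp add: mult.commute)
      qed (auto intro!: integrable_continuous_real continuous_intros g cq)
      finally show ?thesis by (simp add: M_def)
    qed
    have M0: "M \<ge> 0" unfolding M_def by (rule integral_nonneg)
        (auto intro!: integrable_continuous_real continuous_intros g)
    have "I \<le> 0"
    proof (rule field_le_epsilon)
      fix e :: real assume "e > 0"
      then have "I \<le> e / (M + 1) * M" using M0 by (intro I) auto
      also have "\<dots> \<le> e" using M0 \<open>e > 0\<close> by (simp add: field_simps)
      finally show "I \<le> 0 + e" by simp
    qed
    have c: "continuous_on (cbox 0 1) (\<lambda>s. g s ^ 2)"
      by (auto intro!: continuous_intros g)
    then have "((\<lambda>s. g s ^ 2) has_integral I) (cbox 0 1)"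
      unfolding I_def by (simp add: integrable_integral integrable_continuous_real)
    moreover have "I = 0"
    proof (rule antisym[OF \<open>I \<le> 0\<close>])
      show "0 \<le> I" unfolding I_def
        by (rule integral_nonneg) (auto intro!: integrable_continuous_real continuous_intros g)
    qed
    ultimately have "g s ^ 2 = 0"
      using has_integral_0_cbox_imp_0[OF c, of s] assms(3) by auto
    then show ?thesis by simp
  qed
  have int: "(\<lambda>s. f s * of_real (s ^ p)) integrable_on {0..1}" for p
    by (intro integrable_continuous_real continuous_intros assms(1))
  have "((\<lambda>s. f s * of_real (s ^ p)) has_integral 0) {0..1}" for p
    using integrable_integral[OF int[of p]] assms(2)[of p] by simp
  note has_integral_Re[OF this] has_integral_Im[OF this]
  then have "integral {0..1} (\<lambda>s. Re (f s) * s ^ p) = 0" "integral {0..1} (\<lambda>s. Im (f s) * s ^ p) = 0" for p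
    by (simp_all add: integral_unique Re_divide_of_real flip: of_real_power)
  then have "Re (f s) = 0" "Im (f s) = 0"
    by (auto intro!: zero[of "\<lambda>s. Re (f s)"] zero[of "\<lambda>s. Im (f s)"] continuous_intros assms(1))
  then show ?thesis by (simp add: complex_eq_iff)
qed

subsection \<open>Pencils of circles in the disc\<close>

text \<open>The line of slope \<open>c\<close> through \<open>(\<alpha>, 0)\<close> meets the sphere
  in a curve whose projection to the first coordinate is a circle. With
  \<open>s = 1 / (1 + \<bar>c\<bar>\<^sup>2)\<close> its centre is \<open>(1 - s) * \<alpha>\<close>
  and its squared radius is this polynomial in \<open>s\<close>; \<open>s = 1\<close> gives the unit
  circle.\<close>

definition rad2 :: "real \<Rightarrow> real \<Rightarrow> real" where
  "rad2 \<alpha> s = s - s * (1 - s) * \<alpha>\<^sup>2"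

definition rad :: "real \<Rightarrow> real \<Rightarrow> real" where
  "rad \<alpha> s = sqrt (rad2 \<alpha> s)"

text \<open>Half the derivative of \<open>rad2\<close>, that is \<open>rad\<close> times its
  derivative, in a form that stays regular where the radius vanishes.\<close>

definition drad :: "real \<Rightarrow> real \<Rightarrow> real" where
  "drad \<alpha> s = (1 - \<alpha>\<^sup>2 * (1 - 2 * s)) / 2"

text \<open>The parameter at which the circle degenerates to a point: to \<open>\<alpha>\<close> if
  \<open>\<bar>\<alpha>\<bar> \<le> 1\<close>, and otherwise to \<open>1 / \<alpha>\<close>, where
  the lines of the pencil become tangent to the sphere.\<close>

definition start :: "real \<Rightarrow> real" where
  "start \<alpha> = (if \<alpha>\<^sup>2 \<le> 1 then 0 else 1 - 1 / \<alpha>\<^sup>2)"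

definition circ :: "real \<Rightarrow> real \<Rightarrow> real \<Rightarrow> complex" where
  "circ \<alpha> s t = of_real ((1 - s) * \<alpha>) + of_real (rad \<alpha> s) * ecis t"

text \<open>The Jacobian determinant of \<open>circ \<alpha>\<close> divided by
  \<open>2 * pi\<close>. Hence \<open>disc_int\<close> is meant to be the area integral over the
  disc divided by \<open>2 * pi\<close>, whatever \<open>\<alpha>\<close> is.\<close>

definition jac :: "real \<Rightarrow> real \<Rightarrow> real \<Rightarrow> real" where
  "jac \<alpha> s t = drad \<alpha> s - \<alpha> * rad \<alpha> s * Re (ecis t)"

definition disc_int :: "real \<Rightarrow> (complex \<Rightarrow> complex) \<Rightarrow> complex" where
  "disc_int \<alpha> g = integral (cbox (start \<alpha>, 0) (1, 1)) (\<lambda>(s, t). g (circ \<alpha> s t) * of_real (jac \<alpha> s t))"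

lemma start_bounds: "0 \<le> start \<alpha>" "start \<alpha> < 1"
proof -
  have "0 < 1 / \<alpha>\<^sup>2 \<and> 1 / \<alpha>\<^sup>2 \<le> 1" if "\<not> \<alpha>\<^sup>2 \<le> 1"
    using that zero_less_power2[of \<alpha>] by (auto simp: divide_le_eq_1)
  then show "0 \<le> start \<alpha>" "start \<alpha> < 1"
    by (auto simp: start_def)
qed

lemma start_sq: "s \<ge> start \<alpha> \<Longrightarrow> s \<le> 1 \<Longrightarrow> (1 - s) * \<alpha>\<^sup>2 \<le> 1"
  and start_sq_less: "s > start \<alpha> \<Longrightarrow> s \<le> 1 \<Longrightarrow> (1 - s) * \<alpha>\<^sup>2 < 1"
proof -
  assume s: "s \<ge> start \<alpha>" "s \<le> 1"
  show "(1 - s) * \<alpha>\<^sup>2 \<le> 1"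
  proof (cases "\<alpha>\<^sup>2 \<le> 1")
    case True
    then have "(1 - s) * \<alpha>\<^sup>2 \<le> 1 * 1" using s by (intro mult_mono) (auto simp: start_def)
    then show ?thesis by simp
  next
    case False
    then have "1 - s \<le> 1 / \<alpha>\<^sup>2" using s by (simp add: start_def)
    from mult_right_mono[OF this, of "\<alpha>\<^sup>2"] show ?thesis using False by (auto split: if_splits)
  qed
next
  assume s: "s > start \<alpha>" "s \<le> 1"
  show "(1 - s) * \<alpha>\<^sup>2 < 1"
  proof (cases "\<alpha>\<^sup>2 \<le> 1")
    case True
    then have "(1 - s) * \<alpha>\<^sup>2 \<le> (1 - s) * 1" using s by (intro mult_left_mono) auto
    then show ?thesis using s True by (simp add: start_def)
  next
    case False
    then have "1 - s < 1 / \<alpha>\<^sup>2" using s by (simp add: start_def)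
    moreover have "\<alpha> \<noteq> 0" using False by auto
    ultimately show ?thesis using mult_strict_right_mono[of "1 - s" "1 / \<alpha>\<^sup>2" "\<alpha>\<^sup>2"] by simp
  qed
qed

lemma rad2_eq: "rad2 \<alpha> s = s * (1 - (1 - s) * \<alpha>\<^sup>2)"
  by (simp add: rad2_def algebra_simps)

lemma rad2_nonneg: "s \<in> {start \<alpha>..1} \<Longrightarrow> 0 \<le> rad2 \<alpha> s"
  using start_bounds[of \<alpha>] start_sq[of \<alpha> s] by (auto simp: rad2_eq)

lemma rad2_pos: "s \<in> {start \<alpha><..1} \<Longrightarrow> 0 < rad2 \<alpha> s"
  using start_bounds[of \<alpha>] start_sq_less[of \<alpha> s] by (auto simp: rad2_eq)

lemma rad_nonneg: "s \<in> {start \<alpha>..1} \<Longrightarrow> 0 \<le> rad \<alpha> s"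
  by (simp add: rad_def rad2_nonneg)

lemma rad_pos: "s \<in> {start \<alpha><..1} \<Longrightarrow> 0 < rad \<alpha> s"
  by (simp add: rad_def rad2_pos)

lemma rad_sq: "s \<in> {start \<alpha>..1} \<Longrightarrow> (rad \<alpha> s)\<^sup>2 = rad2 \<alpha> s"
  by (simp add: rad_def rad2_nonneg)

lemma rad_start [simp]: "rad \<alpha> (start \<alpha>) = 0"
  by (simp add: rad_def rad2_eq start_def)

lemma rad_1 [simp]: "rad \<alpha> 1 = 1"
  by (simp add: rad_def rad2_def)

text \<open>The circle stays in the closed unit disc because \<open>(1 - \<bar>(1 - s) *
  \<alpha>\<bar>)\<^sup>2 - rad2 \<alpha> s\<close> equals
  \<open>(1 - s) * (1 - \<bar>\<alpha>\<bar>)\<^sup>2\<close>, which is nonnegative for base points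
  inside and outside the disc alike.\<close>

lemma center_plus_rad: 
  assumes "s \<in> {start \<alpha>..1}"
  shows "\<bar>(1 - s) * \<alpha>\<bar> + rad \<alpha> s \<le> 1"
proof -
  have s: "0 \<le> s" "s \<le> 1" using assms start_bounds[of \<alpha>] by auto
  have "((1 - s) * \<alpha>)\<^sup>2 = (1 - s) * ((1 - s) * \<alpha>\<^sup>2)" by (simp add: power2_eq_square algebra_simps)
  also have "\<dots> \<le> 1 * 1" using s assms start_sq[of \<alpha> s] by (intro mult_mono) auto
  finally have c: "\<bar>(1 - s) * \<alpha>\<bar> \<le> 1" using abs_le_square_iff[of "(1 - s) * \<alpha>" 1] by simp
  have "(1 - \<bar>(1 - s) * \<alpha>\<bar>)\<^sup>2 - rad2 \<alpha> s = (1 - s) * (1 - \<bar>\<alpha>\<bar>)\<^sup>2"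
  proof -
    have "\<bar>(1 - s) * \<alpha>\<bar> = (1 - s) * \<bar>\<alpha>\<bar>" using s by (simp add: abs_mult)
    moreover have "\<alpha>\<^sup>2 = \<bar>\<alpha>\<bar>\<^sup>2" by simp
    ultimately show ?thesis unfolding rad2_def by (simp only:) (simp add: power2_eq_square algebra_simps)
  qed
  also have "\<dots> \<ge> 0" using s by simp
  finally have "rad \<alpha> s \<le> 1 - \<bar>(1 - s) * \<alpha>\<bar>"
    unfolding rad_def using c by (intro real_le_lsqrt) auto
  then show ?thesis by simp
qed

lemma norm_circ_le: "s \<in> {start \<alpha>..1} \<Longrightarrow> norm (circ \<alpha> s t) \<le> 1"
  using norm_triangle_ineq[of "of_real ((1 - s) * \<alpha>)" "of_real (rad \<alpha> s) * ecis t"]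
    center_plus_rad[of s \<alpha>] rad_nonneg[of s \<alpha>] 
  unfolding circ_def norm_mult norm_of_real by simp

lemma continuous_on_rad [continuous_intros]:
  "continuous_on S f \<Longrightarrow> continuous_on S (\<lambda>x. rad \<alpha> (f x))"
  unfolding rad_def rad2_def by (intro continuous_intros)

lemma continuous_on_circ [continuous_intros]:
  "continuous_on S f \<Longrightarrow> continuous_on S g \<Longrightarrow> continuous_on S (\<lambda>x. circ \<alpha> (f x) (g x))"
  unfolding circ_def by (intro continuous_intros)

lemma continuous_on_drad [continuous_intros]:
  "continuous_on S f \<Longrightarrow> continuous_on S (\<lambda>x. drad \<alpha> (f x))"
  unfolding drad_def by (intro continuous_intros) auto

lemma continuous_on_jac [continuous_intros]:
  "continuous_on S f \<Longrightarrow> continuous_on S g \<Longrightarrow> continuous_on S (\<lambda>x. jac \<alpha> (f x) (g x))"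
  unfolding jac_def by (intro continuous_intros)

lemma mem_box_start: "x \<in> cbox (start \<alpha>, 0) (1, 1) \<longleftrightarrow> fst x \<in> {start \<alpha>..1} \<and> snd x \<in> {0..1::real}"
  by (cases x) (auto simp: cbox_Pair_eq)

lemma continuous_on_box_circ:
  assumes "continuous_on (cball 0 1) g"
  shows "continuous_on (cbox (start \<alpha>, 0) (1, 1)) (\<lambda>x. g (circ \<alpha> (fst x) (snd x)))"
  by (rule continuous_on_compose2[OF assms])
    (auto intro!: continuous_intros norm_circ_le simp: mem_box_start dist_norm)

lemma disc_int_integrable:
  fixes g :: "complex \<Rightarrow> complex"
  assumes "continuous_on (cball 0 1) g"
  shows "(\<lambda>(s, t). g (circ \<alpha> s t) * of_real (jac \<alpha> s t)) integrable_on cbox (start \<alpha>, 0) (1, 1)"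
  unfolding case_prod_unfold
  by (intro integrable_continuous continuous_intros continuous_on_box_circ assms)

lemma disc_int_add:
  assumes "continuous_on (cball 0 1) f" "continuous_on (cball 0 1) g"
  shows "disc_int \<alpha> (\<lambda>z. f z + g z) = disc_int \<alpha> f + disc_int \<alpha> g"
  using integral_add[OF disc_int_integrable[OF assms(1)] disc_int_integrable[OF assms(2)], of \<alpha>]
  by (simp add: disc_int_def case_prod_unfold algebra_simps)

lemma disc_int_cmult:
  "disc_int \<alpha> (\<lambda>z. c * f z) = c * disc_int \<alpha> f"
proof -
  have "disc_int \<alpha> (\<lambda>z. c * f z) = integral (cbox (start \<alpha>, 0) (1, 1))
      (\<lambda>x. c * (case x of (s, t) \<Rightarrow> f (circ \<alpha> s t) * of_real (jac \<alpha> s t)))"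
    unfolding disc_int_def by (simp add: case_prod_unfold mult.assoc)
  also have "\<dots> = c * disc_int \<alpha> f"
    unfolding disc_int_def by (rule integral_mult_right)
  finally show ?thesis .
qed

lemma disc_int_eq_iterated:
  assumes "continuous_on (cball 0 1) g"
  shows "disc_int \<alpha> g = integral {start \<alpha>..1} (\<lambda>s. integral {0..1} (\<lambda>t. g (circ \<alpha> s t) * of_real (jac \<alpha> s t)))"
proof -
  have "continuous_on (cbox (start \<alpha>, 0) (1, 1)) (\<lambda>(s, t). g (circ \<alpha> s t) * of_real (jac \<alpha> s t))"
    unfolding case_prod_unfold
    by (intro integrable_continuous continuous_intros continuous_on_box_circ assms)
  from integral_prod_continuous[OF this] show ?thesis
    by (simp add: disc_int_def)
qed

lemma rad_has_vector_derivative: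
  assumes "s \<in> {start \<alpha><..<1}"
  shows "((\<lambda>s. complex_of_real (rad \<alpha> s)) has_vector_derivative of_real (drad \<alpha> s / rad \<alpha> s)) (at s)"
proof -
  have "rad2 \<alpha> s > 0" using rad2_pos[of s \<alpha>] assms by auto
  then have "(rad \<alpha> has_real_derivative drad \<alpha> s / rad \<alpha> s) (at s)"
    unfolding rad_def rad2_def drad_def
    by (auto intro!: derivative_eq_intros simp: rad2_def field_simps power2_eq_square)
  then show ?thesis
    by (intro has_vector_derivative_of_real) (simp add: has_real_derivative_iff_has_vector_derivative)
qed

lemma power_has_vector_derivative:
  fixes f :: "real \<Rightarrow> complex"
  assumes "(f has_vector_derivative f') (at s within S)"
  shows "((\<lambda>s. f s ^ n) has_vector_derivative of_nat n * f s ^ (n - 1) * f') (at s within S)"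
proof -
  have "((\<lambda>z. z ^ n) has_field_derivative of_nat n * f s ^ (n - 1)) (at (f s) within f ` S)"
    by (auto intro!: derivative_eq_intros)
  from field_vector_diff_chain_within[OF assms this] show ?thesis
    by (simp add: o_def mult_ac)
qed

lemma cnj_has_vector_derivative:
  "(f has_vector_derivative f') F \<Longrightarrow> ((\<lambda>s. cnj (f s)) has_vector_derivative cnj f') F"
  by (rule bounded_linear.has_vector_derivative[OF bounded_linear_cnj])

text \<open>Green's formula for \<open>z ^ p * cnj z ^ Q\<close> between two circles of the pencil: up to an exact
  \<open>t\<close>-derivative, the \<open>s\<close>-derivative of \<open>z ^ p * cnj z ^ Q dz\<close> is \<open>2 * Q * z ^ p * cnj z ^ (Q - 1)\<close> times the area form.\<close>

lemma circle_integral_deriv: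
  assumes s: "s \<in> {start \<alpha><..<1}"
  shows "((\<lambda>s. integral {0..1} (\<lambda>t. circ \<alpha> s t ^ p * cnj (circ \<alpha> s t) ^ Suc q * (of_real (rad \<alpha> s) * ecis t)))
    has_vector_derivative integral {0..1} (\<lambda>t. 2 * of_nat (Suc q) * (circ \<alpha> s t ^ p * cnj (circ \<alpha> s t) ^ q * of_real (jac \<alpha> s t)))) (at s)"
proof -
  define R' where "R' s = complex_of_real (drad \<alpha> s / rad \<alpha> s)" for s
  define zs where "zs s t = - of_real \<alpha> + R' s * ecis t" for s t
  define z where "z = circ \<alpha>"
  define R where "R s = complex_of_real (rad \<alpha> s)" for s
  define F where "F s t = z s t ^ p * cnj (z s t) ^ Suc q * (R s * ecis t)" for s t
  define Fs where "Fs s t = z s t ^ p * cnj (z s t) ^ Suc q * (R' s * ecis t) +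
    (z s t ^ p * (of_nat (Suc q) * cnj (z s t) ^ q * cnj (zs s t)) +
     (of_nat p * z s t ^ (p - 1) * zs s t) * cnj (z s t) ^ Suc q) * (R s * ecis t)" for s t
  \<comment> \<open>\<open>F\<close> and \<open>G\<close> are the \<open>t\<close>- and the
    \<open>s\<close>-component of the form \<open>z ^ p * cnj z ^ Suc q dz\<close>, each divided by
    \<open>2 * pi * \<i>\<close>. So \<open>Fs - Gt\<close> is the coefficient of the exterior
    derivative, and the integral of \<open>Gt\<close> vanishes because \<open>G\<close> is periodic
    in \<open>t\<close>.\<close>
  define G where "G s t = z s t ^ p * cnj (z s t) ^ Suc q * zs s t / (2 * pi * \<i>)" for s t
  define Gt where "Gt s t = (z s t ^ p * cnj (z s t) ^ Suc q * (R' s * (2 * pi * \<i> * ecis t)) +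
    (z s t ^ p * (of_nat (Suc q) * cnj (z s t) ^ q * cnj (R s * (2 * pi * \<i> * ecis t))) +
     (of_nat p * z s t ^ (p - 1) * (R s * (2 * pi * \<i> * ecis t))) * cnj (z s t) ^ Suc q) * zs s t) / (2 * pi * \<i>)" for s t
  have Rd: "(R has_vector_derivative R' s) (at s)" if "s \<in> {start \<alpha><..<1}" for s
    using rad_has_vector_derivative[OF that] by (simp add: R_def[abs_def] R'_def)
  have zd: "((\<lambda>s. z s t) has_vector_derivative zs s t) (at s)" if "s \<in> {start \<alpha><..<1}" for s t
  proof -
    have "((\<lambda>s. complex_of_real ((1 - s) * \<alpha>)) has_vector_derivative of_real (- \<alpha>)) (at s)"
      by (rule has_vector_derivative_of_real)
        (auto intro!: derivative_eq_intros simp: has_real_derivative_iff_has_vector_derivative[symmetric])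
    from has_vector_derivative_add[OF this has_vector_derivative_mult_left[OF Rd[OF that], of "ecis t"]]
    show ?thesis by (simp add: z_def circ_def[abs_def] zs_def R_def)
  qed
  have Fd: "((\<lambda>s. F s t) has_vector_derivative Fs s t) (at s)" if "s \<in> {start \<alpha><..<1}" for s t
  proof -
    note m = power_has_vector_derivative[OF zd[OF that], of t p]
      power_has_vector_derivative[OF cnj_has_vector_derivative[OF zd[OF that]], of t "Suc q"]
    show ?thesis
      unfolding F_def Fs_def
      using has_vector_derivative_mult[OF has_vector_derivative_mult[OF m]
          has_vector_derivative_mult_left[OF Rd[OF that], of "ecis t"]] by simp
  qed
  have tz: "((\<lambda>t. z s t) has_vector_derivative R s * (2 * pi * \<i> * ecis t)) (at t within T)" for s t T
    unfolding z_def circ_def R_def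
    using has_vector_derivative_add[OF has_vector_derivative_const
        has_vector_derivative_mult_right[OF ecis_has_vector_derivative]] by simp
  have tzs: "((\<lambda>t. zs s t) has_vector_derivative R' s * (2 * pi * \<i> * ecis t)) (at t within T)" for s t T
    unfolding zs_def
    using has_vector_derivative_add[OF has_vector_derivative_const[of "- complex_of_real \<alpha>"]
        has_vector_derivative_mult_right[OF ecis_has_vector_derivative]] by simp
  have Gd: "((\<lambda>t. G s t) has_vector_derivative Gt s t) (at t within T)" for s t T
  proof -
    note m = power_has_vector_derivative[OF tz, of s p t T]
      power_has_vector_derivative[OF cnj_has_vector_derivative[OF tz], of s "Suc q" t T]
    show ?thesis
      unfolding G_def Gt_def
      using has_vector_derivative_divide[OF has_vector_derivative_mult[OF has_vector_derivative_mult[OF m] tzs], where a = "2 * of_real pi * \<i>"]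
      by simp
  qed
  have eq: "Fs s t = 2 * of_nat (Suc q) * (z s t ^ p * cnj (z s t) ^ q * of_real (jac \<alpha> s t)) + Gt s t" for t
  proof -
    have R0: "R s \<noteq> 0" and RR: "R s * R' s = of_real (drad \<alpha> s)"
      using rad_pos[of s \<alpha>] s by (auto simp: R_def R'_def)
    have J: "of_real (jac \<alpha> s t) = of_real (drad \<alpha> s) - of_real \<alpha> * R s * (ecis t + cnj (ecis t)) / 2"
      unfolding jac_def R_def by (simp add: complex_add_cnj)
    have c: "cnj (R' s) = R' s" "cnj (R s) = R s" by (simp_all add: R_def R'_def)
    have J2: "2 * of_real (jac \<alpha> s t) = cnj (zs s t) * (R s * ecis t) + R s * cnj (ecis t) * zs s t"
      unfolding J zs_def complex_cnj_add complex_cnj_mult complex_cnj_minus complex_cnj_complex_of_real c RR[symmetric]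
      using ecis_mult_cnj[of t] by (simp add: field_simps)
    have Gt: "Gt s t = z s t ^ p * cnj (z s t) ^ Suc q * (R' s * ecis t) +
      (z s t ^ p * (of_nat (Suc q) * cnj (z s t) ^ q * (- (R s * cnj (ecis t)))) +
      (of_nat p * z s t ^ (p - 1) * (R s * ecis t)) * cnj (z s t) ^ Suc q) * zs s t"
      unfolding Gt_def complex_cnj_mult c by (simp add: field_simps)
    have "2 * of_nat (Suc q) * (z s t ^ p * cnj (z s t) ^ q * of_real (jac \<alpha> s t)) =
      of_nat (Suc q) * (z s t ^ p * cnj (z s t) ^ q) * (2 * of_real (jac \<alpha> s t))"
      by (simp only: mult_ac)
    then show ?thesis
      unfolding Gt Fs_def J2 by (simp only:) (simp add: algebra_simps)
  qed
  have contR': "continuous_on {start \<alpha><..<1} R'"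
    unfolding R'_def using rad_pos[of _ \<alpha>] by (auto intro!: continuous_intros simp: less_imp_neq[symmetric])
  have contz: "continuous_on S (\<lambda>x. z (fst x) (snd x))" for S
    unfolding z_def by (intro continuous_intros)
  have "((\<lambda>s. integral (cbox 0 1) (F s)) has_vector_derivative integral (cbox 0 1) (Fs s)) (at s within {start \<alpha><..<1})"
  proof (rule leibniz_rule_vector_derivative)
    show "((\<lambda>s. F s t) has_vector_derivative Fs s t) (at s within {start \<alpha><..<1})" if "s \<in> {start \<alpha><..<1}" for s t
      using Fd[OF that] has_vector_derivative_at_within by blast
    show "F s integrable_on cbox 0 1" for s
      unfolding F_def z_def by (intro integrable_continuous continuous_intros)
    show "continuous_on ({start \<alpha><..<1} \<times> cbox 0 1) (\<lambda>(s, t). Fs s t)"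
      unfolding Fs_def zs_def case_prod_unfold R_def z_def
      by (intro continuous_intros continuous_on_compose2[OF contR']) auto
  qed (use s in auto)
  then have "((\<lambda>s. integral {0..1} (F s)) has_vector_derivative integral {0..1} (Fs s)) (at s)"
    using s by (simp add: at_within_open[of s "{start \<alpha><..<1}"])
  moreover have "integral {0..1} (Fs s) = integral {0..1} (\<lambda>t. 2 * of_nat (Suc q) * (z s t ^ p * cnj (z s t) ^ q * of_real (jac \<alpha> s t)))"
  proof -
    have "(Gt s has_integral (G s 1 - G s 0)) {0..1}"
      by (rule fundamental_theorem_of_calculus) (auto intro: Gd)
    moreover have "G s 1 = G s 0" by (simp add: G_def zs_def z_def circ_def)
    ultimately have G0: "(Gt s has_integral 0) {0..1}" by simp
    have "(\<lambda>t. 2 * of_nat (Suc q) * (z s t ^ p * cnj (z s t) ^ q * of_real (jac \<alpha> s t))) integrable_on {0..1}"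
      unfolding z_def by (intro integrable_continuous_real continuous_intros)
    from has_integral_add[OF integrable_integral[OF this] G0] show ?thesis
      unfolding eq by (simp add: integral_unique)
  qed
  ultimately show ?thesis unfolding F_def z_def R_def by simp
qed

text \<open>The circle integrals of \<open>circle_integral_deriv\<close> start at a degenerate
  circle, where they vanish, and end at the unit circle, which all pencils share. The value is
  therefore the same for every \<open>\<alpha>\<close>.\<close>

lemma disc_int_monomial:
  "disc_int \<alpha> (\<lambda>z. z ^ p * cnj z ^ q) = (if p = q then 1 / (2 * of_nat (Suc q)) else 0)"
proof -
  define V where "V s = integral {0..1} (\<lambda>t. circ \<alpha> s t ^ p * cnj (circ \<alpha> s t) ^ Suc q * (of_real (rad \<alpha> s) * ecis t))" for s
  define W where "W s = integral {0..1} (\<lambda>t. circ \<alpha> s t ^ p * cnj (circ \<alpha> s t) ^ q * of_real (jac \<alpha> s t))" for s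
  have "continuous_on {start \<alpha>..1} V"
    unfolding V_def cbox_interval[symmetric]
    by (rule integral_continuous_on_param) (auto simp: case_prod_unfold intro!: continuous_intros)
  then have "((\<lambda>s. 2 * of_nat (Suc q) * W s) has_integral (V 1 - V (start \<alpha>))) {start \<alpha>..1}"
  proof (intro fundamental_theorem_of_calculus_interior)
    fix s assume "s \<in> {start \<alpha><..<1}"
    from circle_integral_deriv[OF this, of p q]
    show "(V has_vector_derivative 2 * of_nat (Suc q) * W s) (at s)"
      unfolding V_def[abs_def] W_def by (simp del: of_nat_Suc)
  qed (use start_bounds[of \<alpha>] in auto)
  moreover have "V (start \<alpha>) = 0" by (simp add: V_def)
  moreover have "V 1 = (if p = q then 1 else 0)"
    using integral_ecis_power[of "Suc p" "Suc q"] by (simp add: V_def circ_def mult_ac)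
  ultimately have "((\<lambda>s. 2 * of_nat (Suc q) * W s) has_integral (if p = q then 1 else 0)) {start \<alpha>..1}"
    by (simp only: diff_0_right)
  then have "integral {start \<alpha>..1} (\<lambda>s. 2 * of_nat (Suc q) * W s) = (if p = q then 1 else 0)"
    by (rule integral_unique)
  then have "2 * of_nat (Suc q) * integral {start \<alpha>..1} W = (if p = q then 1 else 0)"
    by (simp del: of_nat_Suc)
  moreover have "disc_int \<alpha> (\<lambda>z. z ^ p * cnj z ^ q) = integral {start \<alpha>..1} W"
    unfolding W_def by (rule disc_int_eq_iterated) (intro continuous_intros)
  ultimately show ?thesis
    by (simp add: field_simps del: of_nat_Suc split: if_splits)
qed

lemma disc_int_bound:
  assumes "continuous_on (cball 0 1) g" "\<And>z. z \<in> cball 0 1 \<Longrightarrow> norm (g z) \<le> e"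
  shows "norm (disc_int \<alpha> g) \<le> e * integral (cbox (start \<alpha>, 0) (1, 1)) (\<lambda>(s, t). \<bar>jac \<alpha> s t\<bar>)"
proof -
  have "norm (disc_int \<alpha> g) \<le> integral (cbox (start \<alpha>, 0) (1, 1)) (\<lambda>x. e * (case x of (s, t) \<Rightarrow> \<bar>jac \<alpha> s t\<bar>))"
    unfolding disc_int_def
  proof (rule integral_norm_bound_integral[OF disc_int_integrable[OF assms(1)]])
    show "(\<lambda>x. e * (case x of (s, t) \<Rightarrow> \<bar>jac \<alpha> s t\<bar>)) integrable_on cbox (start \<alpha>, 0) (1, 1)"
      unfolding case_prod_unfold by (intro integrable_continuous continuous_intros)
    fix x assume x: "x \<in> cbox (start \<alpha>, 0) (1, 1::real)"
    then have "norm (g (circ \<alpha> (fst x) (snd x))) \<le> e"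
      by (intro assms(2)) (auto simp: mem_box_start norm_circ_le)
    then show "norm (case x of (s, t) \<Rightarrow> g (circ \<alpha> s t) * of_real (jac \<alpha> s t)) \<le> e * (case x of (s, t) \<Rightarrow> \<bar>jac \<alpha> s t\<bar>)"
      by (simp add: case_prod_unfold norm_mult mult_right_mono)
  qed
  then show ?thesis by simp
qed

text \<open>Instead of a change of variables: both sides agree on the monomials
  \<open>z ^ i * cnj z ^ j\<close>, are continuous for the uniform norm, and the span of the
  monomials is dense.\<close>

lemma disc_int_independent:
  assumes g: "continuous_on (cball 0 1) g"
  shows "disc_int \<alpha> g = disc_int 0 g"
proof -
  define A where "A f \<longleftrightarrow> continuous_on (cball 0 1) f \<and> 
    (\<forall>i j. disc_int \<alpha> (\<lambda>z. f z * (z ^ i * cnj z ^ j)) = disc_int 0 (\<lambda>z. f z * (z ^ i * cnj z ^ j)))" for f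
  have Aadd: "A (\<lambda>z. f z + g z)" if "A f" "A g" for f g
  proof -
    have "disc_int \<beta> (\<lambda>z. f z * (z ^ i * cnj z ^ j) + g z * (z ^ i * cnj z ^ j)) =
      disc_int \<beta> (\<lambda>z. f z * (z ^ i * cnj z ^ j)) + disc_int \<beta> (\<lambda>z. g z * (z ^ i * cnj z ^ j))" for \<beta> i j
      using that unfolding A_def by (intro disc_int_add continuous_intros) auto
    then show ?thesis
      using that unfolding A_def distrib_right by (simp add: continuous_on_add)
  qed
  have Ascale: "A (\<lambda>z. c * f z)" if "A f" for f c
    using that unfolding A_def mult.assoc by (simp add: disc_int_cmult continuous_on_mult)
  have Az: "A (\<lambda>z. z * f z)" if "A f" for f
  proof -
    have "z * f z * (z ^ i * cnj z ^ j) = f z * (z ^ Suc i * cnj z ^ j)" for z i j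
      by (simp add: mult_ac)
    then show ?thesis
      using that unfolding A_def by (simp only: continuous_on_mult continuous_on_id) blast
  qed
  have Acnj: "A (\<lambda>z. cnj z * f z)" if "A f" for f
  proof -
    have "cnj z * f z * (z ^ i * cnj z ^ j) = f z * (z ^ i * cnj z ^ Suc j)" for z i j
      by (simp add: mult_ac)
    then show ?thesis
      using that unfolding A_def by (simp only: continuous_on_mult continuous_on_cnj continuous_on_id) blast
  qed
  have A1: "A (\<lambda>z. 1)" by (simp add: A_def disc_int_monomial)
  define K where "K \<beta> = integral (cbox (start \<beta>, 0) (1, 1)) (\<lambda>(s, t). \<bar>jac \<beta> s t\<bar>)" for \<beta>
  have K0: "K \<beta> \<ge> 0" for \<beta>
    unfolding K_def case_prod_unfold by (rule integral_nonneg) (auto intro!: integrable_continuous continuous_intros)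
  have bound: "norm (disc_int \<alpha> g - disc_int 0 g) \<le> e * (K \<alpha> + K 0)" if e: "e > 0" for e
  proof -
    have "\<exists>f. A f \<and> continuous_on (cball 0 1) f \<and> (\<forall>z\<in>cball 0 1. norm (g z - f z) < e)"
      by (rule complex_Stone_Weierstrass[where A = A, OF _ _ _ _ A1 compact_cball g e])
        (rule Aadd Ascale Az Acnj; assumption)+
    then obtain f where f: "A f" "continuous_on (cball 0 1) f" "\<And>z. z \<in> cball 0 1 \<Longrightarrow> norm (g z - f z) < e"
      by blast
    have d: "disc_int \<beta> g = disc_int \<beta> (\<lambda>z. g z - f z) + disc_int \<beta> f" for \<beta>
      using disc_int_add[of "\<lambda>z. g z - f z" f \<beta>] f(2) g by (simp add: continuous_on_diff)
    have "disc_int \<alpha> f = disc_int 0 f"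
      using f(1)[unfolded A_def, THEN conjunct2, rule_format, of 0 0] by simp
    then have "disc_int \<alpha> g - disc_int 0 g = disc_int \<alpha> (\<lambda>z. g z - f z) - disc_int 0 (\<lambda>z. g z - f z)"
      by (simp add: d)
    also have "norm \<dots> \<le> norm (disc_int \<alpha> (\<lambda>z. g z - f z)) + norm (disc_int 0 (\<lambda>z. g z - f z))"
      by (rule norm_triangle_ineq4)
    also have "\<dots> \<le> e * K \<alpha> + e * K 0"
      unfolding K_def using f g by (intro add_mono disc_int_bound continuous_on_diff) (auto intro: less_imp_le)
    finally show ?thesis by (simp add: algebra_simps)
  qed
  have "norm (disc_int \<alpha> g - disc_int 0 g) \<le> 0"
  proof (rule field_le_epsilon)
    fix e :: real assume "e > 0"
    then have "norm (disc_int \<alpha> g - disc_int 0 g) \<le> e / (K \<alpha> + K 0 + 1) * (K \<alpha> + K 0)"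
      using K0[of \<alpha>] K0[of 0] by (intro bound) auto
    also have "\<dots> \<le> e" using \<open>e > 0\<close> K0[of \<alpha>] K0[of 0] by (simp add: field_simps)
    finally show "norm (disc_int \<alpha> g - disc_int 0 g) \<le> 0 + e" by simp
  qed
  then show ?thesis by simp
qed

text \<open>Up to a factor these are the integrals of \<open>h z / (A + B * z) dz\<close> around the
  circles. Test functions with one pole outside the closed disc, rather than powers of
  \<open>z\<close>, are used because the kernel below leaves exactly such a factor behind, with
  \<open>B = - y\<close>.\<close>

definition pencil_holomorphic :: "real \<Rightarrow> (complex \<Rightarrow> complex) \<Rightarrow> bool" where
  "pencil_holomorphic \<alpha> h \<longleftrightarrow> (\<forall>s\<in>{start \<alpha><..<1}. \<forall>A B.
     (\<forall>z\<in>cball (of_real ((1 - s) * \<alpha>)) (rad \<alpha> s). A + B * z \<noteq> 0) \<longrightarrow>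
     integral {0..1} (\<lambda>t. h (circ \<alpha> s t) * ecis t / (A + B * circ \<alpha> s t)) = 0)"

section \<open>Partial fractions of the test kernel on the circles of one pencil\<close>

definition kD :: "real \<Rightarrow> real \<Rightarrow> real \<Rightarrow> real" where
  "kD \<alpha> u s = 1 - u * ((1 - s) * \<alpha>)"

definition kk :: "real \<Rightarrow> real \<Rightarrow> real" where
  "kk \<alpha> u = (\<alpha> - u) * (1 - \<alpha> * u)"

text \<open>On the circle, \<open>1 - u * cnj z\<close> equals
  \<open>kD * (ecis t - knu) / ecis t\<close>, so it continues with a zero at
  \<open>ecis t = knu\<close>. The corresponding \<open>z\<close> is the reflection of
  \<open>1 / u\<close> in the circle, or the centre if \<open>u = 0\<close>, and
  \<open>kdelta\<close> is its offset from \<open>u\<close>.\<close>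

definition kdelta :: "real \<Rightarrow> real \<Rightarrow> real \<Rightarrow> real" where
  "kdelta \<alpha> u s = kk \<alpha> u * (1 - s) / kD \<alpha> u s"

definition knu :: "real \<Rightarrow> real \<Rightarrow> real \<Rightarrow> real" where
  "knu \<alpha> u s = u * rad \<alpha> s / kD \<alpha> u s"

definition kQ :: "real \<Rightarrow> real \<Rightarrow> real \<Rightarrow> real" where
  "kQ \<alpha> u s = drad \<alpha> s - \<alpha> * rad \<alpha> s * knu \<alpha> u s"

text \<open>What is left of the kernel by the expansion in powers of \<open>ecis t - knu\<close>
  once the part killed by the moment conditions is dropped: \<open>ka\<close> goes with the first
  power of \<open>1 / (1 - y * kdelta)\<close>, \<open>kb\<close> with the second.\<close>

definition ka :: "real \<Rightarrow> real \<Rightarrow> real \<Rightarrow> real \<Rightarrow> complex" where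
  "ka \<alpha> u s t = (of_real (- kk \<alpha> u * rad \<alpha> s / (2 * (kD \<alpha> u s)\<^sup>2)) * ecis t / (ecis t - of_real (knu \<alpha> u s))\<^sup>2
     + of_real (kQ \<alpha> u s) * ecis t / (ecis t - of_real (knu \<alpha> u s))) / of_real ((kD \<alpha> u s)\<^sup>2)"

definition kb :: "real \<Rightarrow> real \<Rightarrow> real \<Rightarrow> real \<Rightarrow> complex" where
  "kb \<alpha> u s t = of_real (- kk \<alpha> u * (rad \<alpha> s)\<^sup>2 / (2 * (kD \<alpha> u s)\<^sup>2)) * ecis t / (ecis t - of_real (knu \<alpha> u s)) / of_real ((kD \<alpha> u s)\<^sup>2)"

definition kK :: "real \<Rightarrow> real \<Rightarrow> real \<Rightarrow> real \<Rightarrow> complex \<Rightarrow> complex" where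
  "kK \<alpha> u s t y = ka \<alpha> u s t / (1 - y * of_real (kdelta \<alpha> u s)) + kb \<alpha> u s t * y / (1 - y * of_real (kdelta \<alpha> u s))\<^sup>2"

context
  fixes \<alpha> u :: real
  assumes \<alpha>: "\<alpha> \<noteq> 0" and u: "\<bar>u\<bar> \<le> 1/2" "\<bar>u\<bar> < \<bar>\<alpha>\<bar>" "\<bar>u\<bar> * \<bar>\<alpha>\<bar> < 1"
begin

lemma kD_ge: "s \<in> {start \<alpha>..1} \<Longrightarrow> kD \<alpha> u s \<ge> 1/2"
  and knu_le: "s \<in> {start \<alpha>..1} \<Longrightarrow> \<bar>knu \<alpha> u s\<bar> \<le> 1/2"
proof -
  assume s: "s \<in> {start \<alpha>..1}"
  let ?g = "(1 - s) * \<alpha>"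
  have c: "\<bar>?g\<bar> + rad \<alpha> s \<le> 1" "0 \<le> rad \<alpha> s"
    using center_plus_rad[OF s] rad_nonneg[OF s] by auto
  have "\<bar>u * ?g\<bar> \<le> 1/2 * \<bar>?g\<bar>" unfolding abs_mult[of u] using u(1) by (intro mult_right_mono) auto
  then have D: "kD \<alpha> u s \<ge> 1 - \<bar>?g\<bar> / 2" unfolding kD_def by linarith
  then show D2: "kD \<alpha> u s \<ge> 1/2" using c by linarith
  have "\<bar>u * rad \<alpha> s\<bar> \<le> 1/2 * rad \<alpha> s" unfolding abs_mult[of u] using u(1) c by (intro mult_mono) auto
  also have "\<dots> \<le> 1/2 * kD \<alpha> u s" using D c by linarith
  finally show "\<bar>knu \<alpha> u s\<bar> \<le> 1/2" using D2 by (simp add: knu_def field_simps)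
qed

text \<open>Because \<open>kk = (\<alpha> - u) * (1 - \<alpha> * u)\<close> has the sign of
  \<open>\<alpha>\<close>, so has \<open>kdelta\<close>, for all \<open>s\<close>. Seen as poles in
  \<open>y\<close>, the points \<open>1 / kdelta\<close> thus lie on a single real ray, and
  \<open>\<bar>kdelta\<bar> \<le> 2\<close> keeps them at distance at least 1/2 from 0.\<close>

lemma kdelta_eq: "s \<in> {start \<alpha>..1} \<Longrightarrow> kdelta \<alpha> u s = (1 - s) * \<alpha> + rad \<alpha> s * knu \<alpha> u s - u"
  and kdelta_le: "s \<in> {start \<alpha>..1} \<Longrightarrow> \<bar>kdelta \<alpha> u s\<bar> \<le> 2"
  and kdelta_sgn: "s \<in> {start \<alpha>..1} \<Longrightarrow> kdelta \<alpha> u s = sgn \<alpha> * \<bar>kdelta \<alpha> u s\<bar>"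
  and kdelta_abs: "s \<in> {start \<alpha>..1} \<Longrightarrow> \<bar>kdelta \<alpha> u s\<bar> = \<bar>kk \<alpha> u\<bar> * (1 - s) / kD \<alpha> u s"
proof -
  assume s: "s \<in> {start \<alpha>..1}"
  have D: "kD \<alpha> u s > 0" using kD_ge[OF s] by simp
  have R: "rad \<alpha> s * knu \<alpha> u s = u * rad2 \<alpha> s / kD \<alpha> u s"
    unfolding knu_def rad_sq[OF s, symmetric] by (simp add: power2_eq_square)
  have "((1 - s) * \<alpha> - u) * kD \<alpha> u s + u * rad2 \<alpha> s = kk \<alpha> u * (1 - s)"
    unfolding kD_def rad2_def kk_def by algebra
  then show e: "kdelta \<alpha> u s = (1 - s) * \<alpha> + rad \<alpha> s * knu \<alpha> u s - u"
    unfolding R kdelta_def using D by (simp add: field_simps)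
  have "\<bar>rad \<alpha> s * knu \<alpha> u s\<bar> \<le> rad \<alpha> s * 1"
    unfolding abs_mult using rad_nonneg[OF s] knu_le[OF s] by (intro mult_mono) auto
  then show "\<bar>kdelta \<alpha> u s\<bar> \<le> 2"
    unfolding e using center_plus_rad[OF s] u(1) by linarith
  have s1: "s \<le> 1" using s by simp
  show a: "\<bar>kdelta \<alpha> u s\<bar> = \<bar>kk \<alpha> u\<bar> * (1 - s) / kD \<alpha> u s"
    unfolding kdelta_def abs_divide abs_mult using D s1 by simp
  have "\<bar>\<alpha> * u\<bar> < 1" using u(3) by (simp add: abs_mult mult.commute)
  then have p: "1 - \<alpha> * u > 0" by linarith
  have "kk \<alpha> u = sgn \<alpha> * \<bar>kk \<alpha> u\<bar>"
  proof (cases "\<alpha> > 0")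
    case True
    then have "kk \<alpha> u \<ge> 0" unfolding kk_def using u(2) p by (intro mult_nonneg_nonneg) auto
    then show ?thesis using True by simp
  next
    case False
    then have "kk \<alpha> u \<le> 0" unfolding kk_def using u(2) p by (intro mult_nonpos_nonneg) auto
    then show ?thesis using False \<alpha> by simp
  qed
  then show "kdelta \<alpha> u s = sgn \<alpha> * \<bar>kdelta \<alpha> u s\<bar>"
    unfolding a unfolding kdelta_def by (metis mult.assoc times_divide_eq_right)
qed

text \<open>The bound 1/4 on the half plane and the bound 2 on \<open>kdelta\<close> give a real
  part of at least 1/2. The second estimate combines this with the lower bound
  \<open>norm y * \<bar>kdelta\<bar> - 1\<close>, which takes over for large
  \<open>y\<close>.\<close>

lemma kA_bounds:
  assumes "s \<in> {start \<alpha>..1}" "Re (of_real (sgn \<alpha>) * y) < 1/4"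
  shows "norm (1 - y * of_real (kdelta \<alpha> u s)) \<ge> 1/2"
    and "norm (1 - y * of_real (kdelta \<alpha> u s)) \<ge> (1 + norm y * \<bar>kdelta \<alpha> u s\<bar>) / 6"
proof -
  let ?d = "\<bar>kdelta \<alpha> u s\<bar>"
  have "Re (y * of_real (kdelta \<alpha> u s)) = Re (of_real (sgn \<alpha>) * y) * ?d"
    by (subst kdelta_sgn[OF assms(1)]) simp
  also have "\<dots> \<le> 1/2"
  proof (cases "Re (of_real (sgn \<alpha>) * y) \<ge> 0")
    case True
    then have "Re (of_real (sgn \<alpha>) * y) * ?d \<le> (1/4) * 2"
      using assms(2) kdelta_le[OF assms(1)] by (intro mult_mono) auto
    then show ?thesis by simp
  next
    case False
    then have "Re (of_real (sgn \<alpha>) * y) * ?d \<le> 0" by (intro mult_nonpos_nonneg) auto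
    then show ?thesis by linarith
  qed
  finally have "Re (1 - y * of_real (kdelta \<alpha> u s)) \<ge> 1/2" by simp
  then show 1: "norm (1 - y * of_real (kdelta \<alpha> u s)) \<ge> 1/2"
    using complex_Re_le_cmod order_trans by blast
  have "norm (1 - y * of_real (kdelta \<alpha> u s)) \<ge> norm y * ?d - 1"
    using norm_triangle_ineq2[of "y * of_real (kdelta \<alpha> u s)" 1]
    by (simp add: norm_mult norm_minus_commute)
  then show "norm (1 - y * of_real (kdelta \<alpha> u s)) \<ge> (1 + norm y * \<bar>kdelta \<alpha> u s\<bar>) / 6"
    using 1 by argo
qed

lemma small_imp_half_plane: "norm y < 1/4 \<Longrightarrow> Re (of_real (sgn \<alpha>) * y) < 1/4"
  using complex_Re_le_cmod[of "of_real (sgn \<alpha>) * y"] \<alpha> by (auto simp: norm_mult abs_sgn_eq)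

lemma ecis_knu_bound: "s \<in> {start \<alpha>..1} \<Longrightarrow> norm (ecis t - of_real (knu \<alpha> u s)) \<ge> 1/2"
  using norm_triangle_ineq2[of "ecis t" "of_real (knu \<alpha> u s)"] knu_le[of s] by simp

lemma ecis_knu_nonzero: "s \<in> {start \<alpha>..1} \<Longrightarrow> ecis t - of_real (knu \<alpha> u s) \<noteq> 0"
  using ecis_knu_bound[of s t] by (metis norm_zero not_le zero_less_divide_1_iff zero_less_numeral)

text \<open>Partial fractions in \<open>w = ecis t - knu\<close>: the numerator
  \<open>jac * ecis t\<close> is a quadratic polynomial in \<open>w\<close>, and the denominators
  are \<open>w ^ 2\<close> and \<open>1 - y * (z - u) = A - y * R * w\<close>. The terms over
  \<open>w\<close> and \<open>w ^ 2\<close> make up \<open>kK\<close>; the remaining one is a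
  constant in \<open>t\<close> times \<open>ecis t / (1 - y * (z - u))\<close> and integrates to
  zero against \<open>h\<close>.\<close>

lemma kernel_decomposition:
  assumes s: "s \<in> {start \<alpha><..<1}" and y: "norm y < 1/4"
  shows "of_real (jac \<alpha> s t) / (1 - of_real u * cnj (circ \<alpha> s t))\<^sup>2 / (1 - y * (circ \<alpha> s t - of_real u)) =
    kK \<alpha> u s t y + of_real (rad \<alpha> s) * (of_real (- kk \<alpha> u * rad \<alpha> s / (2 * (kD \<alpha> u s)\<^sup>2)) * of_real (rad \<alpha> s) * y\<^sup>2 / (1 - y * of_real (kdelta \<alpha> u s))\<^sup>2
       + of_real (kQ \<alpha> u s) * y / (1 - y * of_real (kdelta \<alpha> u s)) - of_real \<alpha> / 2) / of_real ((kD \<alpha> u s)\<^sup>2)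
       * (ecis t / (1 - y * (circ \<alpha> s t - of_real u)))"
proof -
  have s': "s \<in> {start \<alpha>..1}" using s by auto
  define R D nu e where "R = complex_of_real (rad \<alpha> s)" and "D = complex_of_real (kD \<alpha> u s)"
    and "nu = complex_of_real (knu \<alpha> u s)" and "e = ecis t"
  define w where "w = e - nu"
  define A where "A = 1 - y * of_real (kdelta \<alpha> u s)"
  define q0 where "q0 = complex_of_real (- kk \<alpha> u * rad \<alpha> s / (2 * (kD \<alpha> u s)\<^sup>2))"
  define q1 where "q1 = complex_of_real (kQ \<alpha> u s)"
  define P where "P = 1 - y * (circ \<alpha> s t - of_real u)"
  have R0: "R \<noteq> 0" using rad_pos[of s \<alpha>] s by (simp add: R_def)
  have Dr: "kD \<alpha> u s \<noteq> 0" using kD_ge[OF s'] by auto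
  have D0: "D \<noteq> 0" using Dr by (simp add: D_def)
  have w0: "w \<noteq> 0" using ecis_knu_nonzero[OF s'] by (simp add: w_def e_def nu_def)
  have A0: "A \<noteq> 0" using kA_bounds(1)[OF s' small_imp_half_plane[OF y]] by (auto simp: A_def)
  have e0: "e \<noteq> 0" by (simp add: e_def)
  have P0: "P \<noteq> 0"
  proof
    assume "P = 0"
    then have "norm (y * (circ \<alpha> s t - of_real u)) = 1" by (simp add: P_def)
    moreover have "norm (circ \<alpha> s t - of_real u) \<le> 2"
      using norm_triangle_ineq4[of "circ \<alpha> s t" "of_real u"] norm_circ_le[OF s', of t] u(1) by simp
    then have "norm y * norm (circ \<alpha> s t - of_real u) \<le> 1/4 * 2" using y by (intro mult_mono) auto
    ultimately show False by (simp add: norm_mult)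
  qed
  have nuD: "nu * D = of_real u * R" using Dr by (simp add: nu_def D_def R_def knu_def)
  have P: "P = A - y * R * w"
    unfolding P_def A_def w_def circ_def kdelta_eq[OF s'] R_def nu_def e_def by (simp add: algebra_simps)
  have cnj: "1 - of_real u * cnj (circ \<alpha> s t) = D * w / e"
  proof -
    have "cnj e = 1 / e" using ecis_mult_cnj[of t] e0 by (simp add: e_def field_simps)
    then have "1 - of_real u * cnj (circ \<alpha> s t) = D - of_real u * R / e"
      unfolding circ_def e_def[symmetric] R_def D_def kD_def by (simp add: algebra_simps)
    then show ?thesis using e0 nuD by (simp add: w_def field_simps)
  qed
  \<comment> \<open>Taylor expansion of \<open>jac * ecis t\<close> at \<open>knu\<close>, with
    value \<open>q0\<close> and first derivative \<open>q1\<close>. The identity \<open>k\<close>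
    shows that the value carries the factor \<open>kk\<close>, on which the uniform bound in
    \<open>y\<close> depends.\<close>
  have J: "of_real (jac \<alpha> s t) * e = q0 + q1 * w - of_real \<alpha> / 2 * R * w\<^sup>2"
  proof -
    have J1: "of_real (jac \<alpha> s t) = of_real (drad \<alpha> s) - of_real \<alpha> * R * (e + cnj e) / 2"
      unfolding jac_def R_def e_def by (simp add: complex_add_cnj)
    have J2: "of_real (jac \<alpha> s t) * e = of_real (drad \<alpha> s) * e - of_real \<alpha> * R * (e\<^sup>2 + 1) / 2"
      unfolding J1 using ecis_mult_cnj[of t] by (simp add: e_def field_simps power2_eq_square)
    have k: "drad \<alpha> s * knu \<alpha> u s - \<alpha> * rad \<alpha> s * ((knu \<alpha> u s)\<^sup>2 + 1) / 2 = - kk \<alpha> u * rad \<alpha> s / (2 * (kD \<alpha> u s)\<^sup>2)"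
    proof -
      have "2 * drad \<alpha> s * u * kD \<alpha> u s - \<alpha> * (u\<^sup>2 * rad2 \<alpha> s + (kD \<alpha> u s)\<^sup>2) = - kk \<alpha> u"
        unfolding drad_def rad2_def kD_def kk_def by (simp add: field_simps power2_eq_square)
      then have "2 * drad \<alpha> s * u * kD \<alpha> u s - \<alpha> * (u\<^sup>2 * (rad \<alpha> s)\<^sup>2 + (kD \<alpha> u s)\<^sup>2) = - kk \<alpha> u"
        unfolding rad_sq[OF s'] .
      moreover have "drad \<alpha> s * knu \<alpha> u s - \<alpha> * rad \<alpha> s * ((knu \<alpha> u s)\<^sup>2 + 1) / 2 =
        (2 * drad \<alpha> s * u * kD \<alpha> u s - \<alpha> * (u\<^sup>2 * (rad \<alpha> s)\<^sup>2 + (kD \<alpha> u s)\<^sup>2)) * rad \<alpha> s / (2 * (kD \<alpha> u s)\<^sup>2)"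
        using Dr unfolding knu_def by (simp add: field_simps power2_eq_square)
      ultimately show ?thesis by simp
    qed
    have q0: "q0 = of_real (drad \<alpha> s) * nu - of_real \<alpha> * R * (nu\<^sup>2 + 1) / 2"
      unfolding q0_def k[symmetric] by (simp add: nu_def R_def)
    have q1: "q1 = of_real (drad \<alpha> s) - of_real \<alpha> * R * nu"
      by (simp add: q1_def kQ_def R_def nu_def)
    show ?thesis unfolding J2 q0 q1 w_def by (simp add: field_simps power2_eq_square)
  qed
  have "of_real (jac \<alpha> s t) / (1 - of_real u * cnj (circ \<alpha> s t))\<^sup>2 / P = (of_real (jac \<alpha> s t) * e) * e / (D\<^sup>2 * w\<^sup>2 * P)"
    unfolding cnj using e0 D0 w0 by (simp add: field_simps power2_eq_square)
  also have "\<dots> = (q0 / (A * w\<^sup>2) + (R * q0 * y / A\<^sup>2 + q1 / A) / w + R * (R * q0 * y\<^sup>2 / A\<^sup>2 + q1 * y / A - of_real \<alpha> / 2) / P) * e / D\<^sup>2"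
  proof -
    have "(q0 + q1 * w - of_real \<alpha> / 2 * R * w\<^sup>2) / (w\<^sup>2 * P) = 
      q0 / (A * w\<^sup>2) + (R * q0 * y / A\<^sup>2 + q1 / A) / w + R * (R * q0 * y\<^sup>2 / A\<^sup>2 + q1 * y / A - of_real \<alpha> / 2) / P"
      using w0 A0 P0 P by (simp add: divide_simps) (simp add: algebra_simps power2_eq_square)
    moreover have "a * e / (D\<^sup>2 * w\<^sup>2 * P) = (a / (w\<^sup>2 * P)) * e / D\<^sup>2" for a
      by (simp add: mult_ac)
    ultimately show ?thesis unfolding J by (simp only:)
  qed
  also have "\<dots> = kK \<alpha> u s t y + R * (q0 * R * y\<^sup>2 / A\<^sup>2 + q1 * y / A - of_real \<alpha> / 2) / D\<^sup>2 * (e / P)"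
  proof -
    have kb: "kb \<alpha> u s t = R * q0 * e / w / D\<^sup>2"
      unfolding kb_def R_def q0_def e_def w_def nu_def D_def by (simp add: power2_eq_square)
    have ka: "ka \<alpha> u s t = (q0 * e / w\<^sup>2 + q1 * e / w) / D\<^sup>2"
      unfolding ka_def q1_def q0_def e_def w_def nu_def D_def by simp
    show ?thesis
      unfolding kK_def ka kb A_def[symmetric] using w0 A0 P0 D0
      by (simp add: divide_simps) (simp add: algebra_simps power2_eq_square)
  qed
  finally show ?thesis
    unfolding P_def R_def D_def e_def q0_def q1_def A_def by simp
qed

lemma continuous_on_kD [continuous_intros]: "continuous_on S f \<Longrightarrow> continuous_on S (\<lambda>x. kD \<alpha> u (f x))"
  unfolding kD_def by (intro continuous_intros)

lemma kD_nonzero: "s \<in> {start \<alpha>..1} \<Longrightarrow> kD \<alpha> u s \<noteq> 0"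
  using kD_ge[of s] by auto

lemma continuous_on_knu: 
  "continuous_on (cbox (start \<alpha>, 0) (1, 1::real)) (\<lambda>x. knu \<alpha> u (fst x))"
  unfolding knu_def by (intro continuous_intros) (simp add: mem_box_start kD_nonzero)

lemma continuous_on_kdelta: 
  "continuous_on (cbox (start \<alpha>, 0) (1, 1::real)) (\<lambda>x. kdelta \<alpha> u (fst x))"
  unfolding kdelta_def by (intro continuous_intros) (simp add: mem_box_start kD_nonzero)

lemma continuous_on_ka: 
  "continuous_on (cbox (start \<alpha>, 0) (1, 1::real)) (\<lambda>x. ka \<alpha> u (fst x) (snd x))"
  unfolding ka_def kQ_def
  by (intro continuous_intros continuous_on_knu ballI)
    (simp_all add: mem_box_start kD_nonzero ecis_knu_nonzero del: right_minus_eq)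

lemma continuous_on_kb: 
  "continuous_on (cbox (start \<alpha>, 0) (1, 1::real)) (\<lambda>x. kb \<alpha> u (fst x) (snd x))"
  unfolding kb_def
  by (intro continuous_intros continuous_on_knu ballI)
    (simp_all add: mem_box_start kD_nonzero ecis_knu_nonzero del: right_minus_eq)

text \<open>The integral of \<open>h\<close> against the reduced kernel. Its singularities in
  \<open>y\<close> are the points \<open>1 / kdelta\<close> alone, so it makes sense on a whole half
  plane and not just near 0.\<close>

definition kG :: "(complex \<Rightarrow> complex) \<Rightarrow> complex \<Rightarrow> complex" where
  "kG h y = integral (cbox (start \<alpha>, 0) (1, 1)) (\<lambda>x. h (circ \<alpha> (fst x) (snd x)) * kK \<alpha> u (fst x) (snd x) y)"

lemma kA_nonzero:
  assumes "s \<in> {start \<alpha>..1}" "Re (of_real (sgn \<alpha>) * y) < 1/4"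
  shows "1 - y * of_real (kdelta \<alpha> u s) \<noteq> 0"
  using kA_bounds(1)[OF assms] by auto

lemma continuous_on_kK:
  assumes "Re (of_real (sgn \<alpha>) * y) < 1/4"
  shows "continuous_on (cbox (start \<alpha>, 0) (1, 1)) (\<lambda>x. kK \<alpha> u (fst x) (snd x) y)"
  unfolding kK_def
  by (intro continuous_intros continuous_on_ka continuous_on_kb continuous_on_kdelta ballI)
    (simp_all add: mem_box_start kA_nonzero[OF _ assms] del: right_minus_eq)

lemma kG_holomorphic:
  assumes h: "continuous_on (cball 0 1) h"
  shows "kG h holomorphic_on {y. Re (of_real (sgn \<alpha>) * y) < 1/4}"
proof -
  define H where "H = {y. Re (of_real (sgn \<alpha>) * y) < 1/4}"
  define d where "d x = complex_of_real (kdelta \<alpha> u (fst x))" for x :: "real \<times> real"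
  define A where "A y x = 1 - y * d x" for y x
  define a where "a x = ka \<alpha> u (fst x) (snd x)" for x
  define b where "b x = kb \<alpha> u (fst x) (snd x)" for x
  define hc where "hc x = h (circ \<alpha> (fst x) (snd x))" for x
  have A0: "A y x \<noteq> 0" if "y \<in> H" "x \<in> cbox (start \<alpha>, 0) (1, 1)" for x y
    using that kA_nonzero unfolding A_def d_def H_def by (auto simp: mem_box_start)
  have "convex H"
  proof -
    have "H = (*) (of_real (sgn \<alpha>)) -` {z. Re z < 1/4}" by (auto simp: H_def)
    also have "convex \<dots>"
      by (rule convex_linear_vimage[OF bounded_linear.linear[OF bounded_linear_mult_right] convex_halfspace_Re_lt])
    finally show ?thesis .
  qed
  define I where "I y x = inverse (A y x)" for y x
  define f' where "f' y x = hc x * (a x * (d x * (I y x)\<^sup>2) + (b x * y * (2 * I y x * (d x * (I y x)\<^sup>2)) + b x * (I y x)\<^sup>2))" for y x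
  have kK: "kK \<alpha> u (fst x) (snd x) y = a x * I y x + b x * y * (I y x)\<^sup>2" for x y
    unfolding kK_def a_def b_def I_def A_def d_def divide_inverse power_inverse ..
  let ?B = "cbox (start \<alpha>, 0) (1, 1::real)"
  have "(\<lambda>y. integral ?B (\<lambda>x. hc x * (a x * I y x + b x * y * (I y x)\<^sup>2))) holomorphic_on H"
  proof (rule leibniz_rule_holomorphic)
    fix y x assume yx: "y \<in> H" "x \<in> ?B"
    have "((\<lambda>y. A y x) has_field_derivative - d x) (at y)"
      unfolding A_def by (auto intro!: derivative_eq_intros)
    from DERIV_inverse_fun[OF this A0[OF yx]]
    have I: "((\<lambda>y. I y x) has_field_derivative d x * (I y x)\<^sup>2) (at y)"
      unfolding I_def by (simp add: power2_eq_square mult_ac)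
    have I2: "((\<lambda>y. (I y x)\<^sup>2) has_field_derivative 2 * I y x * (d x * (I y x)\<^sup>2)) (at y)"
      using DERIV_power[OF I, of 2] by (simp add: mult_ac)
    have bd: "((\<lambda>y. b x * y) has_field_derivative b x) (at y)"
      by (auto intro!: derivative_eq_intros)
    have "((\<lambda>y. hc x * (a x * I y x + b x * y * (I y x)\<^sup>2)) has_field_derivative f' y x) (at y)"
      unfolding f'_def
      by (rule DERIV_cmult[OF DERIV_add[OF DERIV_cmult[OF I] DERIV_mult'[OF bd I2]]])
    then show "((\<lambda>y. hc x * (a x * I y x + b x * y * (I y x)\<^sup>2)) has_field_derivative f' y x) (at y within H)"
      by (rule has_field_derivative_at_within)
  next
    fix y assume y: "y \<in> H"
    have "(\<lambda>x. hc x * kK \<alpha> u (fst x) (snd x) y) integrable_on ?B"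
      unfolding hc_def
      by (intro integrable_continuous continuous_on_mult continuous_on_kK continuous_on_box_circ h)
        (use y in \<open>simp add: H_def\<close>)
    then show "(\<lambda>x. hc x * (a x * I y x + b x * y * (I y x)\<^sup>2)) integrable_on ?B"
      unfolding kK .
  next
    have *: "continuous_on (H \<times> ?B) (\<lambda>p. f (snd p))"
      if "continuous_on ?B f" for f :: "real \<times> real \<Rightarrow> complex"
      by (rule continuous_on_compose2[OF that]) (auto intro!: continuous_intros)
    have cd: "continuous_on (H \<times> ?B) (\<lambda>p. d (snd p))"
      unfolding d_def by (rule *) (intro continuous_intros continuous_on_kdelta)
    have cI: "continuous_on (H \<times> ?B) (\<lambda>p. I (fst p) (snd p))"
      unfolding I_def
    proof (rule continuous_on_inverse)
      show "continuous_on (H \<times> ?B) (\<lambda>p. A (fst p) (snd p))"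
        unfolding A_def by (intro continuous_intros cd)
    qed (use A0 in auto)
    have "continuous_on (H \<times> ?B) (\<lambda>p. hc (snd p))" "continuous_on (H \<times> ?B) (\<lambda>p. a (snd p))" "continuous_on (H \<times> ?B) (\<lambda>p. b (snd p))"
      unfolding hc_def a_def b_def
      using *[OF continuous_on_box_circ[OF h]] *[OF continuous_on_ka] *[OF continuous_on_kb] by blast+
    then show "continuous_on (H \<times> ?B) (\<lambda>(y, x). f' y x)"
      unfolding f'_def case_prod_unfold
      by (intro continuous_on_mult continuous_on_add continuous_on_power continuous_on_fst continuous_on_id continuous_on_const cI cd)
  qed fact
  moreover have "kG h = (\<lambda>y. integral ?B (\<lambda>x. hc x * (a x * I y x + b x * y * (I y x)\<^sup>2)))"
    unfolding kG_def[abs_def] kK hc_def ..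
  ultimately show ?thesis
    by (simp only: H_def)
qed

text \<open>Of the two factors \<open>1 / kD\<^sup>2\<close> only one is estimated by a constant.
  The other is kept because \<open>kk / kD\<^sup>2\<close> is minus the derivative of
  \<open>kdelta\<close> in \<open>s\<close>.\<close>

lemma kb_bound:
  assumes "s \<in> {start \<alpha>..1}"
  shows "norm (kb \<alpha> u s t) \<le> 4 * (\<bar>kk \<alpha> u\<bar> / (kD \<alpha> u s)\<^sup>2)"
proof -
  have D: "(kD \<alpha> u s)\<^sup>2 \<ge> 1/4"
    using power_mono[OF kD_ge[OF assms], of 2] by (simp add: power2_eq_square)
  have R: "(rad \<alpha> s)\<^sup>2 \<le> 1"
    using power_mono[of "rad \<alpha> s" 1 2] rad_nonneg[OF assms] center_plus_rad[OF assms] by simp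
  define K where "K = \<bar>kk \<alpha> u\<bar>"
  have K: "K \<ge> 0" by (simp add: K_def)
  have "norm (kb \<alpha> u s t) = K * (rad \<alpha> s)\<^sup>2 / (2 * (kD \<alpha> u s)\<^sup>2) / norm (ecis t - of_real (knu \<alpha> u s)) / (kD \<alpha> u s)\<^sup>2"
    unfolding kb_def K_def
    by (simp only: norm_mult norm_divide norm_of_real norm_ecis abs_mult abs_divide abs_minus_cancel abs_power2 abs_numeral mult_1_right)
  also have "\<dots> \<le> K / (2 * (kD \<alpha> u s)\<^sup>2) / (1/2) / (1/4)"
    using ecis_knu_bound[OF assms, of t] D R mult_left_le[OF R K] K
    by (intro frac_le) (auto simp: less_imp_le)
  also have "\<dots> = 4 * (K / (kD \<alpha> u s)\<^sup>2)" by simp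
  finally show ?thesis by (simp only: K_def)
qed

text \<open>Pointwise there is no uniform bound: at \<open>s = 1\<close>, where
  \<open>kdelta\<close> vanishes, the term with \<open>kb\<close> grows like \<open>norm y\<close>.
  The bound appears only after integration in \<open>s\<close>.\<close>

lemma kG_bounded:
  assumes h: "continuous_on (cball 0 1) h"
  obtains C where "\<And>y. Re (of_real (sgn \<alpha>) * y) < 1/4 \<Longrightarrow> norm (kG h y) \<le> C"
proof -
  let ?B = "cbox (start \<alpha>, 0) (1, 1::real)"
  have "compact ((\<lambda>x. h (circ \<alpha> (fst x) (snd x))) ` ?B)"
    by (intro compact_continuous_image continuous_on_box_circ h compact_cbox)
  then obtain M where M: "\<And>x. x \<in> ?B \<Longrightarrow> norm (h (circ \<alpha> (fst x) (snd x))) \<le> M"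
    using compact_imp_bounded bounded_iff by (metis (no_types, lifting) imageI)
  have "compact ((\<lambda>x. ka \<alpha> u (fst x) (snd x)) ` ?B)"
    by (intro compact_continuous_image continuous_on_ka compact_cbox)
  then obtain N where N: "\<And>x. x \<in> ?B \<Longrightarrow> norm (ka \<alpha> u (fst x) (snd x)) \<le> N"
    using compact_imp_bounded bounded_iff by (metis (no_types, lifting) imageI)
  have s1: "start \<alpha> \<le> 1" using start_bounds[of \<alpha>] by simp
  then have "(start \<alpha>, 0) \<in> ?B" by (simp add: mem_box_start)
  from M[OF this] N[OF this] have MN: "0 \<le> M" "0 \<le> N" using norm_ge_zero order_trans by blast+
  show thesis
  proof
    fix y :: complex assume y: "Re (of_real (sgn \<alpha>) * y) < 1/4"
    define W where "W s = norm y * (\<bar>kk \<alpha> u\<bar> / (kD \<alpha> u s)\<^sup>2) / (1 + norm y * \<bar>kdelta \<alpha> u s\<bar>)\<^sup>2" for s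
    have pos: "1 + norm y * \<bar>kdelta \<alpha> u s\<bar> > 0" for s
      by (rule add_pos_nonneg) auto
    have contW: "continuous_on ?B (\<lambda>x. W (fst x))"
      unfolding W_def using pos kD_nonzero
      by (intro continuous_intros continuous_on_kdelta ballI) (auto simp: mem_box_start less_imp_neq[symmetric])
    have Wint: "integral {start \<alpha>..1} W \<le> 1"
    proof -
      \<comment> \<open>Since \<open>kk / kD\<^sup>2\<close> is minus the derivative of
        \<open>kdelta\<close>, the majorant \<open>W\<close> is the derivative of
        \<open>1 / (1 + norm y * \<bar>kdelta\<bar>)\<close>, a quantity between 0 and 1 for every
        \<open>y\<close>.\<close>
      define E where "E s = 1 / (1 + norm y * (\<bar>kk \<alpha> u\<bar> * (1 - s) / kD \<alpha> u s))" for s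
      have "(W has_integral (E 1 - E (start \<alpha>))) {start \<alpha>..1}"
      proof (rule fundamental_theorem_of_calculus[OF s1])
        fix s assume s: "s \<in> {start \<alpha>..1}"
        have p: "1 + norm y * (\<bar>kk \<alpha> u\<bar> * (1 - s) / kD \<alpha> u s) \<noteq> 0"
          using pos[of s] unfolding kdelta_abs[OF s] by auto
        have "((\<lambda>s. (1 - s) / kD \<alpha> u s) has_real_derivative - 1 / (kD \<alpha> u s)\<^sup>2) (at s)"
          unfolding kD_def using kD_nonzero[OF s, unfolded kD_def]
          by (auto intro!: derivative_eq_intros simp: field_simps power2_eq_square)
        note dd = DERIV_cmult[OF this, of "norm y * \<bar>kk \<alpha> u\<bar>"]
        have "((\<lambda>s. 1 + norm y * (\<bar>kk \<alpha> u\<bar> * (1 - s) / kD \<alpha> u s)) has_real_derivative - (norm y * (\<bar>kk \<alpha> u\<bar> / (kD \<alpha> u s)\<^sup>2))) (at s)"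
          using DERIV_add[OF DERIV_const[of 1] dd] by (simp add: mult.assoc)
        from DERIV_inverse_fun[OF this p]
        have "(E has_real_derivative W s) (at s)"
          unfolding E_def[abs_def] W_def kdelta_abs[OF s] by (simp add: divide_inverse power2_eq_square mult_ac)
        then show "(E has_vector_derivative W s) (at s within {start \<alpha>..1})"
          by (simp add: has_real_derivative_iff_has_vector_derivative has_vector_derivative_at_within)
      qed
      moreover have "E 1 = 1" by (simp add: E_def)
      moreover have "E (start \<alpha>) \<ge> 0"
        unfolding E_def using pos[of "start \<alpha>"] kdelta_abs[of "start \<alpha>"] s1 by auto
      ultimately show ?thesis by (simp add: integral_unique)
    qed
    \<comment> \<open>The constant 144 is 4 from \<open>kb_bound\<close> times the square of the 6
      in \<open>kA_bounds\<close>.\<close>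
    have "norm (kG h y) \<le> integral ?B (\<lambda>x. M * (2 * N + 144 * W (fst x)))"
      unfolding kG_def
    proof (rule integral_norm_bound_integral)
      show "(\<lambda>x. h (circ \<alpha> (fst x) (snd x)) * kK \<alpha> u (fst x) (snd x) y) integrable_on ?B"
        by (intro integrable_continuous continuous_on_mult continuous_on_kK continuous_on_box_circ h y)
      show "(\<lambda>x. M * (2 * N + 144 * W (fst x))) integrable_on ?B"
        by (intro integrable_continuous continuous_intros contW)
      fix x :: "real \<times> real" assume x: "x \<in> ?B"
      then have s: "fst x \<in> {start \<alpha>..1}" by (simp add: mem_box_start)
      let ?A = "1 - y * of_real (kdelta \<alpha> u (fst x))"
      have A1: "inverse (norm ?A) \<le> 2"
        using le_imp_inverse_le[OF kA_bounds(1)[OF s y]] by simp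
      have A2: "inverse (norm ?A) \<le> 6 / (1 + norm y * \<bar>kdelta \<alpha> u (fst x)\<bar>)"
        using le_imp_inverse_le[OF kA_bounds(2)[OF s y]] pos[of "fst x"] by simp
      have "norm (kK \<alpha> u (fst x) (snd x) y) \<le> norm (ka \<alpha> u (fst x) (snd x)) * inverse (norm ?A)
        + norm (kb \<alpha> u (fst x) (snd x)) * norm y * (inverse (norm ?A))\<^sup>2"
        unfolding kK_def by (rule order_trans[OF norm_triangle_ineq])
          (simp add: norm_mult norm_divide norm_power norm_inverse divide_inverse power_inverse)
      also have "\<dots> \<le> N * 2 + (4 * (\<bar>kk \<alpha> u\<bar> / (kD \<alpha> u (fst x))\<^sup>2)) * norm y * (6 / (1 + norm y * \<bar>kdelta \<alpha> u (fst x)\<bar>))\<^sup>2"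
        using A1 A2 N[OF x] kb_bound[OF s] MN
        by (intro add_mono mult_mono power_mono) auto
      also have "\<dots> = 2 * N + 144 * W (fst x)"
        by (simp add: W_def power_divide)
      finally show "norm (h (circ \<alpha> (fst x) (snd x)) * kK \<alpha> u (fst x) (snd x) y) \<le> M * (2 * N + 144 * W (fst x))"
        unfolding norm_mult using M[OF x] MN by (intro mult_mono) auto
    qed
    also have "\<dots> = integral {start \<alpha>..1} (\<lambda>s. M * (2 * N + 144 * W s))"
    proof -
      have "continuous_on ?B (\<lambda>x. M * (2 * N + 144 * W (fst x)))"
        by (intro continuous_intros contW)
      from integral_prod_continuous[OF this] show ?thesis
        by (simp add: cbox_interval)
    qed
    also have "\<dots> = M * (2 * N * (1 - start \<alpha>) + 144 * integral {start \<alpha>..1} W)"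
    proof -
      have "continuous_on {start \<alpha>..1} (\<lambda>s. W (fst (s, 0::real)))"
        by (rule continuous_on_compose2[OF contW]) (auto intro!: continuous_intros simp: mem_box_start)
      then have "W integrable_on {start \<alpha>..1}" by (simp add: integrable_continuous_real)
      from integral_unique[OF has_integral_mult_right[OF has_integral_add[OF has_integral_const_real has_integral_mult_right[OF integrable_integral[OF this], of 144]], of M "2 * N"]]
      show ?thesis using s1 by (simp add: mult_ac)
    qed
    also have "\<dots> \<le> M * (2 * N * 1 + 144 * 1)"
      using MN Wint start_bounds[of \<alpha>] by (intro mult_left_mono add_mono) auto
    finally show "norm (kG h y) \<le> M * (2 * N * 1 + 144 * 1)" .
  qed
qed

lemma norm_shift_less_1:
  fixes y z :: complex
  assumes "norm y < 1/4" "norm z \<le> 1"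
  shows "norm (y * (z - of_real u)) < 1"
proof -
  have "norm (z - of_real u) \<le> 2"
    using norm_triangle_ineq4[of z "of_real u"] assms(2) u(1) by simp
  then have "norm (y * (z - of_real u)) \<le> 1/4 * 2"
    unfolding norm_mult using assms(1) by (intro mult_mono) auto
  then show ?thesis by simp
qed

lemma shift_nonzero:
  fixes y z :: complex
  assumes "norm y < 1/4" "norm z \<le> 1"
  shows "1 - y * (z - of_real u) \<noteq> 0"
  using norm_shift_less_1[OF assms] by auto

lemma cnj_nonzero:
  assumes "norm z \<le> 1"
  shows "1 - of_real u * cnj z \<noteq> 0"
proof
  assume "1 - of_real u * cnj z = 0"
  then have "norm (of_real u * cnj z) = 1" by simp
  moreover have "norm (of_real u * cnj z) \<le> 1/2 * 1"
    unfolding norm_mult using u(1) assms by (intro mult_mono) auto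
  ultimately show False by simp
qed

lemma continuous_on_kernel:
  assumes "continuous_on (cball 0 1) h" "norm y < 1/4"
  shows "continuous_on (cball 0 1) (\<lambda>z. h z / (1 - of_real u * cnj z)\<^sup>2 / (1 - y * (z - of_real u)))"
  by (intro continuous_intros assms(1) ballI) (use shift_nonzero[OF assms(2)] cnj_nonzero in auto)

text \<open>For small \<open>y\<close> the full and the reduced kernel have the same integral on
  each circle, by the moment condition with \<open>A = 1 + y * u\<close> and \<open>B = - y\<close>.
  Hence \<open>kG\<close> continues the left side analytically to a half plane.\<close>

lemma disc_int_kernel:
  assumes h: "continuous_on (cball 0 1) h" and ph: "pencil_holomorphic \<alpha> h" and y: "norm y < 1/4"
  shows "disc_int \<alpha> (\<lambda>z. h z / (1 - of_real u * cnj z)\<^sup>2 / (1 - y * (z - of_real u))) = kG h y"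
proof -
  let ?g = "\<lambda>z. h z / (1 - of_real u * cnj z)\<^sup>2 / (1 - y * (z - of_real u))"
  have "integral {0..1} (\<lambda>t. ?g (circ \<alpha> s t) * of_real (jac \<alpha> s t)) = integral {0..1} (\<lambda>t. h (circ \<alpha> s t) * kK \<alpha> u s t y)"
    if s: "s \<in> {start \<alpha>..1} - {start \<alpha>, 1}" for s
  proof -
    have s1: "s \<in> {start \<alpha><..<1}" and s2: "s \<in> {start \<alpha>..1}" using s by auto
    define c where "c = of_real (rad \<alpha> s) * (of_real (- kk \<alpha> u * rad \<alpha> s / (2 * (kD \<alpha> u s)\<^sup>2)) * of_real (rad \<alpha> s) * y\<^sup>2 / (1 - y * of_real (kdelta \<alpha> u s))\<^sup>2
       + of_real (kQ \<alpha> u s) * y / (1 - y * of_real (kdelta \<alpha> u s)) - of_real \<alpha> / 2) / of_real ((kD \<alpha> u s)\<^sup>2)"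
    have eq: "?g (circ \<alpha> s t) * of_real (jac \<alpha> s t) = h (circ \<alpha> s t) * kK \<alpha> u s t y
        + c * (h (circ \<alpha> s t) * ecis t / ((1 + y * of_real u) + (- y) * circ \<alpha> s t))" for t
    proof -
      have den: "(1 + y * of_real u) + (- y) * circ \<alpha> s t = 1 - y * (circ \<alpha> s t - of_real u)"
        by (simp add: algebra_simps)
      have "?g (circ \<alpha> s t) * of_real (jac \<alpha> s t) = h (circ \<alpha> s t) *
        (of_real (jac \<alpha> s t) / (1 - of_real u * cnj (circ \<alpha> s t))\<^sup>2 / (1 - y * (circ \<alpha> s t - of_real u)))"
        by simp
      also have "\<dots> = h (circ \<alpha> s t) * (kK \<alpha> u s t y + c * (ecis t / (1 - y * (circ \<alpha> s t - of_real u))))"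
        unfolding kernel_decomposition[OF s1 y] c_def by simp
      also have "\<dots> = h (circ \<alpha> s t) * kK \<alpha> u s t y
          + c * (h (circ \<alpha> s t) * ecis t / (1 - y * (circ \<alpha> s t - of_real u)))"
        by (simp add: distrib_left mult_ac)
      finally show ?thesis unfolding den .
    qed
    have hc: "continuous_on {0..1} (\<lambda>t. h (circ \<alpha> s t))"
      by (rule continuous_on_compose2[OF h]) (auto intro!: continuous_intros norm_circ_le s2 simp: dist_norm simp del: atLeastAtMost_iff)
    have den: "(1 + y * of_real u) + (- y) * z = 1 - y * (z - of_real u)" for z
      by (simp add: algebra_simps)
    have in_disc: "norm z \<le> 1" if "z \<in> cball (of_real ((1 - s) * \<alpha>)) (rad \<alpha> s)" for z :: complex
    proof -
      have "norm z \<le> norm (complex_of_real ((1 - s) * \<alpha>)) + norm (z - of_real ((1 - s) * \<alpha>))"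
        by (rule norm_triangle_sub)
      also have "\<dots> \<le> \<bar>(1 - s) * \<alpha>\<bar> + rad \<alpha> s"
        using that unfolding norm_of_real mem_cball dist_norm by (intro add_mono) (auto simp: norm_minus_commute)
      finally show ?thesis using center_plus_rad[OF s2] by simp
    qed
    have nz: "\<forall>z\<in>cball (of_real ((1 - s) * \<alpha>)) (rad \<alpha> s). (1 + y * of_real u) + (- y) * z \<noteq> 0"
      unfolding den using shift_nonzero[OF y in_disc] by blast
    have "integral {0..1} (\<lambda>t. h (circ \<alpha> s t) * ecis t / ((1 + y * of_real u) + (- y) * circ \<alpha> s t)) = 0"
      using ph s1 nz unfolding pencil_holomorphic_def by blast
    moreover have i1: "(\<lambda>t. h (circ \<alpha> s t) * ecis t / ((1 + y * of_real u) + (- y) * circ \<alpha> s t)) integrable_on {0..1}"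
      unfolding den by (intro integrable_continuous_real continuous_intros hc ballI shift_nonzero[OF y norm_circ_le[OF s2]])
    ultimately have "((\<lambda>t. h (circ \<alpha> s t) * ecis t / ((1 + y * of_real u) + (- y) * circ \<alpha> s t)) has_integral 0) {0..1}"
      using integrable_integral[OF i1] by (simp only:)
    from has_integral_mult_right[OF this, of c]
    have i0: "((\<lambda>t. c * (h (circ \<alpha> s t) * ecis t / ((1 + y * of_real u) + (- y) * circ \<alpha> s t))) has_integral 0) {0..1}"
      by simp
    have i2: "(\<lambda>t. h (circ \<alpha> s t) * kK \<alpha> u s t y) integrable_on {0..1}"
    proof -
      have "continuous_on {0..1::real} (Pair s)"
        by (intro continuous_intros)
      moreover have "Pair s ` {0..1} \<subseteq> cbox (start \<alpha>, 0) (1, 1::real)"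
        using s2 by (auto simp: mem_box_start cbox_interval)
      ultimately have "continuous_on {0..1} (\<lambda>t. kK \<alpha> u (fst (s, t)) (snd (s, t)) y)"
        by (rule continuous_on_compose2[OF continuous_on_kK[OF small_imp_half_plane[OF y]]])
      then have "continuous_on {0..1} (\<lambda>t. kK \<alpha> u s t y)"
        by (simp only: fst_conv snd_conv)
      from continuous_on_mult[OF hc this] show ?thesis
        by (rule integrable_continuous_real)
    qed
    from integral_unique[OF has_integral_add[OF integrable_integral[OF i2] i0]] show ?thesis
      unfolding eq by (simp only: add_0_right)
  qed
  \<comment> \<open>The moment conditions concern parameters strictly between the endpoints; the two
    extreme circles form a null set.\<close>
  then have 1: "integral {start \<alpha>..1} (\<lambda>s. integral {0..1} (\<lambda>t. ?g (circ \<alpha> s t) * of_real (jac \<alpha> s t)))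
    = integral {start \<alpha>..1} (\<lambda>s. integral {0..1} (\<lambda>t. h (circ \<alpha> s t) * kK \<alpha> u s t y))"
  proof -
    assume *: "\<And>s. s \<in> {start \<alpha>..1} - {start \<alpha>, 1} \<Longrightarrow> integral {0..1} (\<lambda>t. ?g (circ \<alpha> s t) * of_real (jac \<alpha> s t))
      = integral {0..1} (\<lambda>t. h (circ \<alpha> s t) * kK \<alpha> u s t y)"
    show ?thesis
      by (rule integral_spike[where S = "{start \<alpha>, 1}", OF _ *[symmetric]]) (simp, assumption)
  qed
  have 2: "integral {start \<alpha>..1} (\<lambda>s. integral {0..1} (\<lambda>t. h (circ \<alpha> s t) * kK \<alpha> u s t y)) = kG h y"
  proof -
    have "continuous_on (cbox (start \<alpha>, 0) (1, 1)) (\<lambda>x. h (circ \<alpha> (fst x) (snd x)) * kK \<alpha> u (fst x) (snd x) y)"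
      by (intro continuous_on_mult continuous_on_box_circ h continuous_on_kK small_imp_half_plane y)
    from integral_prod_continuous[OF this] show ?thesis
      unfolding kG_def by (simp only: fst_conv snd_conv cbox_interval)
  qed
  show ?thesis
    by (rule trans[OF disc_int_eq_iterated[OF continuous_on_kernel[OF h y]] trans[OF 1 2]])
qed

end

section \<open>Liouville's theorem and moments over the disc\<close>

lemma continuous_on_cball_bound:
  fixes h :: "complex \<Rightarrow> complex"
  assumes "continuous_on (cball 0 1) h"
  shows "\<exists>W\<ge>0. \<forall>z. norm z \<le> 1 \<longrightarrow> norm (h z) \<le> W"
proof -
  have "bounded (h ` cball 0 1)"
    by (intro compact_imp_bounded compact_continuous_image assms compact_cball)
  then obtain W where W: "\<And>w. w \<in> h ` cball 0 1 \<Longrightarrow> norm w \<le> W"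
    unfolding bounded_iff by blast
  have "norm (h z) \<le> W" if "norm z \<le> 1" for z using that by (intro W imageI) simp
  moreover from this[of 0] have "W \<ge> 0" using order_trans[OF norm_ge_zero] by simp
  ultimately show ?thesis by blast
qed

lemma integral_sums_cbox:
  fixes f :: "nat \<Rightarrow> 'a::euclidean_space \<Rightarrow> complex"
  assumes cont: "\<And>n. continuous_on (cbox a b) (f n)"
    and bound: "\<And>n x. x \<in> cbox a b \<Longrightarrow> norm (f n x) \<le> M n" and M: "summable M"
    and g: "\<And>x. x \<in> cbox a b \<Longrightarrow> (\<lambda>n. f n x) sums g x"
  shows "(\<lambda>n. integral (cbox a b) (f n)) sums integral (cbox a b) g"
proof -
  have "uniform_limit (cbox a b) (\<lambda>n x. \<Sum>i<n. f i x) (\<lambda>x. suminf (\<lambda>i. f i x)) sequentially"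
    by (rule Weierstrass_m_test[OF bound M])
  then have "uniform_limit (cbox a b) (\<lambda>n x. \<Sum>i<n. f i x) g sequentially"
    by (rule uniform_limit_cong'[THEN iffD1, rotated -1]) (auto simp: sums_unique[OF g])
  then obtain I J where IJ: "\<And>n. ((\<lambda>x. \<Sum>i<n. f i x) has_integral I n) (cbox a b)"
    "(g has_integral J) (cbox a b)" "I \<longlonglongrightarrow> J"
    by (rule uniform_limit_integral_cbox) (auto intro!: continuous_on_sum cont)
  have "I = (\<lambda>n. \<Sum>i<n. integral (cbox a b) (f i))"
  proof
    show "I n = (\<Sum>i<n. integral (cbox a b) (f i))" for n
      using integral_unique[OF IJ(1)[of n]] by (simp add: integral_sum integrable_continuous cont)
  qed
  then show ?thesis
    using IJ(2,3) by (simp add: sums_def integral_unique)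
qed

lemma disc_int_sums:
  assumes cont: "\<And>n. continuous_on (cball 0 1) (f n)"
    and bound: "\<And>n z. norm z \<le> 1 \<Longrightarrow> norm (f n z) \<le> M n" and M: "summable M"
    and g: "\<And>z. norm z \<le> 1 \<Longrightarrow> (\<lambda>n. f n z) sums g z"
  shows "(\<lambda>n. disc_int \<alpha> (f n)) sums disc_int \<alpha> g"
proof -
  have "compact ((\<lambda>x. jac \<alpha> (fst x) (snd x)) ` cbox (start \<alpha>, 0) (1, 1))"
    by (intro compact_continuous_image continuous_intros compact_cbox)
  then obtain K where K: "\<And>x. x \<in> cbox (start \<alpha>, 0) (1, 1) \<Longrightarrow> norm (jac \<alpha> (fst x) (snd x)) \<le> K"
    using compact_imp_bounded bounded_iff by (metis (no_types, lifting) imageI)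
  have z: "norm (circ \<alpha> (fst x) (snd x)) \<le> 1" if "x \<in> cbox (start \<alpha>, 0) (1, 1::real)" for x
    using that by (intro norm_circ_le) (simp add: mem_box_start)
  show ?thesis
    unfolding disc_int_def case_prod_unfold
  proof (rule integral_sums_cbox)
    show "continuous_on (cbox (start \<alpha>, 0) (1, 1)) (\<lambda>p. f n (circ \<alpha> (fst p) (snd p)) * of_real (jac \<alpha> (fst p) (snd p)))" for n
      by (intro continuous_on_mult continuous_on_box_circ cont continuous_intros)
    show "summable (\<lambda>n. M n * K)" using M by (rule summable_mult2)
    show "norm (f n (circ \<alpha> (fst x) (snd x)) * of_real (jac \<alpha> (fst x) (snd x))) \<le> M n * K"
      if "x \<in> cbox (start \<alpha>, 0) (1, 1)" for x n
      unfolding norm_mult norm_of_real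
      using bound[OF z[OF that], of n] K[OF that] norm_ge_zero order_trans[OF norm_ge_zero bound[OF z[OF that], of n]]
      by (intro mult_mono) auto
    show "(\<lambda>n. f n (circ \<alpha> (fst x) (snd x)) * of_real (jac \<alpha> (fst x) (snd x))) sums
        (g (circ \<alpha> (fst x) (snd x)) * of_real (jac \<alpha> (fst x) (snd x)))"
      if "x \<in> cbox (start \<alpha>, 0) (1, 1)" for x
      by (intro sums_mult2 g z that)
  qed
qed

text \<open>Zeros of a nonzero power series are isolated, so real arguments suffice. This matters
  because the moment identities are known for real \<open>u\<close> only.\<close>

lemma powser_eq_0:
  fixes a :: "nat \<Rightarrow> complex"
  assumes "0 < r" and sm: "\<And>x. norm x < r \<Longrightarrow> (\<lambda>n. a n * x ^ n) sums f x"
    and zero: "\<And>t. \<bar>t\<bar> < r \<Longrightarrow> f (of_real t) = 0"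
  shows "a n = 0"
proof (rule ccontr)
  assume n: "a n \<noteq> 0"
  have f0: "f 0 = 0" using zero[of 0] assms(1) by simp
  have "a 0 = 0"
    using sums_unique2[OF sm[of 0] powser_sums_zero[of a]] assms(1) f0 by simp
  then have "n > 0" using n by (cases n) auto
  then obtain s where s: "0 < s" "\<And>z. z \<in> cball 0 s - {0} \<Longrightarrow> f z \<noteq> 0"
    using powser_0_nonzero[of r 0 a f n] assms(1) sm f0 n by auto
  have "complex_of_real (min s (r / 2)) \<in> cball 0 s - {0}"
    using s(1) assms(1) by (auto simp: dist_norm min_def)
  from s(2)[OF this] zero[of "min s (r / 2)"] assms(1) s(1) show False
    by (auto simp: min_def split: if_splits)
qed

text \<open>The opposite signs of \<open>\<alpha>\<close> and \<open>\<beta>\<close> enter here. One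
  pencil puts its poles in \<open>y\<close> on the positive ray, the other on the negative ray; the
  two half planes overlap in a strip and cover the plane. Both continuations agree near 0, since
  \<open>disc_int\<close> does not depend on the pencil, and glue to a bounded entire
  function.\<close>

lemma pencil_kernel_constant:
  fixes \<alpha> \<beta> u :: real
  assumes ab: "\<beta> < 0" "0 < \<alpha>" and u: "\<bar>u\<bar> \<le> 1/2" "\<bar>u\<bar> < \<bar>\<alpha>\<bar>" "\<bar>u\<bar> * \<bar>\<alpha>\<bar> < 1" "\<bar>u\<bar> < \<bar>\<beta>\<bar>" "\<bar>u\<bar> * \<bar>\<beta>\<bar> < 1"
    and h: "continuous_on (cball 0 1) h" and p: "pencil_holomorphic \<alpha> h" "pencil_holomorphic \<beta> h"
    and y: "norm y < 1/4"
  shows "disc_int 0 (\<lambda>z. h z / (1 - of_real u * cnj z)\<^sup>2 / (1 - y * (z - of_real u))) =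
         disc_int 0 (\<lambda>z. h z / (1 - of_real u * cnj z)\<^sup>2)"
proof -
  have \<alpha>: "\<alpha> \<noteq> 0" and \<beta>: "\<beta> \<noteq> 0" using ab by auto
  let ?A = "{y. Re y < 1/4}" and ?B = "{y. Re y > - (1/4)}"
  let ?g = "\<lambda>y z. h z / (1 - of_real u * cnj z)\<^sup>2 / (1 - y * (z - of_real u))"
  have eqA: "kG \<alpha> u h y = disc_int 0 (?g y)" if "norm y < 1/4" for y
    using disc_int_kernel[OF \<alpha> u(1-3) h p(1) that]
      disc_int_independent[OF continuous_on_kernel[OF \<alpha> u(1-3) h that], of \<alpha>] by (simp only:)
  have eqB: "kG \<beta> u h y = disc_int 0 (?g y)" if "norm y < 1/4" for y
    using disc_int_kernel[OF \<beta> u(1,4,5) h p(2) that]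
      disc_int_independent[OF continuous_on_kernel[OF \<alpha> u(1-3) h that], of \<beta>] by (simp only:)
  have HA: "kG \<alpha> u h holomorphic_on ?A"
    using kG_holomorphic[OF \<alpha> u(1-3) h] ab by simp
  have HB: "kG \<beta> u h holomorphic_on ?B"
    using kG_holomorphic[OF \<beta> u(1,4,5) h] ab by (simp add: minus_less_iff)
  obtain C1 where C1: "\<And>y. y \<in> ?A \<Longrightarrow> norm (kG \<alpha> u h y) \<le> C1"
    using kG_bounded[OF \<alpha> u(1-3) h] ab by auto
  obtain C2 where C2: "\<And>y. y \<in> ?B \<Longrightarrow> norm (kG \<beta> u h y) \<le> C2"
    using kG_bounded[OF \<beta> u(1,4,5) h] ab by (auto simp: minus_less_iff)
  define F where "F y = (if y \<in> ?A then kG \<alpha> u h y else kG \<beta> u h y)" for y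
  have oA: "open ?A" and oB: "open ?B"
    by (rule open_halfspace_Re_lt, rule open_halfspace_Re_gt)
  have "F holomorphic_on (?A \<union> ?B)"
    unfolding F_def
  proof (rule holomorphic_on_If_Un[OF HA HB oA oB])
    fix z assume z: "z \<in> ?A" "z \<in> ?B"
    show "kG \<alpha> u h z = kG \<beta> u h z"
    proof (rule analytic_continuation_open[of "ball 0 (1/4)" "?A \<inter> ?B" "kG \<alpha> u h" "kG \<beta> u h"])
      show "connected (?A \<inter> ?B)"
        by (rule convex_connected[OF convex_Int[OF convex_halfspace_Re_lt convex_halfspace_Re_gt]])
      show "ball 0 (1/4) \<subseteq> ?A \<inter> ?B"
      proof
        fix y :: complex assume "y \<in> ball 0 (1/4)"
        then have "\<bar>Re y\<bar> < 1/4" using abs_Re_le_cmod[of y] by simp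
        then have "Re y < 1/4" "- (1/4) < Re y" by linarith+
        then show "y \<in> ?A \<inter> ?B" by (intro IntI CollectI)
      qed
      show "kG \<alpha> u h holomorphic_on ?A \<inter> ?B" "kG \<beta> u h holomorphic_on ?A \<inter> ?B"
        using holomorphic_on_subset[OF HA Int_lower1] holomorphic_on_subset[OF HB Int_lower2] by blast+
      show "open (?A \<inter> ?B)" using oA oB by (rule open_Int)
      show "kG \<alpha> u h y = kG \<beta> u h y" if "y \<in> ball 0 (1/4)" for y
        using that eqA[of y] eqB[of y] by simp
      show "z \<in> ?A \<inter> ?B" using z by (rule IntI)
    qed auto
  qed
  moreover have "?A \<union> ?B = UNIV" by auto
  ultimately have "F holomorphic_on UNIV" by simp
  moreover have "bounded (range F)"
  proof (rule boundedI)
    fix x assume "x \<in> range F"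
    then obtain y where x: "x = F y" by blast
    show "norm x \<le> max C1 C2"
      using C1[of y] C2[of y] unfolding x F_def by (cases "y \<in> ?A") auto
  qed
  ultimately have "F constant_on UNIV" by (rule Liouville_theorem)
  then obtain v where "\<And>x. F x = v" unfolding constant_on_def by blast
  then have "F y = F 0" by simp
  moreover have "y \<in> ?A" using y complex_Re_le_cmod[of y] by simp
  moreover have "(0::complex) \<in> ?A" by simp
  ultimately have "kG \<alpha> u h y = kG \<alpha> u h 0" unfolding F_def by (simp only: if_True)
  then show ?thesis using eqA[OF y] eqA[of 0] by simp
qed

lemma continuous_on_disc_kernel:
  fixes h :: "complex \<Rightarrow> complex"
  assumes "continuous_on (cball 0 1) h" "\<bar>u\<bar> \<le> 1/2"
  shows "continuous_on (cball 0 1) (\<lambda>z. h z / (1 - of_real u * cnj z)\<^sup>2)"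
proof (intro continuous_intros assms(1) ballI)
  fix z :: complex assume z: "z \<in> cball 0 1"
  have "norm (of_real u * cnj z) \<le> 1/2 * 1"
    unfolding norm_mult using assms z by (intro mult_mono) auto
  then show "(1 - of_real u * cnj z)\<^sup>2 \<noteq> 0" by auto
qed

text \<open>Expanding in \<open>y\<close>, constancy says that the weighted integrals of
  \<open>h * (z - u) ^ n\<close> vanish for \<open>n > 0\<close>. In terms of the Bergman
  projection, whose kernel at \<open>u\<close> is the weight up to a constant: the projection of
  \<open>h * z ^ n\<close> takes at \<open>u\<close> the value \<open>u ^ n\<close> times that of
  the projection of \<open>h\<close>.\<close>

lemma pencil_kernel_moments:
  fixes \<alpha> \<beta> u :: real
  assumes ab: "\<beta> < 0" "0 < \<alpha>" and u: "\<bar>u\<bar> \<le> 1/2" "\<bar>u\<bar> < \<bar>\<alpha>\<bar>" "\<bar>u\<bar> * \<bar>\<alpha>\<bar> < 1" "\<bar>u\<bar> < \<bar>\<beta>\<bar>" "\<bar>u\<bar> * \<bar>\<beta>\<bar> < 1"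
    and h: "continuous_on (cball 0 1) h" and p: "pencil_holomorphic \<alpha> h" "pencil_holomorphic \<beta> h"
  shows "disc_int 0 (\<lambda>z. h z / (1 - of_real u * cnj z)\<^sup>2 * z ^ n) =
         of_real u ^ n * disc_int 0 (\<lambda>z. h z / (1 - of_real u * cnj z)\<^sup>2)"
proof -
  define w where "w z = h z / (1 - of_real u * cnj z)\<^sup>2" for z
  have cw: "continuous_on (cball 0 1) w"
    unfolding w_def by (rule continuous_on_disc_kernel[OF h u(1)])
  obtain W where W0: "W \<ge> 0" and W: "\<And>z. norm z \<le> 1 \<Longrightarrow> norm (w z) \<le> W"
    using continuous_on_cball_bound[OF cw] by blast
  have sums: "(\<lambda>n. disc_int 0 (\<lambda>z. w z * (z - of_real u) ^ n) * y ^ n) sums disc_int 0 w" if y: "norm y < 1/4" for y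
  proof -
    have "(\<lambda>n. disc_int 0 (\<lambda>z. w z * (y * (z - of_real u)) ^ n)) sums disc_int 0 (\<lambda>z. w z * (1 / (1 - y * (z - of_real u))))"
    proof (rule disc_int_sums)
      show "continuous_on (cball 0 1) (\<lambda>z. w z * (y * (z - of_real u)) ^ n)" for n
        by (intro continuous_intros cw)
      show "summable (\<lambda>n. W * (1/2) ^ n)" by (intro summable_mult summable_geometric) auto
      fix z :: complex assume z: "norm z \<le> 1"
      have "norm (z - of_real u) \<le> 2"
        using norm_triangle_ineq4[of z "of_real u"] z u(1) by simp
      then have b: "norm (y * (z - of_real u)) \<le> 1/4 * 2"
        unfolding norm_mult using y by (intro mult_mono) auto
      show "norm (w z * (y * (z - of_real u)) ^ n) \<le> W * (1/2) ^ n" for n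
        unfolding norm_mult[of "w z"] norm_power using W[OF z] b W0 by (intro mult_mono power_mono) auto
      show "(\<lambda>n. w z * (y * (z - of_real u)) ^ n) sums (w z * (1 / (1 - y * (z - of_real u))))"
        using b by (intro sums_mult geometric_sums) auto
    qed
    moreover have "disc_int 0 (\<lambda>z. w z * (y * (z - of_real u)) ^ n) = disc_int 0 (\<lambda>z. w z * (z - of_real u) ^ n) * y ^ n" for n
    proof -
      have eq: "w z * (y * (z - of_real u)) ^ n = y ^ n * (w z * (z - of_real u) ^ n)" for z
        by (simp add: power_mult_distrib mult_ac)
      show ?thesis unfolding eq disc_int_cmult by (rule mult.commute)
    qed
    moreover have "disc_int 0 (\<lambda>z. w z * (1 / (1 - y * (z - of_real u)))) = disc_int 0 w"
      using pencil_kernel_constant[OF ab u h p y] unfolding w_def by simp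
    ultimately show ?thesis by simp
  qed
  define b where "b n = (if n = 0 then 0 else disc_int 0 (\<lambda>z. w z * (z - of_real u) ^ n))" for n
  have "b n = 0" for n
  proof (rule powser_eq_0[of "1/4" b "\<lambda>_. 0"])
    fix x :: complex assume x: "norm x < 1/4"
    have "(\<lambda>n. if n = 0 then disc_int 0 w else 0) sums disc_int 0 w" by (rule sums_single)
    from sums_diff[OF sums[OF x] this]
    have "(\<lambda>n. disc_int 0 (\<lambda>z. w z * (z - of_real u) ^ n) * x ^ n - (if n = 0 then disc_int 0 w else 0)) sums 0" by simp
    also have "(\<lambda>n. disc_int 0 (\<lambda>z. w z * (z - of_real u) ^ n) * x ^ n - (if n = 0 then disc_int 0 w else 0)) = (\<lambda>n. b n * x ^ n)"
      by (auto simp: b_def fun_eq_iff)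
    finally show "(\<lambda>n. b n * x ^ n) sums 0" .
  qed auto
  then have van0: "disc_int 0 (\<lambda>z. w z * (z - of_real u) ^ Suc n) = 0" for n
    using b_def[of "Suc n"] by simp
  \<comment> \<open>The extra factor \<open>z ^ m\<close> is absorbed by writing
    \<open>z = (z - u) + u\<close>, which is why the induction on \<open>m\<close> leaves
    \<open>n\<close> arbitrary.\<close>
  have van: "disc_int 0 (\<lambda>z. w z * (z - of_real u) ^ Suc n * z ^ m) = 0" for n m
  proof (induction m arbitrary: n)
    case 0
    then show ?case using van0 by simp
  next
    case (Suc m)
    have eq: "w z * (z - of_real u) ^ Suc n * z ^ Suc m = w z * (z - of_real u) ^ Suc (Suc n) * z ^ m +
      of_real u * (w z * (z - of_real u) ^ Suc n * z ^ m)" for z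
      by (simp add: algebra_simps)
    have "disc_int 0 (\<lambda>z. w z * (z - of_real u) ^ Suc n * z ^ Suc m) = disc_int 0 (\<lambda>z. w z * (z - of_real u) ^ Suc (Suc n) * z ^ m)
      + disc_int 0 (\<lambda>z. of_real u * (w z * (z - of_real u) ^ Suc n * z ^ m))"
      unfolding eq by (intro disc_int_add continuous_intros cw)
    then show ?case unfolding Suc.IH disc_int_cmult by simp
  qed
  have "disc_int 0 (\<lambda>z. w z * z ^ n) = of_real u ^ n * disc_int 0 w"
  proof (induction n)
    case (Suc n)
    have eq: "w z * z ^ Suc n = w z * (z - of_real u) ^ Suc 0 * z ^ n + of_real u * (w z * z ^ n)" for z
      by (simp add: algebra_simps)
    have "disc_int 0 (\<lambda>z. w z * z ^ Suc n) = disc_int 0 (\<lambda>z. w z * (z - of_real u) ^ Suc 0 * z ^ n) + disc_int 0 (\<lambda>z. of_real u * (w z * z ^ n))"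
      unfolding eq by (intro disc_int_add continuous_intros cw)
    then show ?case unfolding van disc_int_cmult Suc.IH by simp
  qed simp
  then show ?thesis unfolding w_def .
qed

text \<open>Comparison of coefficients in \<open>u\<close>: the weight
  \<open>1 / (1 - u * cnj z)\<^sup>2\<close> is the series with terms
  \<open>(l + 1) * u ^ l * cnj z ^ l\<close>, and the factor \<open>u ^ n\<close> in
  \<open>pencil_kernel_moments\<close> shifts indices by \<open>n\<close>, which also produces the
  zeros for \<open>l < n\<close>.\<close>

lemma pencil_moments:
  fixes \<alpha> \<beta> :: real
  assumes ab: "\<beta> < 0" "0 < \<alpha>"
    and h: "continuous_on (cball 0 1) h" and p: "pencil_holomorphic \<alpha> h" "pencil_holomorphic \<beta> h"
  shows "of_nat (Suc l) * disc_int 0 (\<lambda>z. h z * (cnj z ^ l * z ^ n)) =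
    (if l < n then 0 else of_nat (Suc (l - n)) * disc_int 0 (\<lambda>z. h z * cnj z ^ (l - n)))"
proof -
  define a where "a n l = of_nat (Suc l) * disc_int 0 (\<lambda>z. h z * (cnj z ^ l * z ^ n))" for n l
  obtain W where W0: "W \<ge> 0" and W: "\<And>z. norm z \<le> 1 \<Longrightarrow> norm (h z) \<le> W"
    using continuous_on_cball_bound[OF h] by blast
  have sums: "(\<lambda>l. a n l * x ^ l) sums disc_int 0 (\<lambda>z. h z / (1 - x * cnj z)\<^sup>2 * z ^ n)" if x: "norm x < 1/2" for x n
  proof -
    have "(\<lambda>l. disc_int 0 (\<lambda>z. h z * z ^ n * (of_nat (Suc l) * (x * cnj z) ^ l))) sums disc_int 0 (\<lambda>z. h z * z ^ n * (1 / (1 - x * cnj z)\<^sup>2))"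
    proof (rule disc_int_sums)
      show "continuous_on (cball 0 1) (\<lambda>z. h z * z ^ n * (of_nat (Suc l) * (x * cnj z) ^ l))" for l
        by (intro continuous_intros h)
      have "summable (\<lambda>l. real (Suc l) * (1/2) ^ l)"
        using geometric_deriv_sums[of "1/2::real"] by (auto simp: sums_iff)
      then show "summable (\<lambda>l. W * 1 * (real (Suc l) * (1/2) ^ l))" by (rule summable_mult)
      fix z :: complex assume z: "norm z \<le> 1"
      have b: "norm (x * cnj z) \<le> 1/2 * 1"
        unfolding norm_mult using x z by (intro mult_mono) auto
      have zn: "norm (z ^ n) \<le> 1" unfolding norm_power using z by (simp add: power_le_one)
      show "norm (h z * z ^ n * (of_nat (Suc l) * (x * cnj z) ^ l)) \<le> W * 1 * (real (Suc l) * (1/2) ^ l)" for l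
        unfolding norm_mult[of "h z * z ^ n"] norm_mult[of "h z"] norm_mult[of "of_nat _"] norm_of_nat norm_power[of "x * cnj z"]
        using W[OF z] zn b W0 by (intro mult_mono power_mono) auto
      have "norm (x * cnj z) < 1" using b by simp
      then show "(\<lambda>l. h z * z ^ n * (of_nat (Suc l) * (x * cnj z) ^ l)) sums (h z * z ^ n * (1 / (1 - x * cnj z)\<^sup>2))"
        by (intro sums_mult geometric_deriv_sums)
    qed
    moreover have "disc_int 0 (\<lambda>z. h z * z ^ n * (of_nat (Suc l) * (x * cnj z) ^ l)) = a n l * x ^ l" for l
    proof -
      have eq: "h z * z ^ n * (of_nat (Suc l) * (x * cnj z) ^ l) = of_nat (Suc l) * x ^ l * (h z * (cnj z ^ l * z ^ n))" for z
        by (simp only: power_mult_distrib mult_ac)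
      show ?thesis unfolding eq disc_int_cmult a_def by (simp only: mult_ac)
    qed
    moreover have "h z * z ^ n * (1 / (1 - x * cnj z)\<^sup>2) = h z / (1 - x * cnj z)\<^sup>2 * z ^ n" for z
      by simp
    ultimately show ?thesis by (simp only:)
  qed
  \<comment> \<open>Every real \<open>u\<close> with \<open>\<bar>u\<bar> < r\<close> satisfies all
    conditions of \<open>pencil_kernel_moments\<close> for both base points.\<close>
  define r where "r = min (1/2) (min (min \<bar>\<alpha>\<bar> \<bar>\<beta>\<bar>) (min (1 / \<bar>\<alpha>\<bar>) (1 / \<bar>\<beta>\<bar>)))"
  have r: "0 < r" "r \<le> 1/2" using ab by (auto simp: r_def)
  have "a n l - (if l < n then 0 else a 0 (l - n)) = 0"
  proof (rule powser_eq_0[OF r(1), where a = "\<lambda>l. a n l - (if l < n then 0 else a 0 (l - n))"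
      and f = "\<lambda>x. disc_int 0 (\<lambda>z. h z / (1 - x * cnj z)\<^sup>2 * z ^ n) - x ^ n * disc_int 0 (\<lambda>z. h z / (1 - x * cnj z)\<^sup>2 * z ^ 0)"])
    fix x :: complex assume "norm x < r"
    then have x: "norm x < 1/2" using r by simp
    let ?g = "\<lambda>l. if l < n then 0 else a 0 (l - n) * x ^ l"
    have "(\<lambda>l. ?g (l + n)) sums (x ^ n * disc_int 0 (\<lambda>z. h z / (1 - x * cnj z)\<^sup>2 * z ^ 0))"
      using sums_mult[OF sums[OF x, of 0], of "x ^ n"] by (simp add: power_add mult_ac)
    then have "?g sums (x ^ n * disc_int 0 (\<lambda>z. h z / (1 - x * cnj z)\<^sup>2 * z ^ 0) + (\<Sum>i<n. ?g i))"
      by (subst (asm) sums_iff_shift)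
    then have "?g sums (x ^ n * disc_int 0 (\<lambda>z. h z / (1 - x * cnj z)\<^sup>2 * z ^ 0))" by simp
    from sums_diff[OF sums[OF x, of n] this]
    have "(\<lambda>l. a n l * x ^ l - ?g l) sums (disc_int 0 (\<lambda>z. h z / (1 - x * cnj z)\<^sup>2 * z ^ n) - x ^ n * disc_int 0 (\<lambda>z. h z / (1 - x * cnj z)\<^sup>2 * z ^ 0))" .
    moreover have "a n l * x ^ l - ?g l = (a n l - (if l < n then 0 else a 0 (l - n))) * x ^ l" for l
      by (simp add: left_diff_distrib)
    ultimately show "(\<lambda>l. (a n l - (if l < n then 0 else a 0 (l - n))) * x ^ l) sums (disc_int 0 (\<lambda>z. h z / (1 - x * cnj z)\<^sup>2 * z ^ n) - x ^ n * disc_int 0 (\<lambda>z. h z / (1 - x * cnj z)\<^sup>2 * z ^ 0))"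
      by simp
  next
    fix t :: real assume t: "\<bar>t\<bar> < r"
    then have "\<bar>t\<bar> < 1 / \<bar>\<alpha>\<bar>" "\<bar>t\<bar> < 1 / \<bar>\<beta>\<bar>" by (auto simp: r_def)
    moreover have "0 < \<bar>\<alpha>\<bar>" "0 < \<bar>\<beta>\<bar>" using ab by auto
    ultimately have "\<bar>t\<bar> * \<bar>\<alpha>\<bar> < 1" "\<bar>t\<bar> * \<bar>\<beta>\<bar> < 1" by (simp_all only: pos_less_divide_eq)
    moreover have "\<bar>t\<bar> \<le> 1/2" "\<bar>t\<bar> < \<bar>\<alpha>\<bar>" "\<bar>t\<bar> < \<bar>\<beta>\<bar>" using t by (auto simp: r_def)
    ultimately have "disc_int 0 (\<lambda>z. h z / (1 - of_real t * cnj z)\<^sup>2 * z ^ n) = of_real t ^ n * disc_int 0 (\<lambda>z. h z / (1 - of_real t * cnj z)\<^sup>2)"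
      by (intro pencil_kernel_moments[OF ab _ _ _ _ _ h p])
    then show "disc_int 0 (\<lambda>z. h z / (1 - of_real t * cnj z)\<^sup>2 * z ^ n) - of_real t ^ n * disc_int 0 (\<lambda>z. h z / (1 - of_real t * cnj z)\<^sup>2 * z ^ 0) = 0"
      by (simp only: power_0 mult_1_right diff_self)
  qed
  then have "a n l = (if l < n then 0 else a 0 (l - n))"
    by (simp only: right_minus_eq)
  then show ?thesis unfolding a_def power_0 mult_1_right .
qed

section \<open>Fourier coefficients on concentric circles\<close>

lemma disc_int_radial:
  assumes h: "continuous_on (cball 0 1) h"
  shows "disc_int 0 (\<lambda>z. h z * (cnj z ^ l * z ^ p)) =
    integral {0..1} (\<lambda>s. integral {0..1} (\<lambda>t. h (of_real (sqrt s) * ecis t) * (ecis t ^ p * cnj (ecis t) ^ l)) * of_real (sqrt s ^ (l + p) / 2))"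
proof -
  have c: "circ 0 s t = of_real (sqrt s) * ecis t" and j: "jac 0 s t = 1/2" for s t
    by (simp_all add: circ_def rad_def rad2_def jac_def drad_def)
  have eq: "h (circ 0 s t) * (cnj (circ 0 s t) ^ l * circ 0 s t ^ p) * of_real (jac 0 s t) =
    h (of_real (sqrt s) * ecis t) * (ecis t ^ p * cnj (ecis t) ^ l) * of_real (sqrt s ^ (l + p) / 2)" for s t
    unfolding c j by (simp add: power_mult_distrib power_add)
  have "disc_int 0 (\<lambda>z. h z * (cnj z ^ l * z ^ p)) = integral {start 0..1} (\<lambda>s. integral {0..1} (\<lambda>t. h (circ 0 s t) * (cnj (circ 0 s t) ^ l * circ 0 s t ^ p) * of_real (jac 0 s t)))"
    by (rule disc_int_eq_iterated) (intro continuous_intros h)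
  also have "start 0 = 0" by (simp add: start_def)
  finally show ?thesis unfolding eq integral_mult_left .
qed

definition circle_coeff :: "(complex \<Rightarrow> complex) \<Rightarrow> real \<Rightarrow> nat \<Rightarrow> nat \<Rightarrow> complex" where
  "circle_coeff h r i j = integral {0..1} (\<lambda>t. h (of_real r * ecis t) * (ecis t ^ i * cnj (ecis t) ^ j))"

lemma circle_coeff_reduce:
  "circle_coeff h r i j = (if i \<le> j then circle_coeff h r 0 (j - i) else circle_coeff h r (i - j) 0)"
proof -
  have c: "ecis t ^ n * cnj (ecis t) ^ n = 1" for t n by (simp add: power_mult_distrib[symmetric])
  show ?thesis
  proof (cases "i \<le> j")
    case True
    have "ecis t ^ i * cnj (ecis t) ^ j = ecis t ^ 0 * cnj (ecis t) ^ (j - i)" for t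
      using c[of t i] power_add[of "cnj (ecis t)" i "j - i"] True by (simp add: mult.assoc[symmetric])
    then show ?thesis using True unfolding circle_coeff_def by (simp only: if_True)
  next
    case False
    have "ecis t ^ i * cnj (ecis t) ^ j = ecis t ^ (i - j) * cnj (ecis t) ^ 0" for t
      using c[of t j] power_add[of "ecis t" "i - j" j] False by (simp add: mult.assoc)
    then show ?thesis using False unfolding circle_coeff_def by (simp only: if_False)
  qed
qed

lemma continuous_on_circle_coeff:
  assumes h: "continuous_on (cball 0 1) h"
  shows "continuous_on {0..1} (\<lambda>s. circle_coeff h (sqrt s) i j)"
  unfolding circle_coeff_def cbox_interval[symmetric]
proof (rule integral_continuous_on_param)
  have "continuous_on ({0..1} \<times> cbox 0 1) (\<lambda>x. h (of_real (sqrt (fst x)) * ecis (snd x)))"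
    by (rule continuous_on_compose2[OF h]) (auto intro!: continuous_intros simp: norm_mult dist_norm)
  then show "continuous_on (cbox 0 1 \<times> cbox 0 1) (\<lambda>(s, t). h (of_real (sqrt s) * ecis t) * (ecis t ^ i * cnj (ecis t) ^ j))"
    unfolding case_prod_unfold cbox_interval by (intro continuous_intros)
qed

text \<open>In polar coordinates, with \<open>s\<close> the squared radius,
  \<open>pencil_moments\<close> prescribes all power moments in \<open>s\<close> of each single
  Fourier coefficient, and \<open>moments_unique\<close> then determines it. The outcome is what a
  power series in \<open>z\<close> would give: coefficients proportional to the powers of the
  radius, and none of negative frequency.\<close>

lemma pencil_circle_coeff:
  fixes \<alpha> \<beta> :: real
  assumes ab: "\<beta> < 0" "0 < \<alpha>"
    and h: "continuous_on (cball 0 1) h" and p: "pencil_holomorphic \<alpha> h" "pencil_holomorphic \<beta> h"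
    and s: "s \<in> {0<..1}"
  shows "circle_coeff h (sqrt s) 0 k = 2 * of_nat (Suc k) * disc_int 0 (\<lambda>z. h z * cnj z ^ k) * of_real (sqrt s ^ k)"
    and "m > 0 \<Longrightarrow> circle_coeff h (sqrt s) m 0 = 0"
proof -
  have sq: "sqrt s ^ (n + n) = s ^ n" if "s \<ge> 0" for s n
    using that by (simp add: power_add power_mult_distrib[symmetric])
  have s0: "sqrt s \<noteq> 0" "s \<in> {0..1}" using s by auto
  note rad = disc_int_radial[OF h, folded circle_coeff_def]
  {
    define c where "c = of_nat (Suc k) * disc_int 0 (\<lambda>z. h z * cnj z ^ k)"
    have "circle_coeff h (sqrt s) 0 k * of_real (sqrt s ^ k / 2) - c * of_real (s ^ k) = 0"
    proof (rule moments_unique[OF _ _ s0(2), where f = "\<lambda>s. circle_coeff h (sqrt s) 0 k * of_real (sqrt s ^ k / 2) - c * of_real (s ^ k)"])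
      show "continuous_on {0..1} (\<lambda>s. circle_coeff h (sqrt s) 0 k * of_real (sqrt s ^ k / 2) - c * of_real (s ^ k))"
        by (intro continuous_intros continuous_on_circle_coeff h) auto
      fix n
      have "integral {0..1} (\<lambda>s. circle_coeff h (sqrt s) 0 k * of_real (sqrt s ^ k / 2) * of_real (s ^ n)) = disc_int 0 (\<lambda>z. h z * (cnj z ^ (k + n) * z ^ n))"
        unfolding rad
      proof (rule integral_cong)
        fix s :: real assume "s \<in> {0..1}"
        then show "circle_coeff h (sqrt s) 0 k * of_real (sqrt s ^ k / 2) * of_real (s ^ n) = circle_coeff h (sqrt s) n (k + n) * of_real (sqrt s ^ (k + n + n) / 2)"
          using sq[of s n] by (simp add: circle_coeff_reduce[of h _ n "k + n"] add.assoc power_add[of _ k])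
      qed
      also have "of_nat (Suc (k + n)) * \<dots> = c"
        unfolding c_def pencil_moments[OF ab h p] by simp
      finally have 1: "of_nat (Suc (k + n)) * integral {0..1} (\<lambda>s. circle_coeff h (sqrt s) 0 k * of_real (sqrt s ^ k / 2) * of_real (s ^ n)) = c" .
      have "((\<lambda>s::real. s ^ (k + n)) has_integral 1 / real (Suc (k + n))) {0..1}"
      proof -
        define m where "m = k + n"
        have m: "1 + real m \<noteq> 0" by linarith
        have "((\<lambda>s::real. s ^ m) has_integral (1 ^ Suc m / (1 + real m) - 0 ^ Suc m / (1 + real m))) {0..1}"
        proof (rule fundamental_theorem_of_calculus)
          fix x :: real
          have "((\<lambda>s. s ^ Suc m / (1 + real m)) has_real_derivative x ^ m) (at x within {0..1})"
            using DERIV_cdivide[OF DERIV_power_Suc[OF DERIV_ident, where n = m], where c = "1 + real m" and x = x and s = "{0..1}"] m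
            by simp
          then show "((\<lambda>s. s ^ Suc m / (1 + real m)) has_vector_derivative x ^ m) (at x within {0..1})"
            by (simp only: has_real_derivative_iff_has_vector_derivative)
        qed simp
        then show ?thesis by (simp add: m_def)
      qed
      from has_integral_mult_right[OF has_integral_of_real[OF this], of c]
      have 2: "((\<lambda>s. c * of_real (s ^ k) * of_real (s ^ n)) has_integral c / of_nat (Suc (k + n))) {0..1}"
        by (simp add: power_add mult_ac del: of_nat_Suc)
      have "(\<lambda>s. circle_coeff h (sqrt s) 0 k * of_real (sqrt s ^ k / 2) * of_real (s ^ n)) integrable_on {0..1}"
        by (intro integrable_continuous_real continuous_intros continuous_on_circle_coeff h) auto
      from has_integral_diff[OF integrable_integral[OF this] 2]
      have "integral {0..1} (\<lambda>s. circle_coeff h (sqrt s) 0 k * of_real (sqrt s ^ k / 2) * of_real (s ^ n) - c * of_real (s ^ k) * of_real (s ^ n)) =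
        integral {0..1} (\<lambda>s. circle_coeff h (sqrt s) 0 k * of_real (sqrt s ^ k / 2) * of_real (s ^ n)) - c / of_nat (Suc (k + n))"
        by (rule integral_unique)
      also have "\<dots> = 0" using 1 by (simp add: field_simps del: of_nat_Suc)
      finally show "integral {0..1} (\<lambda>s. (circle_coeff h (sqrt s) 0 k * of_real (sqrt s ^ k / 2) - c * of_real (s ^ k)) * of_real (s ^ n)) = 0"
        by (simp only: left_diff_distrib)
    qed
    note rel = this
    have "circle_coeff h (sqrt s) 0 k * of_real (sqrt s ^ k) = 2 * c * of_real (sqrt s ^ k) * of_real (sqrt s ^ k)"
    proof -
      have "complex_of_real (s ^ k) = of_real (sqrt s ^ k) * of_real (sqrt s ^ k)"
        using sq[of s k] s0(2) by (simp only: of_real_mult[symmetric] power_add atLeastAtMost_iff)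
      with rel show ?thesis
        by (simp add: field_simps del: of_real_power)
    qed
    then show "circle_coeff h (sqrt s) 0 k = 2 * of_nat (Suc k) * disc_int 0 (\<lambda>z. h z * cnj z ^ k) * of_real (sqrt s ^ k)"
      using s0(1) by (simp add: c_def mult.assoc del: of_nat_Suc)
  }
  assume m: "m > 0"
  have "circle_coeff h (sqrt s) m 0 * of_real (sqrt s ^ m / 2) = 0"
  proof (rule moments_unique[OF _ _ s0(2), where f = "\<lambda>s. circle_coeff h (sqrt s) m 0 * of_real (sqrt s ^ m / 2)"])
    show "continuous_on {0..1} (\<lambda>s. circle_coeff h (sqrt s) m 0 * of_real (sqrt s ^ m / 2))"
      by (intro continuous_intros continuous_on_circle_coeff h) auto
    fix n
    have "integral {0..1} (\<lambda>s. circle_coeff h (sqrt s) m 0 * of_real (sqrt s ^ m / 2) * of_real (s ^ n)) = disc_int 0 (\<lambda>z. h z * (cnj z ^ n * z ^ (m + n)))"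
      unfolding rad
    proof (rule integral_cong)
      fix s :: real assume "s \<in> {0..1}"
      then show "circle_coeff h (sqrt s) m 0 * of_real (sqrt s ^ m / 2) * of_real (s ^ n) = circle_coeff h (sqrt s) (m + n) n * of_real (sqrt s ^ (n + (m + n)) / 2)"
        using sq[of s n] m by (simp add: circle_coeff_reduce[of h _ "m + n" n] power_add mult_ac)
    qed
    also have "\<dots> = 0"
      using pencil_moments[OF ab h p, of n "m + n"] m by (simp del: of_nat_Suc)
    finally show "integral {0..1} (\<lambda>s. circle_coeff h (sqrt s) m 0 * of_real (sqrt s ^ m / 2) * of_real (s ^ n)) = 0" .
  qed
  then show "circle_coeff h (sqrt s) m 0 = 0" using s0(1) by simp
qed

text \<open>The coefficients on the unit circle define a power series that has the same Fourier
  coefficients as \<open>h\<close> on every circle of radius \<open>0 < r < 1\<close>. The origin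
  lies on none of these circles and is filled in by continuity of \<open>h\<close>.\<close>

theorem pencil_holomorphic_imp_holomorphic:
  fixes \<alpha> \<beta> :: real
  assumes ab: "\<beta> < 0" "0 < \<alpha>"
    and h: "continuous_on (cball 0 1) h" and p: "pencil_holomorphic \<alpha> h" "pencil_holomorphic \<beta> h"
  shows "h holomorphic_on ball 0 1"
proof -
  define c where "c k = circle_coeff h 1 0 k" for k
  have coeff0: "circle_coeff h r 0 k = c k * of_real (r ^ k)" and coeffm: "m > 0 \<Longrightarrow> circle_coeff h r m 0 = 0"
    if "r \<in> {0<..1}" for r k m
  proof -
    have r: "r\<^sup>2 \<in> {0<..1}" "sqrt (r\<^sup>2) = r" using that by (auto simp: power_le_one)
    have "circle_coeff h (sqrt 1) 0 k = 2 * of_nat (Suc k) * disc_int 0 (\<lambda>z. h z * cnj z ^ k) * of_real (sqrt 1 ^ k)"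
      by (rule pencil_circle_coeff(1)[OF ab h p]) simp
    then have "c k = 2 * of_nat (Suc k) * disc_int 0 (\<lambda>z. h z * cnj z ^ k)" by (simp add: c_def)
    then show "circle_coeff h r 0 k = c k * of_real (r ^ k)"
      using pencil_circle_coeff(1)[OF ab h p r(1), of k] by (simp only: r(2))
    show "circle_coeff h r m 0 = 0" if "m > 0"
      using pencil_circle_coeff(2)[OF ab h p r(1) that] by (simp only: r(2))
  qed
  obtain W where W0: "W \<ge> 0" and W: "\<And>z. norm z \<le> 1 \<Longrightarrow> norm (h z) \<le> W"
    using continuous_on_cball_bound[OF h] by blast
  have hc: "continuous_on {0..1} (\<lambda>t. h (of_real r * ecis t))" if "r \<in> {0<..1}" for r
    by (rule continuous_on_compose2[OF h]) (use that in \<open>auto intro!: continuous_intros simp: norm_mult dist_norm\<close>)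
  have cb: "norm (c k) \<le> W" for k
  proof -
    have "norm (c k) \<le> integral {0..1::real} (\<lambda>t. W)"
      unfolding c_def circle_coeff_def
    proof (rule integral_norm_bound_integral)
      show "(\<lambda>t. h (complex_of_real 1 * ecis t) * (ecis t ^ 0 * cnj (ecis t) ^ k)) integrable_on {0..1}"
        by (intro integrable_continuous_real continuous_intros hc) auto
      show "norm (h (complex_of_real 1 * ecis t) * (ecis t ^ 0 * cnj (ecis t) ^ k)) \<le> W" for t
        using W[of "ecis t"] by (simp add: norm_mult norm_power)
    qed auto
    then show ?thesis by simp
  qed
  define H where "H w = (\<Sum>k. c k * w ^ k)" for w
  have summ: "summable (\<lambda>k. W * norm w ^ k)" if "norm w < 1" for w :: complex
    using that by (intro summable_mult summable_geometric) auto
  have bd: "norm (c k * w ^ k) \<le> W * norm w ^ k" for k w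
    unfolding norm_mult norm_power using cb by (intro mult_right_mono) auto
  have Hs: "(\<lambda>k. c k * w ^ k) sums H w" if "norm w < 1" for w
    unfolding H_def by (rule summable_sums, rule summable_comparison_test'[OF summ[OF that], of 0], rule bd)
  have Hhol: "H holomorphic_on ball 0 1"
    by (rule power_series_holomorphic[of 0 1 c H]) (simp, rule Hs, simp)
  have Hh: "h w = H w" if w: "w \<in> ball 0 1 - {0}" for w
  proof -
    define r where "r = norm w"
    have r: "r \<in> {0<..1}" "r < 1" using w by (auto simp: r_def)
    have cont: "continuous_on (sphere 0 1) (\<lambda>z. h (of_real r * z) - H (of_real r * z))"
    proof (rule continuous_on_diff)
      show "continuous_on (sphere 0 1) (\<lambda>z. h (of_real r * z))"
        by (rule continuous_on_compose2[OF h]) (use r in \<open>auto intro!: continuous_intros simp: norm_mult dist_norm\<close>)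
      show "continuous_on (sphere 0 1) (\<lambda>z. H (of_real r * z))"
        by (rule continuous_on_compose2[OF holomorphic_on_imp_continuous_on[OF Hhol]])
          (use r in \<open>auto intro!: continuous_intros simp: norm_mult dist_norm\<close>)
    qed
    have "h (of_real r * (w / of_real r)) - H (of_real r * (w / of_real r)) = 0"
    proof (rule circle_fourier_unique[OF cont])
      show "norm (w / of_real r) = 1" using r by (simp add: norm_divide r_def)
      fix i j
      have "(\<lambda>k. integral (cbox 0 1) (\<lambda>t. c k * (of_real r * ecis t) ^ k * (ecis t ^ i * cnj (ecis t) ^ j))) sums
        integral (cbox 0 1) (\<lambda>t. H (of_real r * ecis t) * (ecis t ^ i * cnj (ecis t) ^ j))"
      proof (rule integral_sums_cbox)
        show "summable (\<lambda>k. W * norm (complex_of_real r) ^ k)" using r by (intro summ) auto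
        show "norm (c k * (of_real r * ecis t) ^ k * (ecis t ^ i * cnj (ecis t) ^ j)) \<le> W * norm (complex_of_real r) ^ k" for k t
          using bd[of k "of_real r * ecis t"] by (simp add: norm_mult norm_power)
        show "(\<lambda>k. c k * (of_real r * ecis t) ^ k * (ecis t ^ i * cnj (ecis t) ^ j)) sums (H (of_real r * ecis t) * (ecis t ^ i * cnj (ecis t) ^ j))" for t
          using r by (intro sums_mult2 Hs) (simp add: norm_mult)
      qed (intro continuous_intros)
      moreover have "integral (cbox 0 1) (\<lambda>t. c k * (of_real r * ecis t) ^ k * (ecis t ^ i * cnj (ecis t) ^ j)) = (if k + i = j then c k * of_real (r ^ k) else 0)" for k
      proof -
        have eq: "c k * (of_real r * ecis t) ^ k * (ecis t ^ i * cnj (ecis t) ^ j) = c k * of_real (r ^ k) * (ecis t ^ (k + i) * cnj (ecis t) ^ j)" for t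
          by (simp add: power_mult_distrib power_add mult_ac)
        show ?thesis unfolding eq integral_mult_right integral_ecis_power cbox_interval by simp
      qed
      ultimately have S: "(\<lambda>k. if k + i = j then c k * of_real (r ^ k) else 0) sums
        integral {0..1} (\<lambda>t. H (of_real r * ecis t) * (ecis t ^ i * cnj (ecis t) ^ j))"
        by (simp add: cbox_interval)
      have HI: "integral {0..1} (\<lambda>t. H (of_real r * ecis t) * (ecis t ^ i * cnj (ecis t) ^ j)) = circle_coeff h r i j"
      proof (cases "i \<le> j")
        case True
        then have "(\<lambda>k. if k + i = j then c k * of_real (r ^ k) else 0) = (\<lambda>k. if k = j - i then c k * of_real (r ^ k) else 0)"
          by (intro ext) auto
        then have "(\<lambda>k. if k + i = j then c k * of_real (r ^ k) else 0) sums (c (j - i) * of_real (r ^ (j - i)))"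
          using sums_single[of "j - i" "\<lambda>k. c k * complex_of_real (r ^ k)"] by (simp only:)
        from sums_unique2[OF S this] show ?thesis
          using True coeff0[OF r(1)] by (simp add: circle_coeff_reduce[of h r i j])
      next
        case False
        then have "(\<lambda>k. if k + i = j then c k * of_real (r ^ k) else 0) = (\<lambda>k. 0)"
          by (intro ext) auto
        then have "(\<lambda>k. if k + i = j then c k * of_real (r ^ k) else 0) sums 0"
          by (simp only: sums_zero)
        from sums_unique2[OF S this] show ?thesis
          using False coeffm[OF r(1)] by (simp add: circle_coeff_reduce[of h r i j])
      qed
      have i1: "(\<lambda>t. h (of_real r * ecis t) * (ecis t ^ i * cnj (ecis t) ^ j)) integrable_on {0..1}"
        by (intro integrable_continuous_real continuous_intros hc r)
      have "continuous_on {0..1} (\<lambda>t. H (of_real r * ecis t))"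
        by (rule continuous_on_compose2[OF holomorphic_on_imp_continuous_on[OF Hhol]])
          (use r in \<open>auto intro!: continuous_intros simp: norm_mult dist_norm\<close>)
      then have i2: "(\<lambda>t. H (of_real r * ecis t) * (ecis t ^ i * cnj (ecis t) ^ j)) integrable_on {0..1}"
        by (intro integrable_continuous_real continuous_intros)
      show "integral {0..1} (\<lambda>t. (h (of_real r * ecis t) - H (of_real r * ecis t)) * (ecis t ^ i * cnj (ecis t) ^ j)) = 0"
        unfolding left_diff_distrib integral_diff[OF i1 i2] HI circle_coeff_def by (rule diff_self)
    qed
    moreover have "of_real r * (w / of_real r) = w" using r by simp
    ultimately show ?thesis by (simp only: right_minus_eq)
  qed
  have "h holomorphic_on (ball 0 1 - {0})"
    by (rule holomorphic_transform[OF holomorphic_on_subset[OF Hhol]], blast) (rule Hh[symmetric])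
  then show ?thesis
    by (rule no_isolated_singularity[OF continuous_on_subset[OF h ball_subset_cball]]) simp_all
qed

lemma integral_periodic_shift:
  fixes F :: "real \<Rightarrow> complex"
  assumes F: "continuous_on UNIV F" and per: "\<And>t. F (t + 1) = F t" and s: "0 \<le> s" "s \<le> 1"
  shows "integral {0..1} (\<lambda>t. F (t + s)) = integral {0..1} F"
proof -
  have i: "F integrable_on {a..b}" for a b
    by (intro integrable_continuous_real continuous_on_subset[OF F]) auto
  have "integral {0..1} (\<lambda>t. F (t + s)) = integral {s..1 + s} F"
    using integral_shift[OF continuous_on_subset[OF F subset_UNIV], of 0 1 s] by (simp add: o_def)
  also have "\<dots> = integral {s..1} F + integral {1..1 + s} F"
    by (rule Henstock_Kurzweil_Integration.integral_combine[symmetric, OF _ _ i]) (use s in auto)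
  also have "integral {1..1 + s} F = integral {0..s} (\<lambda>t. F (t + 1))"
    using integral_shift[OF continuous_on_subset[OF F subset_UNIV], of 0 s 1] by (simp add: o_def add.commute)
  also have "\<dots> = integral {0..s} F" by (simp only: per)
  finally show ?thesis
    using Henstock_Kurzweil_Integration.integral_combine[OF s i] by (simp add: add.commute)
qed

subsection \<open>Fourier series in the second coordinate\<close>

definition pt :: "complex \<Rightarrow> complex \<Rightarrow> complex^2" where
  "pt z w = (\<chi> i. if i = 1 then z else w)"

lemma pt_nth [simp]: "pt z w $ 1 = z" "pt z w $ 2 = w"
  by (simp_all add: pt_def)

lemma pt_eta [simp]: "pt (z $ 1) (z $ 2) = z"
  by (simp add: vec_eq_iff forall_2)

lemma norm_vec2: "norm (z :: complex^2) ^ 2 = norm (z $ 1) ^ 2 + norm (z $ 2) ^ 2"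
  by (simp add: norm_vec_def L2_set_def sum_2)

lemma norm_pt: "norm (pt z w) ^ 2 = norm z ^ 2 + norm w ^ 2"
  by (simp add: norm_vec2)

lemma norm_pt_eq_1: "norm (pt z w) = 1 \<longleftrightarrow> norm z ^ 2 + norm w ^ 2 = 1"
  using norm_pt[of z w] by (metis norm_ge_zero one_power2 power2_eq_iff_nonneg zero_le_one)

lemma norm_pt_le_1: "norm (pt z w) \<le> 1 \<longleftrightarrow> norm z ^ 2 + norm w ^ 2 \<le> 1"
  unfolding norm_pt[symmetric] by (simp add: abs_square_le_1)

lemma norm_pt_less_1: "norm (pt z w) < 1 \<longleftrightarrow> norm z ^ 2 + norm w ^ 2 < 1"
  using norm_pt_le_1[of z w] norm_pt_eq_1[of z w] by linarith

lemma norm_pt_ecis [simp]: "norm (pt z (ecis t * w)) = norm (pt z w)"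
  by (rule power2_eq_imp_eq) (simp_all add: norm_pt norm_mult)

lemma continuous_on_pt [continuous_intros]:
  assumes "continuous_on S f" "continuous_on S g"
  shows "continuous_on S (\<lambda>x. pt (f x) (g x))"
  unfolding pt_def
proof (rule continuous_on_vec_lambda)
  show "continuous_on S (\<lambda>x. if i = 1 then f x else g x)" for i :: 2
    using assms by (cases "i = 1") auto
qed

lemma pt_add: "pt a b + pt c d = pt (a + c) (b + d)"
  by (simp add: vec_eq_iff forall_2)

lemma pt_scaleR: "r *\<^sub>R pt a b = pt (r *\<^sub>R a) (r *\<^sub>R b)"
  by (simp add: vec_eq_iff forall_2)

lemma bounded_linear_pt: "bounded_linear (\<lambda>w. pt 0 w)"
proof -
  have "linear (\<lambda>w. pt 0 w)"
    by (rule linearI) (simp_all add: pt_add pt_scaleR)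
  then show ?thesis by (simp add: linear_conv_bounded_linear)
qed

lemma ecis_of_int [simp]: "ecis (of_int n) = 1"
  by (simp add: ecis_eq_cis cis.code complex_eq_iff sin_int_2pin cos_int_2pin flip: mult.assoc)

definition four :: "(complex^2 \<Rightarrow> complex) \<Rightarrow> int \<Rightarrow> complex^2 \<Rightarrow> complex" where
  "four g n z = integral {0..1} (\<lambda>t. g (pt (z $ 1) (ecis t * z $ 2)) * ecis (- (of_int n * t)))"

text \<open>Keeps the neighbourhood and the function on it, so that ambient derivatives can be taken
  repeatedly; \<open>smooth_on_sphere\<close> speaks of the restriction only.\<close>

definition smooth_near :: "(complex^2 \<Rightarrow> complex) \<Rightarrow> (complex^2) set \<Rightarrow> bool" where
  "smooth_near g U \<longleftrightarrow> open U \<and> sphere 0 1 \<subseteq> U \<and> (\<forall>k. C_k_on k g U)"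

lemma smooth_near_continuous: "smooth_near g U \<Longrightarrow> continuous_on (sphere 0 1) g"
  unfolding smooth_near_def using C_k_on_imp_continuous_on continuous_on_subset by blast

lemma continuous_on_orbit:
  fixes g :: "complex^2 \<Rightarrow> complex" and z :: "complex^2"
  assumes "continuous_on (sphere 0 1) g" "norm z = 1"
  shows "continuous_on S (\<lambda>t. g (pt (z $ 1) (ecis t * z $ 2)))"
  by (rule continuous_on_compose2[OF assms(1)])
    (use assms(2) in \<open>auto intro!: continuous_intros\<close>)

lemma four_integrable:
  fixes g :: "complex^2 \<Rightarrow> complex" and z :: "complex^2"
  assumes "continuous_on (sphere 0 1) g" "norm z = 1"
  shows "(\<lambda>t. g (pt (z $ 1) (ecis t * z $ 2)) * ecis (- (of_int n * t))) integrable_on {0..1}"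
  by (intro integrable_continuous_real continuous_intros continuous_on_orbit assms)

lemma four_bound:
  assumes g: "continuous_on (sphere 0 1) g"
  shows "\<exists>C\<ge>0. \<forall>n z. norm z = 1 \<longrightarrow> norm (four g n z) \<le> C"
proof -
  have "bounded (g ` sphere 0 1)"
    by (intro compact_imp_bounded compact_continuous_image g compact_sphere)
  then obtain C where C: "\<And>w. w \<in> g ` sphere 0 1 \<Longrightarrow> norm w \<le> C"
    unfolding bounded_iff by blast
  have "norm (four g n z) \<le> \<bar>C\<bar>" if z: "norm z = 1" for n z
  proof -
    have "norm (four g n z) \<le> integral {0..1::real} (\<lambda>t. \<bar>C\<bar>)"
      unfolding four_def
    proof (rule integral_norm_bound_integral[OF four_integrable[OF g z]])
      fix t :: real
      have "norm (g (pt (z $ 1) (ecis t * z $ 2))) \<le> C"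
        by (intro C imageI) (use z in simp)
      then show "norm (g (pt (z $ 1) (ecis t * z $ 2)) * ecis (- (of_int n * t))) \<le> \<bar>C\<bar>"
        by (simp add: norm_mult)
    qed auto
    then show ?thesis by simp
  qed
  then show ?thesis using abs_ge_zero by blast
qed

text \<open>A shift of the integration variable by part of a period. In the argument of
  \<open>z $ 2\<close> the coefficient thus behaves like \<open>(z $ 2) ^ n\<close>, and it is
  determined by its values at points with nonnegative \<open>z $ 2\<close>, recorded below as
  \<open>four_abs\<close>.\<close>

lemma four_rotate:
  assumes g: "continuous_on (sphere 0 1) g" and z: "norm (pt z1 w) = 1" and s: "0 \<le> s" "s \<le> 1"
  shows "four g n (pt z1 (ecis s * w)) = ecis (of_int n * s) * four g n (pt z1 w)"
proof -
  define F where "F t = g (pt z1 (ecis t * w)) * ecis (- (of_int n * t))" for t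
  have "continuous_on UNIV F"
    unfolding F_def using continuous_on_orbit[OF g z] by (auto intro!: continuous_intros)
  moreover have "F (t + 1) = F t" for t
  proof -
    have "- (of_int n * (t + 1)) = - (of_int n * t) + of_int (- n)" by (simp add: algebra_simps)
    then show ?thesis unfolding F_def ecis_add by (simp only: ecis_add ecis_of_int ecis_1 mult_1_right)
  qed
  ultimately have "integral {0..1} (\<lambda>t. F (t + s)) = integral {0..1} F"
    using s by (rule integral_periodic_shift)
  moreover have "g (pt z1 (ecis t * (ecis s * w))) * ecis (- (of_int n * t)) = ecis (of_int n * s) * F (t + s)" for t
  proof -
    have "ecis (- (of_int n * t)) = ecis (of_int n * s) * ecis (- (of_int n * (t + s)))"
      unfolding ecis_add[symmetric] by (simp add: algebra_simps)
    then show ?thesis unfolding F_def ecis_add by (simp only: mult_ac)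
  qed
  ultimately show ?thesis
    unfolding four_def pt_nth F_def by simp
qed

text \<open>The Wirtinger derivatives with respect to \<open>z $ 2\<close> and its conjugate, taken
  in the ambient space.\<close>

definition dz2 :: "(complex^2 \<Rightarrow> complex) \<Rightarrow> complex^2 \<Rightarrow> complex" where
  "dz2 g x = (frechet_derivative g (at x) (pt 0 1) - \<i> * frechet_derivative g (at x) (pt 0 \<i>)) / 2"

definition dbar2 :: "(complex^2 \<Rightarrow> complex) \<Rightarrow> complex^2 \<Rightarrow> complex" where
  "dbar2 g x = (frechet_derivative g (at x) (pt 0 1) + \<i> * frechet_derivative g (at x) (pt 0 \<i>)) / 2"

lemma smooth_near_derivs:
  assumes "smooth_near g U"
  shows "smooth_near (dz2 g) U" "smooth_near (dbar2 g) U"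
proof -
  have o: "open U" and k': "C_k_on (Suc k) g U" for k
    using assms unfolding smooth_near_def by blast+
  then have k: "C_k_on k (\<lambda>x. frechet_derivative g (at x) v) U" for k v
    using k'[of k] by simp
  have m: "C_k_on k (\<lambda>x. c * frechet_derivative g (at x) v) U" for c k v
    by (rule C_k_on_compose_bounded_linear[OF o bounded_linear_mult_right k])
  have "dz2 g = (\<lambda>x. 1/2 * frechet_derivative g (at x) (pt 0 1) + (- \<i> / 2) * frechet_derivative g (at x) (pt 0 \<i>))"
    by (auto simp: dz2_def fun_eq_iff field_simps)
  moreover have "dbar2 g = (\<lambda>x. 1/2 * frechet_derivative g (at x) (pt 0 1) + (\<i> / 2) * frechet_derivative g (at x) (pt 0 \<i>))"
    by (auto simp: dbar2_def fun_eq_iff field_simps)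
  ultimately have "C_k_on k (dz2 g) U" "C_k_on k (dbar2 g) U" for k
    by (simp_all only: C_k_on_add[OF o m m])
  then show "smooth_near (dz2 g) U" "smooth_near (dbar2 g) U"
    using assms unfolding smooth_near_def by auto
qed

text \<open>Integration by parts along the orbit of the rotation of the second coordinate.\<close>

lemma four_parts:
  assumes g: "smooth_near g U" and z: "norm z = 1"
  shows "of_int n * four g n z = z $ 2 * four (dz2 g) (n - 1) z - cnj (z $ 2) * four (dbar2 g) (n + 1) z"
proof -
  define p where "p t = pt (z $ 1) (ecis t * z $ 2)" for t
  have pU: "p t \<in> sphere 0 1" "p t \<in> U" for t
    using g z unfolding smooth_near_def p_def by (auto simp: subset_iff)
  have pd: "(p has_vector_derivative pt 0 (2 * pi * \<i> * ecis t * z $ 2)) (at t within T)" for t T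
  proof -
    have "((\<lambda>t. ecis t * z $ 2) has_vector_derivative 2 * pi * \<i> * ecis t * z $ 2) (at t within T)"
      by (rule has_vector_derivative_mult_left[OF ecis_has_vector_derivative])
    from bounded_linear.has_vector_derivative[OF bounded_linear_pt this]
    have "((\<lambda>t. pt (z $ 1) 0 + pt 0 (ecis t * z $ 2)) has_vector_derivative 0 + pt 0 (2 * pi * \<i> * ecis t * z $ 2)) (at t within T)"
      by (rule has_vector_derivative_add[OF has_vector_derivative_const])
    then show ?thesis by (simp add: pt_add p_def[abs_def])
  qed
  have gd: "((\<lambda>t. g (p t)) has_vector_derivative 2 * pi * \<i> * (ecis t * z $ 2 * dz2 g (p t) - cnj (ecis t * z $ 2) * dbar2 g (p t))) (at t within T)" for t T
  proof -
    let ?D = "frechet_derivative g (at (p t))"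
    have D: "(g has_derivative ?D) (at (p t))"
      using g unfolding smooth_near_def by (intro C_k_on_SucD[OF _ pU(2)]) blast
    have lin: "linear ?D" using D has_derivative_linear by blast
    have val: "?D (pt 0 v) = v * dz2 g (p t) + cnj v * dbar2 g (p t)" for v
    proof -
      have "pt 0 v = Re v *\<^sub>R pt 0 1 + Im v *\<^sub>R pt 0 \<i>"
        unfolding pt_scaleR pt_add by (simp add: complex_eq_iff vec_eq_iff forall_2)
      then have "?D (pt 0 v) = Re v *\<^sub>R ?D (pt 0 1) + Im v *\<^sub>R ?D (pt 0 \<i>)"
        using lin by (simp only: linear_add linear_scale)
      then show ?thesis
        unfolding dz2_def dbar2_def
        by (simp add: complex_eq_iff scaleR_conv_of_real field_simps)
    qed
    have "((\<lambda>t. g (p t)) has_vector_derivative ?D (pt 0 (2 * pi * \<i> * ecis t * z $ 2))) (at t within T)"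
      using diff_chain_within[OF pd[unfolded has_vector_derivative_def] has_derivative_at_withinI[OF D]] lin
      unfolding has_vector_derivative_def o_def by (simp add: linear_scale)
    then show ?thesis
      unfolding val by (simp add: algebra_simps)
  qed
  define E where "E t = ecis (- (of_int n * t))" for t
  have Ed: "(E has_vector_derivative - (2 * pi * \<i> * of_int n * E t)) (at t within T)" for t T
  proof -
    have "((\<lambda>t. - (of_int n * t)) has_vector_derivative - of_int n) (at t within T)"
      by (auto intro!: derivative_eq_intros simp: has_real_derivative_iff_has_vector_derivative[symmetric])
    from vector_diff_chain_within[OF this ecis_has_vector_derivative]
    show ?thesis unfolding E_def[abs_def] o_def by (simp add: scaleR_conv_of_real mult_ac)
  qed
  define A where "A t = dz2 g (p t) * ecis (- (of_int (n - 1) * t))" for t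
  define B where "B t = dbar2 g (p t) * ecis (- (of_int (n + 1) * t))" for t
  have EA: "E t * ecis t = ecis (- (of_int (n - 1) * t))" and EB: "E t * cnj (ecis t) = ecis (- (of_int (n + 1) * t))" for t
    unfolding E_def cnj_ecis ecis_add[symmetric] by (simp_all add: algebra_simps)
  have "((\<lambda>t. g (p t) * E t) has_vector_derivative 2 * pi * \<i> * ((z $ 2 * A t - cnj (z $ 2) * B t) - of_int n * (g (p t) * E t))) (at t within {0..1})" for t
  proof -
    have "g (p t) * (- (2 * pi * \<i> * of_int n * E t)) + 2 * pi * \<i> * (ecis t * z $ 2 * dz2 g (p t) - cnj (ecis t * z $ 2) * dbar2 g (p t)) * E t
      = 2 * pi * \<i> * ((z $ 2 * A t - cnj (z $ 2) * B t) - of_int n * (g (p t) * E t))"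
      unfolding A_def B_def EA[symmetric] EB[symmetric] complex_cnj_mult by (simp add: algebra_simps)
    with has_vector_derivative_mult[OF gd Ed, of t "{0..1}"] show ?thesis by (simp only:)
  qed
  then have "((\<lambda>t. 2 * pi * \<i> * ((z $ 2 * A t - cnj (z $ 2) * B t) - of_int n * (g (p t) * E t))) has_integral (g (p 1) * E 1 - g (p 0) * E 0)) {0..1}"
    by (intro fundamental_theorem_of_calculus) auto
  moreover have "E 1 = 1" "E 0 = 1" "p 1 = p 0"
    using ecis_of_int[of "- n"] by (simp_all add: E_def p_def)
  ultimately have 0: "((\<lambda>t. 2 * pi * \<i> * ((z $ 2 * A t - cnj (z $ 2) * B t) - of_int n * (g (p t) * E t))) has_integral 0) {0..1}"
    by simp
  have "(A has_integral four (dz2 g) (n - 1) z) {0..1}" "(B has_integral four (dbar2 g) (n + 1) z) {0..1}" "((\<lambda>t. g (p t) * E t) has_integral four g n z) {0..1}"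
    unfolding A_def B_def E_def p_def four_def
    using four_integrable[OF smooth_near_continuous[OF smooth_near_derivs(1)[OF g]] z]
      four_integrable[OF smooth_near_continuous[OF smooth_near_derivs(2)[OF g]] z]
      four_integrable[OF smooth_near_continuous[OF g] z]
    by (blast intro: integrable_integral)+
  then have "((\<lambda>t. 2 * pi * \<i> * ((z $ 2 * A t - cnj (z $ 2) * B t) - of_int n * (g (p t) * E t))) has_integral
    2 * pi * \<i> * ((z $ 2 * four (dz2 g) (n - 1) z - cnj (z $ 2) * four (dbar2 g) (n + 1) z) - of_int n * four g n z)) {0..1}"
    by (intro has_integral_mult_right has_integral_diff)
  from has_integral_unique[OF 0 this] show ?thesis by simp
qed

text \<open>Each integration by parts gains a factor \<open>norm (z $ 2)\<close> and moves the
  frequency by one in either direction, so a frequency of at least \<open>k\<close> allows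
  \<open>k\<close> steps. The coefficient of frequency \<open>n\<close> thus vanishes to order
  \<open>n\<close> at the rim.\<close>

lemma four_decay:
  assumes "smooth_near g U"
  shows "\<exists>C\<ge>0. \<forall>n z. int k \<le> n \<and> norm z = 1 \<longrightarrow> norm (four g n z) \<le> C * norm (z $ 2) ^ k"
  using assms
proof (induction k arbitrary: g)
  case 0
  then show ?case using four_bound[OF smooth_near_continuous[OF 0]] by auto
next
  case (Suc k)
  obtain C1 where C1: "C1 \<ge> 0" "\<And>n z. int k \<le> n \<Longrightarrow> norm z = 1 \<Longrightarrow> norm (four (dz2 g) n z) \<le> C1 * norm (z $ 2) ^ k"
    using Suc.IH[OF smooth_near_derivs(1)[OF Suc.prems]] by blast
  obtain C2 where C2: "C2 \<ge> 0" "\<And>n z. int k \<le> n \<Longrightarrow> norm z = 1 \<Longrightarrow> norm (four (dbar2 g) n z) \<le> C2 * norm (z $ 2) ^ k"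
    using Suc.IH[OF smooth_near_derivs(2)[OF Suc.prems]] by blast
  have "norm (four g n z) \<le> (C1 + C2) * norm (z $ 2) ^ Suc k" if n: "int (Suc k) \<le> n" and z: "norm z = 1" for n z
  proof -
    have "1 * norm (four g n z) \<le> norm (of_int n :: complex) * norm (four g n z)"
      using n by (intro mult_right_mono) auto
    also have "\<dots> = norm (z $ 2 * four (dz2 g) (n - 1) z - cnj (z $ 2) * four (dbar2 g) (n + 1) z)"
      unfolding norm_mult[symmetric] four_parts[OF Suc.prems z] ..
    also have "\<dots> \<le> norm (z $ 2) * norm (four (dz2 g) (n - 1) z) + norm (z $ 2) * norm (four (dbar2 g) (n + 1) z)"
      using norm_triangle_ineq4[of "z $ 2 * four (dz2 g) (n - 1) z" "cnj (z $ 2) * four (dbar2 g) (n + 1) z"] by (simp add: norm_mult)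
    also have "\<dots> \<le> norm (z $ 2) * (C1 * norm (z $ 2) ^ k) + norm (z $ 2) * (C2 * norm (z $ 2) ^ k)"
      using n z by (intro add_mono mult_left_mono C1 C2) auto
    finally show ?thesis by (simp add: algebra_simps)
  qed
  then show ?case using C1(1) C2(1) by (intro exI[of _ "C1 + C2"]) auto
qed

text \<open>Two integrations by parts, for summability over \<open>n\<close>. The case
  \<open>n = 1\<close> is separate: there the term with \<open>dz2\<close> has frequency 0, about
  which the linear bound says nothing.\<close>

lemma four_quadratic_decay:
  assumes g: "smooth_near g U"
  shows "\<exists>C\<ge>0. \<forall>n z. 1 \<le> n \<and> norm z = 1 \<longrightarrow> norm (four g (int n) z) \<le> C / real n ^ 2"
proof -
  have z2: "norm (z $ 2) \<le> 1" if "norm z = 1" for z :: "complex^2"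
    using Finite_Cartesian_Product.norm_nth_le[of z 2] that by simp
  have lin: "\<exists>C\<ge>0. \<forall>n z. 1 \<le> n \<and> norm z = 1 \<longrightarrow> of_int n * norm (four g n z) \<le> C" if g: "smooth_near g U" for g
  proof -
    obtain C1 where C1: "C1 \<ge> 0" "\<And>n z. norm z = 1 \<Longrightarrow> norm (four (dz2 g) n z) \<le> C1"
      using four_bound[OF smooth_near_continuous[OF smooth_near_derivs(1)[OF g]]] by blast
    obtain C2 where C2: "C2 \<ge> 0" "\<And>n z. norm z = 1 \<Longrightarrow> norm (four (dbar2 g) n z) \<le> C2"
      using four_bound[OF smooth_near_continuous[OF smooth_near_derivs(2)[OF g]]] by blast
    have "of_int n * norm (four g n z) \<le> C1 + C2" if n: "1 \<le> n" and z: "norm z = 1" for n z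
    proof -
      have "of_int n * norm (four g n z) = norm (of_int n * four g n z)" using n by (simp add: norm_mult)
      also have "\<dots> \<le> norm (z $ 2) * norm (four (dz2 g) (n - 1) z) + norm (z $ 2) * norm (four (dbar2 g) (n + 1) z)"
        unfolding four_parts[OF g z]
        using norm_triangle_ineq4[of "z $ 2 * four (dz2 g) (n - 1) z" "cnj (z $ 2) * four (dbar2 g) (n + 1) z"] by (simp add: norm_mult)
      also have "\<dots> \<le> 1 * C1 + 1 * C2"
        using z2[OF z] C1 C2 z by (intro add_mono mult_mono) auto
      finally show ?thesis by simp
    qed
    then show ?thesis using C1(1) C2(1) by (intro exI[of _ "C1 + C2"]) auto
  qed
  obtain C0 where C0: "C0 \<ge> 0" "\<And>n z. norm z = 1 \<Longrightarrow> norm (four g n z) \<le> C0"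
    using four_bound[OF smooth_near_continuous[OF g]] by blast
  obtain C1 where C1: "C1 \<ge> 0" "\<And>n z. 1 \<le> n \<Longrightarrow> norm z = 1 \<Longrightarrow> of_int n * norm (four (dz2 g) n z) \<le> C1"
    using lin[OF smooth_near_derivs(1)[OF g]] by blast
  obtain C2 where C2: "C2 \<ge> 0" "\<And>n z. 1 \<le> n \<Longrightarrow> norm z = 1 \<Longrightarrow> of_int n * norm (four (dbar2 g) n z) \<le> C2"
    using lin[OF smooth_near_derivs(2)[OF g]] by blast
  have "norm (four g (int n) z) \<le> (C0 + 2 * C1 + C2) / real n ^ 2" if n: "1 \<le> n" and z: "norm z = 1" for n z
  proof (cases "n = 1")
    case True
    then show ?thesis using C0(2)[OF z, of 1] C1(1) C2(1) by simp
  next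
    case False
    then have n2: "2 \<le> n" using n by simp
    let ?x = "norm (four (dz2 g) (int n - 1) z)" and ?y = "norm (four (dbar2 g) (int n + 1) z)"
    have x: "real n * ?x \<le> 2 * C1"
    proof -
      have "real n * ?x \<le> 2 * (of_int (int n - 1) * ?x)"
        using mult_right_mono[of "real n" "2 * (real n - 1)" ?x] n2 by (simp add: algebra_simps)
      then show ?thesis using C1(2)[of "int n - 1" z] n2 z by linarith
    qed
    have y: "real n * ?y \<le> C2"
    proof -
      have "real n * ?y \<le> of_int (int n + 1) * ?y" by (intro mult_right_mono) auto
      then show ?thesis using C2(2)[of "int n + 1" z] n2 z by linarith
    qed
    have "real n ^ 2 * norm (four g (int n) z) = real n * norm (of_int (int n) * four g (int n) z)"
      by (simp add: norm_mult power2_eq_square)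
    also have "\<dots> \<le> real n * (norm (z $ 2) * ?x + norm (z $ 2) * ?y)"
      unfolding four_parts[OF g z]
      using norm_triangle_ineq4[of "z $ 2 * four (dz2 g) (int n - 1) z" "cnj (z $ 2) * four (dbar2 g) (int n + 1) z"]
      by (intro mult_left_mono) (auto simp: norm_mult)
    also have "\<dots> \<le> real n * (1 * ?x + 1 * ?y)"
      using z2[OF z] by (intro mult_left_mono add_mono mult_right_mono) auto
    also have "\<dots> \<le> 2 * C1 + C2" using x y by (simp add: distrib_left)
    finally have "real n ^ 2 * norm (four g (int n) z) \<le> C0 + 2 * C1 + C2" using C0(1) by linarith
    then show ?thesis using n by (simp add: pos_le_divide_eq mult.commute)
  qed
  then show ?thesis using C0(1) C1(1) C2(1) by (intro exI[of _ "C0 + 2 * C1 + C2"]) auto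
qed

section \<open>Holomorphic functions of two variables: slices, Cauchy estimates, series\<close>

lemma has_derivative_affine_line:
  "((\<lambda>\<zeta>. p + \<zeta> *s v) has_derivative (\<lambda>h. h *s v)) (at (\<zeta>::complex) within S)" for p v :: "complex^2"
proof -
  have "linear (\<lambda>h::complex. h *s v)"
    by (rule linearI) (simp_all add: vec_eq_iff algebra_simps)
  then have "bounded_linear (\<lambda>h::complex. h *s v)"
    by (simp add: linear_conv_bounded_linear)
  from has_derivative_add[OF has_derivative_const bounded_linear_imp_has_derivative[OF this]]
  show ?thesis by simp
qed

lemma holomorphic2_line_derivative:
  fixes f :: "complex^2 \<Rightarrow> complex"
  assumes f: "(f has_derivative f') (at (p + \<zeta> *s v))" and lin: "\<And>c h. f' (c *s h) = c * f' h"
  shows "((\<lambda>\<zeta>. f (p + \<zeta> *s v)) has_field_derivative f' v) (at \<zeta>)"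
proof -
  have "((\<lambda>\<zeta>. f (p + \<zeta> *s v)) has_derivative (\<lambda>h. f' (h *s v))) (at \<zeta>)"
    using has_derivative_compose[OF has_derivative_affine_line f] .
  moreover have "(\<lambda>h. f' (h *s v)) = (*) (f' v)"
    by (rule ext) (simp only: lin mult.commute)
  ultimately show ?thesis
    by (simp only: has_field_derivative_def)
qed

lemma holomorphic2_on_line:
  assumes "holomorphic2_on f U" "\<And>\<zeta>. \<zeta> \<in> S \<Longrightarrow> p + \<zeta> *s v \<in> U" "open S"
  shows "(\<lambda>\<zeta>. f (p + \<zeta> *s v)) holomorphic_on S"
proof (rule holomorphic_onI)
  fix \<zeta> assume "\<zeta> \<in> S"
  then obtain f' where f': "(f has_derivative f') (at (p + \<zeta> *s v))" "\<forall>c h. f' (c *s h) = c * f' h"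
    using bspec[OF assms(1)[unfolded holomorphic2_on_def] assms(2)] by blast
  have "((\<lambda>\<zeta>. f (p + \<zeta> *s v)) has_field_derivative f' v) (at \<zeta>)"
    by (rule holomorphic2_line_derivative[OF f'(1)]) (rule f'(2)[rule_format])
  then have "(\<lambda>\<zeta>. f (p + \<zeta> *s v)) field_differentiable at \<zeta>"
    unfolding field_differentiable_def by blast
  then show "(\<lambda>\<zeta>. f (p + \<zeta> *s v)) field_differentiable at \<zeta> within S"
    by (rule field_differentiable_at_within)
qed

lemma norm_smult_vec: "norm (c *s v) = norm c * norm v" for v :: "complex^2"
proof -
  have "norm (c *s v) ^ 2 = (norm c * norm v) ^ 2"
    by (simp add: norm_vec2 norm_mult power_mult_distrib distrib_left)
  then show ?thesis by (rule power2_eq_imp_eq) auto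
qed

text \<open>Cauchy's estimate on the complex line in the direction of the increment.\<close>

lemma holomorphic2_derivative_bound:
  assumes hol: "holomorphic2_on f (ball 0 1)" and bound: "\<And>z. norm z < 1 \<Longrightarrow> norm (f z) \<le> B"
    and z: "norm z < r" "r < 1" and f': "(f has_derivative f') (at z)" "\<And>c h. f' (c *s h) = c * f' h"
  shows "norm (f' h) \<le> 2 * B / (1 - r) * norm h"
proof (cases "h = 0")
  case True
  have "f' (0 *s h) = 0" unfolding f'(2) by simp
  then show ?thesis using True by simp
next
  case False
  \<comment> \<open>With this choice even the disc of radius \<open>2 * d\<close> in direction
    \<open>h\<close> around \<open>z\<close> stays in the unit ball, which leaves room for
    continuity on the closed disc of radius \<open>d\<close>.\<close>
  define d where "d = (1 - r) / (2 * norm h)"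
  have d: "d > 0" using False z by (simp add: d_def)
  have in_ball: "norm (z + \<zeta> *s h) < 1" if "norm \<zeta> \<le> d" for \<zeta>
  proof -
    have "norm (\<zeta> *s h) \<le> d * norm h"
      unfolding norm_smult_vec using that by (intro mult_right_mono) auto
    also have "\<dots> = (1 - r) / 2" using False by (simp add: d_def)
    finally have "norm z + norm (\<zeta> *s h) < r + (1 - r) / 2" using z by (intro add_less_le_mono) auto
    also have "\<dots> < 1" using z by (simp add: field_simps)
    finally show ?thesis by (rule le_less_trans[OF norm_triangle_ineq])
  qed
  let ?\<phi> = "\<lambda>\<zeta>. f (z + \<zeta> *s h)"
  have hol\<phi>: "?\<phi> holomorphic_on ball 0 (2 * d)"
  proof (rule holomorphic2_on_line[OF hol])
    fix \<zeta> :: complex assume "\<zeta> \<in> ball 0 (2 * d)"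
    then have "norm \<zeta> * norm h < 2 * d * norm h" using False by (intro mult_strict_right_mono) auto
    also have "2 * d * norm h = 1 - r" using False by (simp add: d_def)
    finally have "norm \<zeta> * norm h < 1 - r" .
    then have "norm (z + \<zeta> *s h) < 1"
      using norm_triangle_ineq[of z "\<zeta> *s h"] z by (simp add: norm_smult_vec)
    then show "z + \<zeta> *s h \<in> ball 0 1" by simp
  qed simp
  have dlt: "d < 2 * d" using d by simp
  have "norm ((deriv ^^ 1) ?\<phi> 0) \<le> fact 1 * B / d ^ 1"
  proof (rule Cauchy_inequality[OF _ _ d])
    show "?\<phi> holomorphic_on ball 0 d"
      by (rule holomorphic_on_subset[OF hol\<phi>]) (use dlt in auto)
    show "continuous_on (cball 0 d) ?\<phi>"
      by (rule continuous_on_subset[OF holomorphic_on_imp_continuous_on[OF hol\<phi>]]) (use dlt in auto)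
    show "norm (?\<phi> x) \<le> B" if "norm (0 - x) = d" for x
      using that by (intro bound in_ball) simp
  qed
  moreover have "(?\<phi> has_field_derivative f' h) (at 0)"
    by (rule holomorphic2_line_derivative) (use f' in auto)
  then have "deriv ?\<phi> 0 = f' h" by (rule DERIV_imp_deriv)
  ultimately show ?thesis using False z by (simp add: d_def mult_ac)
qed

text \<open>Cauchy's estimate turns the bounds \<open>M n\<close> into bounds for the derivatives on
  a smaller ball, so the differentiated series converges uniformly there, and complex linearity
  passes to the sum.\<close>

lemma holomorphic2_series:
  fixes f :: "nat \<Rightarrow> complex^2 \<Rightarrow> complex"
  assumes hol: "\<And>n. holomorphic2_on (f n) (ball 0 1)"
    and bound: "\<And>n z. norm z < 1 \<Longrightarrow> norm (f n z) \<le> M n" and M: "summable M"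
    and F: "\<And>z. norm z < 1 \<Longrightarrow> (\<lambda>n. f n z) sums F z"
  shows "holomorphic2_on F (ball 0 1)"
  unfolding holomorphic2_on_def
proof
  fix z0 :: "complex^2" assume "z0 \<in> ball 0 1"
  then have z0: "norm z0 < 1" by simp
  define r where "r = (norm z0 + 1) / 2"
  have r: "norm z0 < r" "r < 1" using z0 by (auto simp: r_def)
  define f' where "f' n z = (SOME f'. (f n has_derivative f') (at z) \<and> (\<forall>c h. f' (c *s h) = c * f' h))" for n z
  have f': "(f n has_derivative f' n z) (at z)" "f' n z (c *s h) = c * f' n z h" if "z \<in> ball 0 1" for n z c h
  proof -
    have "\<exists>f'. (f n has_derivative f') (at z) \<and> (\<forall>c h. f' (c *s h) = c * f' h)"
      using hol[of n] that unfolding holomorphic2_on_def by (rule bspec)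
    from someI_ex[OF this]
    have *: "(f n has_derivative f' n z) (at z) \<and> (\<forall>c h. f' n z (c *s h) = c * f' n z h)"
      unfolding f'_def .
    show "(f n has_derivative f' n z) (at z)" by (rule conjunct1[OF *])
    show "f' n z (c *s h) = c * f' n z h" by (rule conjunct2[OF *, rule_format])
  qed
  define K where "K n = 2 * M n / (1 - r)" for n
  have K: "norm (f' n z h) \<le> K n * norm h" if "norm z < r" for n z h
  proof -
    have z1: "z \<in> ball 0 1" using that r by simp
    show ?thesis
      unfolding K_def
      by (rule holomorphic2_derivative_bound[OF hol _ that r(2) f'(1)[OF z1] f'(2)[OF z1]]) (rule bound)
  qed
  have sumK: "summable K" unfolding K_def by (intro summable_divide summable_mult M)
  define g' where "g' z h = (\<Sum>n. f' n z h)" for z h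
  have summ: "summable (\<lambda>n. f' n z h)" if "norm z < r" for z h
    by (rule summable_comparison_test'[OF summable_mult2[OF sumK, of "norm h"], of 0]) (rule K[OF that])
  have "\<exists>g. \<forall>x\<in>ball 0 r. (\<lambda>n. f n x) sums g x \<and> (g has_derivative g' x) (at x within ball 0 r)"
  proof (rule has_derivative_series[where f = f and f' = f' and g' = g' and x = z0 and l = "F z0" and S = "ball 0 r"])
    show "(f n has_derivative f' n x) (at x within ball 0 r)" if "x \<in> ball 0 r" for n x
      by (rule has_derivative_at_withinI[OF f'(1)]) (use that r in auto)
    fix e :: real assume e: "e > 0"
    have "(\<lambda>n. \<Sum>i. K (i + n)) \<longlonglongrightarrow> 0" by (rule suminf_exist_split2[OF sumK])
    then have "\<forall>\<^sub>F n in sequentially. (\<Sum>i. K (i + n)) < e"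
      using e by (rule order_tendstoD(2))
    then show "\<forall>\<^sub>F n in sequentially. \<forall>x\<in>ball 0 r. \<forall>h. norm (sum (\<lambda>i. f' i x h) {..<n} - g' x h) \<le> e * norm h"
    proof (rule eventually_mono, intro ballI allI)
      fix n x h assume n: "(\<Sum>i. K (i + n)) < e" and x: "x \<in> ball (0::complex^2) r"
      then have x: "norm x < r" by simp
      have "g' x h = (\<Sum>i. f' (i + n) x h) + sum (\<lambda>i. f' i x h) {..<n}"
        unfolding g'_def by (rule suminf_split_initial_segment[OF summ[OF x]])
      then have "norm (sum (\<lambda>i. f' i x h) {..<n} - g' x h) = norm (\<Sum>i. f' (i + n) x h)"
        by (simp add: norm_minus_commute)
      also have "\<dots> \<le> (\<Sum>i. K (i + n) * norm h)"
        by (rule norm_suminf_le[OF K[OF x]]) (intro summable_mult2 summable_ignore_initial_segment sumK)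
      also have "\<dots> = (\<Sum>i. K (i + n)) * norm h"
        by (rule suminf_mult2[symmetric]) (intro summable_ignore_initial_segment sumK)
      also have "\<dots> \<le> e * norm h" using n by (intro mult_right_mono) auto
      finally show "norm (sum (\<lambda>i. f' i x h) {..<n} - g' x h) \<le> e * norm h" .
    qed
  next
    show "z0 \<in> ball 0 r" using r by simp
    show "(\<lambda>n. f n z0) sums F z0" by (rule F[OF z0])
  qed simp
  then obtain g where g0: "\<forall>x\<in>ball 0 r. (\<lambda>n. f n x) sums g x \<and> (g has_derivative g' x) (at x within ball 0 r)" ..
  have g: "(\<lambda>n. f n x) sums g x" "(g has_derivative g' x) (at x within ball 0 r)" if "x \<in> ball 0 r" for x
    using bspec[OF g0 that] by simp_all
  have gF: "g x = F x" if "x \<in> ball 0 r" for x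
    using sums_unique2[OF g(1)[OF that] F[of x]] that r by simp
  have z0r: "z0 \<in> ball 0 r" using r by simp
  have "(g has_derivative g' z0) (at z0)"
    using g(2)[OF z0r] at_within_open[OF z0r open_ball] by simp
  then have "(F has_derivative g' z0) (at z0)"
    by (rule has_derivative_transform_within_open[OF _ open_ball z0r]) (rule gF)
  moreover have "g' z0 (c *s h) = c * g' z0 h" for c h
  proof -
    have "f' i z0 (c *s h) = c * f' i z0 h" for i by (rule f'(2)[OF \<open>z0 \<in> ball 0 1\<close>])
    then have "g' z0 (c *s h) = (\<Sum>i. c * f' i z0 h)" by (simp only: g'_def)
    also have "\<dots> = c * g' z0 h" unfolding g'_def by (rule suminf_mult[OF summ[OF r(1)]])
    finally show ?thesis .
  qed
  ultimately show "\<exists>f'. (F has_derivative f') (at z0) \<and> (\<forall>c h. f' (c *s h) = c * f' h)" by blast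
qed

lemma has_derivative_nth [derivative_intros]:
  "((\<lambda>z :: complex^2. z $ i) has_derivative (\<lambda>h. h $ i)) (at z within S)"
  by (rule bounded_linear_imp_has_derivative) (rule bounded_linear_vec_nth)

lemma holomorphic2_monomial:
  assumes H: "H holomorphic_on ball 0 1"
  shows "holomorphic2_on (\<lambda>z. H (z $ 1) * (z $ 2) ^ n) (ball 0 1)"
  unfolding holomorphic2_on_def
proof
  fix z :: "complex^2" assume z: "z \<in> ball 0 1"
  then have "z $ 1 \<in> ball 0 1" using Finite_Cartesian_Product.norm_nth_le[of z 1] by simp
  then have "(H has_field_derivative deriv H (z $ 1)) (at (z $ 1))"
    using holomorphic_derivI[OF H open_ball] by blast
  then have "(H has_derivative (\<lambda>h. deriv H (z $ 1) * h)) (at (z $ 1))"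
    by (simp add: has_field_derivative_def)
  from has_derivative_compose[OF has_derivative_nth this]
  have 1: "((\<lambda>z. H (z $ 1)) has_derivative (\<lambda>h. deriv H (z $ 1) * h $ 1)) (at z)" .
  have "((\<lambda>w. w ^ n) has_derivative (\<lambda>h. of_nat n * (z $ 2) ^ (n - 1) * h)) (at (z $ 2))"
    using DERIV_power[OF DERIV_ident, where x = "z $ 2" and s = UNIV and n = n] by (simp add: has_field_derivative_def)
  from has_derivative_compose[OF has_derivative_nth this]
  have 2: "((\<lambda>z. (z $ 2) ^ n) has_derivative (\<lambda>h. of_nat n * (z $ 2) ^ (n - 1) * h $ 2)) (at z)" .
  show "\<exists>f'. ((\<lambda>z. H (z $ 1) * (z $ 2) ^ n) has_derivative f') (at z) \<and> (\<forall>c h. f' (c *s h) = c * f' h)"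
    by (rule exI, rule conjI, rule has_derivative_mult[OF 1 2]) (simp add: algebra_simps)
qed

text \<open>Over a fixed \<open>z $ 1\<close> the term \<open>H n (z $ 1) * (z $ 2) ^ n\<close> is
  largest in modulus on the sphere, so the decay of the coefficients on the sphere gives uniform
  convergence on the closed ball. The sum equals \<open>g\<close> on the sphere because both have
  the same Fourier coefficients on every orbit.\<close>

lemma extension_of_four_coefficients:
  assumes g: "smooth_near g U"
    and neg: "\<And>n z. n < 0 \<Longrightarrow> norm z = 1 \<Longrightarrow> four g n z = 0"
    and H: "\<And>n. continuous_on (cball 0 1) (H n)" "\<And>n. H n holomorphic_on ball 0 1"
    and eq: "\<And>n z. norm z = 1 \<Longrightarrow> four g (int n) z = H n (z $ 1) * (z $ 2) ^ n"
  shows "extends_holomorphically_through_ball g"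
proof -
  from four_quadratic_decay[OF g] obtain C where "C \<ge> 0 \<and> (\<forall>n z. 1 \<le> n \<and> norm z = 1 \<longrightarrow> norm (four g (int n) z) \<le> C / real n ^ 2)" ..
  note C = conjunct1[OF this] conjunct2[OF this, rule_format, OF conjI]
  from four_bound[OF smooth_near_continuous[OF g]] obtain C0 where "C0 \<ge> 0 \<and> (\<forall>n z. norm z = 1 \<longrightarrow> norm (four g n z) \<le> C0)" ..
  note C0 = conjunct1[OF this] conjunct2[OF this, rule_format]
  \<comment> \<open>At \<open>n = 0\<close> the quotient would be 0 by the convention for division
    by zero and bound nothing.\<close>
  define M where "M n = (if n = 0 then C0 else C / real n ^ 2)" for n
  have "summable (\<lambda>n. C * inverse (real n ^ 2))"
    by (intro summable_mult inverse_power_summable) auto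
  then have "summable (\<lambda>n. C / real n ^ 2)"
    by (simp only: divide_inverse)
  moreover have "norm (M n) \<le> C / real n ^ 2" if "1 \<le> n" for n
    using that C(1) by (simp add: M_def)
  ultimately have M: "summable M"
    by (rule summable_comparison_test'[where N = 1])
  define f where "f n z = H n (z $ 1) * (z $ 2) ^ n" for n and z :: "complex^2"
  have bound: "norm (f n z) \<le> M n" if z: "norm z \<le> 1" for n z
  proof -
    have z2: "norm (z $ 1) ^ 2 + norm (z $ 2) ^ 2 \<le> 1"
      using z norm_pt_le_1[of "z $ 1" "z $ 2"] by simp
    define r where "r = sqrt (1 - norm (z $ 1) ^ 2)"
    have r2: "r ^ 2 = 1 - norm (z $ 1) ^ 2" and r0: "r \<ge> 0"
    proof -
      have "0 \<le> norm (z $ 2) ^ 2" by simp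
      then have "0 \<le> 1 - norm (z $ 1) ^ 2" using z2 by linarith
      then show "r ^ 2 = 1 - norm (z $ 1) ^ 2" "r \<ge> 0" unfolding r_def by simp_all
    qed
    have r: "norm (z $ 2) \<le> r"
    proof (rule power2_le_imp_le[OF _ r0])
      show "norm (z $ 2) ^ 2 \<le> r ^ 2" unfolding r2 using z2 by linarith
    qed
    have n1: "norm (pt (z $ 1) (of_real r)) = 1"
      unfolding norm_pt_eq_1 norm_of_real power2_abs r2 by simp
    have "norm (f n z) \<le> norm (H n (z $ 1)) * r ^ n"
      unfolding f_def norm_mult norm_power using r by (intro mult_left_mono power_mono) auto
    also have "\<dots> = norm (four g (int n) (pt (z $ 1) (of_real r)))"
      unfolding eq[OF n1] pt_nth norm_mult norm_power norm_of_real using r0 by simp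
    also have "\<dots> \<le> M n"
    proof (cases "n = 0")
      case True
      then show ?thesis using C0(2)[OF n1, of 0] by (simp add: M_def)
    next
      case False
      then show ?thesis using C(2)[OF _ n1, of n] by (simp add: M_def)
    qed
    finally show ?thesis .
  qed
  define F where "F z = (\<Sum>n. f n z)" for z
  have F: "(\<lambda>n. f n z) sums F z" if "norm z \<le> 1" for z
    unfolding F_def by (rule summable_sums, rule summable_comparison_test'[OF M, of 0], rule bound[OF that])
  have cf: "continuous_on (cball 0 1) (f n)" for n
  proof -
    have "continuous_on (cball 0 1) (\<lambda>z::complex^2. H n (z $ 1))"
    proof (rule continuous_on_compose2[OF H(1)])
      show "(\<lambda>z::complex^2. z $ 1) ` cball 0 1 \<subseteq> cball 0 1"
      proof (rule image_subsetI)
        show "z $ 1 \<in> cball 0 1" if "z \<in> cball 0 1" for z :: "complex^2"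
          using that order_trans[OF Finite_Cartesian_Product.norm_nth_le[of z 1], of 1] by simp
      qed
    qed (intro continuous_intros)
    then show ?thesis unfolding f_def[abs_def]
      by (intro continuous_on_mult continuous_on_power continuous_on_component continuous_on_id)
  qed
  have cF: "continuous_on (cball 0 1) F"
  proof (rule uniform_limit_theorem)
    show "uniform_limit (cball 0 1) (\<lambda>n z. \<Sum>i<n. f i z) F sequentially"
      unfolding F_def[abs_def] by (rule Weierstrass_m_test[OF _ M]) (rule bound, simp)
    show "\<forall>\<^sub>F n in sequentially. continuous_on (cball 0 1) (\<lambda>z. \<Sum>i<n. f i z)"
      by (intro always_eventually allI continuous_on_sum cf)
  qed simp
  have holF: "holomorphic2_on F (ball 0 1)"
  proof (rule holomorphic2_series[OF _ _ M])
    show "holomorphic2_on (f n) (ball 0 1)" for n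
      unfolding f_def[abs_def] by (rule holomorphic2_monomial[OF H(2)])
    show "norm (f n z) \<le> M n" if "norm z < 1" for n z
      by (rule bound[OF less_imp_le[OF that]])
    show "(\<lambda>n. f n z) sums F z" if "norm z < 1" for z
      by (rule F[OF less_imp_le[OF that]])
  qed
  have "F z = g z" if z: "norm z = 1" for z
  proof -
    have p1: "norm (pt (z $ 1) (w * z $ 2)) = 1" if "norm w = 1" for w
    proof -
      have "norm (z $ 1) ^ 2 + norm (z $ 2) ^ 2 = 1" unfolding norm_vec2[symmetric] z by simp
      then show ?thesis unfolding norm_pt_eq_1 norm_mult that by simp
    qed
    have cp: "continuous_on (sphere 0 1) (\<lambda>w. pt (z $ 1) (w * z $ 2))"
      by (intro continuous_on_pt continuous_on_const continuous_on_mult continuous_on_id)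
    have cont: "continuous_on (sphere 0 1) (\<lambda>w. g (pt (z $ 1) (w * z $ 2)) - F (pt (z $ 1) (w * z $ 2)))"
    proof (rule continuous_on_diff)
      show "continuous_on (sphere 0 1) (\<lambda>w. g (pt (z $ 1) (w * z $ 2)))"
        by (rule continuous_on_compose2[OF smooth_near_continuous[OF g] cp]) (rule image_subsetI, simp add: p1 z)
      show "continuous_on (sphere 0 1) (\<lambda>w. F (pt (z $ 1) (w * z $ 2)))"
        by (rule continuous_on_compose2[OF cF cp]) (rule image_subsetI, simp add: p1 z)
    qed
    have ct: "continuous_on T (\<lambda>t. q (pt (z $ 1) (ecis t * z $ 2)))" if "continuous_on (cball 0 1) q" for q :: "complex^2 \<Rightarrow> complex" and T
      by (rule continuous_on_compose2[OF that]) (intro continuous_on_pt continuous_on_const continuous_on_mult continuous_on_ecis continuous_on_id, rule image_subsetI, simp add: p1 z)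
    have "g (pt (z $ 1) (1 * z $ 2)) - F (pt (z $ 1) (1 * z $ 2)) = 0"
    proof (rule circle_fourier_unique[OF cont, where z = 1])
      fix i j :: nat
      let ?e = "\<lambda>t. ecis t ^ i * cnj (ecis t) ^ j"
      have e: "?e t = ecis (- (of_int (int j - int i) * t))" for t
        by (simp add: cnj_ecis ecis_power ecis_add[symmetric] algebra_simps)
      have gi: "((\<lambda>t. g (pt (z $ 1) (ecis t * z $ 2)) * ?e t) has_integral four g (int j - int i) z) {0..1}"
        unfolding e four_def by (intro integrable_integral four_integrable smooth_near_continuous[OF g] z)
      have "(\<lambda>n. integral (cbox 0 1) (\<lambda>t. f n (pt (z $ 1) (ecis t * z $ 2)) * ?e t)) sums
        integral (cbox 0 1) (\<lambda>t. F (pt (z $ 1) (ecis t * z $ 2)) * ?e t)"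
      proof (rule integral_sums_cbox[OF _ _ M])
        show "continuous_on (cbox 0 1) (\<lambda>t. f n (pt (z $ 1) (ecis t * z $ 2)) * ?e t)" for n
          by (intro continuous_on_mult ct cf continuous_intros)
        show "norm (f n (pt (z $ 1) (ecis t * z $ 2)) * ?e t) \<le> M n" for n t
          using bound[of "pt (z $ 1) (ecis t * z $ 2)" n] p1[of "ecis t"] by (simp add: norm_mult norm_power)
        show "(\<lambda>n. f n (pt (z $ 1) (ecis t * z $ 2)) * ?e t) sums (F (pt (z $ 1) (ecis t * z $ 2)) * ?e t)" for t
          using p1[of "ecis t"] by (intro sums_mult2 F) simp
      qed
      moreover have "integral (cbox 0 1) (\<lambda>t. f n (pt (z $ 1) (ecis t * z $ 2)) * ?e t) = (if n = nat (int j - int i) then if i \<le> j then f n z else 0 else 0)" for n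
      proof -
        have q: "f n (pt (z $ 1) (ecis t * z $ 2)) * ?e t = f n z * (ecis t ^ (n + i) * cnj (ecis t) ^ j)" for t
          by (simp add: f_def power_mult_distrib power_add mult_ac)
        have "integral (cbox 0 1) (\<lambda>t. f n (pt (z $ 1) (ecis t * z $ 2)) * ?e t) = f n z * (if n + i = j then 1 else 0)"
          unfolding q integral_mult_right cbox_interval integral_ecis_power ..
        then show ?thesis by auto
      qed
      ultimately have "(\<lambda>n. if n = nat (int j - int i) then if i \<le> j then f n z else 0 else 0) sums
        integral (cbox 0 1) (\<lambda>t. F (pt (z $ 1) (ecis t * z $ 2)) * ?e t)" by (simp only:)
      from sums_unique2[OF this sums_single[of "nat (int j - int i)" "\<lambda>n. if i \<le> j then f n z else 0"]]
      have FI: "integral {0..1} (\<lambda>t. F (pt (z $ 1) (ecis t * z $ 2)) * ?e t) = (if i \<le> j then f (nat (int j - int i)) z else 0)"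
        by (simp only: cbox_interval)
      have "four g (int j - int i) z = (if i \<le> j then f (nat (int j - int i)) z else 0)"
      proof (cases "i \<le> j")
        case True
        then show ?thesis using eq[OF z, of "nat (int j - int i)"] by (simp add: f_def)
      next
        case False
        then show ?thesis using neg[OF _ z] by simp
      qed
      then have gi': "((\<lambda>t. g (pt (z $ 1) (ecis t * z $ 2)) * ?e t) has_integral (if i \<le> j then f (nat (int j - int i)) z else 0)) {0..1}"
        using gi by (simp only:)
      have "(\<lambda>t. F (pt (z $ 1) (ecis t * z $ 2)) * ?e t) integrable_on {0..1}"
        by (intro integrable_continuous_real continuous_on_mult ct cF continuous_intros)
      then have Fi: "((\<lambda>t. F (pt (z $ 1) (ecis t * z $ 2)) * ?e t) has_integral (if i \<le> j then f (nat (int j - int i)) z else 0)) {0..1}"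
        unfolding FI[symmetric] by (rule integrable_integral)
      show "integral {0..1} (\<lambda>t. (g (pt (z $ 1) (ecis t * z $ 2)) - F (pt (z $ 1) (ecis t * z $ 2))) * ?e t) = 0"
        using integral_unique[OF has_integral_diff[OF gi' Fi]] unfolding left_diff_distrib by (simp only: diff_self)
    qed simp
    then show ?thesis by simp
  qed
  then have "\<forall>z\<in>sphere 0 1. F z = g z" by simp
  then show ?thesis
    unfolding extends_holomorphically_through_ball_def using cF holF by blast
qed

subsection \<open>Two points on opposite sides of the origin\<close>

text \<open>Extension along the lines \<open>z\<^sub>2 = c * (z\<^sub>1 - \<gamma>)\<close>,
  expressed in the coordinate \<open>z\<^sub>1\<close>; \<open>s\<close> and the modulus of
  \<open>c\<close> determine each other. The vertical line and the line \<open>z\<^sub>2 = 0\<close>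
  would belong to \<open>s = 0\<close> and \<open>s = 1\<close>.\<close>

definition ext_pencil :: "real \<Rightarrow> (complex^2 \<Rightarrow> complex) \<Rightarrow> bool" where
  "ext_pencil \<gamma> f \<longleftrightarrow> (\<forall>s\<in>{start \<gamma><..<1}. \<forall>c. norm c ^ 2 = (1 - s) / s \<longrightarrow>
     (\<exists>G. continuous_on (cball (of_real ((1 - s) * \<gamma>)) (rad \<gamma> s)) G \<and>
          G holomorphic_on ball (of_real ((1 - s) * \<gamma>)) (rad \<gamma> s) \<and>
          (\<forall>z. norm (z - of_real ((1 - s) * \<gamma>)) = rad \<gamma> s \<longrightarrow> G z = f (pt z (c * (z - of_real \<gamma>))))))"

lemma circle_equation:
  fixes z c :: complex
  assumes "s > 0" "norm c ^ 2 = (1 - s) / s"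
  shows "norm z ^ 2 + norm (c * (z - of_real \<gamma>)) ^ 2 = 1 + (norm (z - of_real ((1 - s) * \<gamma>)) ^ 2 - rad2 \<gamma> s) / s"
proof -
  have "s * norm z ^ 2 + (1 - s) * norm (z - of_real \<gamma>) ^ 2 = s + (norm (z - of_real ((1 - s) * \<gamma>)) ^ 2 - rad2 \<gamma> s)"
    unfolding cmod_power2 rad2_def by (simp add: algebra_simps power2_eq_square)
  then have "(s * norm z ^ 2 + (1 - s) * norm (z - of_real \<gamma>) ^ 2) / s = (s + (norm (z - of_real ((1 - s) * \<gamma>)) ^ 2 - rad2 \<gamma> s)) / s"
    by (rule arg_cong)
  then show ?thesis
    unfolding norm_mult power_mult_distrib assms(2) using assms(1) by (simp add: add_divide_distrib)
qed

lemma circle_on_sphere: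
  assumes "s \<in> {start \<gamma><..<1}" "norm c ^ 2 = (1 - s) / s"
  shows "norm (pt (circ \<gamma> s t) (c * (circ \<gamma> s t - of_real \<gamma>))) = 1"
proof -
  have s: "s > 0" "s \<in> {start \<gamma>..1}" using assms(1) start_bounds(1)[of \<gamma>] by auto
  have "circ \<gamma> s t - of_real ((1 - s) * \<gamma>) = of_real (rad \<gamma> s) * ecis t"
    unfolding circ_def by simp
  then have "norm (circ \<gamma> s t - of_real ((1 - s) * \<gamma>)) ^ 2 = rad2 \<gamma> s"
    by (simp only: norm_mult norm_of_real norm_ecis mult_1_right power2_abs rad_sq[OF s(2)])
  then show ?thesis
    unfolding norm_pt_eq_1 circle_equation[OF s(1) assms(2)] by simp
qed

text \<open>Cauchy's integral formula at the centre for \<open>G u * (u - z0)\<close>, which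
  vanishes there.\<close>

lemma circle_integral_zero:
  assumes r: "r > 0" and G: "continuous_on (cball z0 r) G" "G holomorphic_on ball z0 r"
  shows "integral {0..1} (\<lambda>t. G (z0 + of_real r * ecis t) * ecis t) = 0"
proof -
  let ?F = "\<lambda>u. G u * (u - z0)"
  have "((\<lambda>u. ?F u / (u - z0)) has_contour_integral (2 * of_real pi * \<i> * ?F z0)) (circlepath z0 r)"
    by (rule Cauchy_integral_circlepath) (use r in \<open>auto intro!: continuous_intros holomorphic_intros G\<close>)
  then have "((\<lambda>x. ?F (circlepath z0 r x) / (circlepath z0 r x - z0) * (2 * pi * \<i> * r * exp (2 * of_real pi * \<i> * x))) has_integral 0) {0..1}"
    unfolding has_contour_integral_def
    by (subst (asm) has_integral_cong[where g = "\<lambda>x. ?F (circlepath z0 r x) / (circlepath z0 r x - z0) * (2 * pi * \<i> * r * exp (2 * of_real pi * \<i> * x))"])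
      (simp_all add: vector_derivative_circlepath01)
  moreover have "?F (circlepath z0 r x) / (circlepath z0 r x - z0) * (2 * pi * \<i> * r * exp (2 * of_real pi * \<i> * x)) =
      2 * pi * \<i> * r * (G (z0 + of_real r * ecis x) * ecis x)" for x
    unfolding circlepath_eq_ecis ecis_def[symmetric] using r by simp
  ultimately have "((\<lambda>x. 2 * pi * \<i> * r * (G (z0 + of_real r * ecis x) * ecis x)) has_integral 0) {0..1}"
    by (simp only:)
  from integral_unique[OF this] show ?thesis
    unfolding integral_mult_right using r by simp
qed

text \<open>Rotating the second coordinate replaces the slope \<open>c\<close> by
  \<open>ecis \<tau> * c\<close>, hence permutes lines of the pencil over one and the same circle.
  The moment vanishes for each of them, and the Fourier coefficient is a weighted average over
  \<open>\<tau>\<close>. The entire factor \<open>P\<close> leaves room for a power of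
  \<open>z\<^sub>2\<close>, which is a polynomial in \<open>z\<^sub>1\<close> on a line.\<close>

lemma four_pencil_moment:
  assumes g: "continuous_on (sphere 0 1) g" and ext: "ext_pencil \<gamma> g" and s: "s \<in> {start \<gamma><..<1}"
    and c: "norm c ^ 2 = (1 - s) / s" and P: "P holomorphic_on UNIV"
    and AB: "\<forall>z\<in>cball (of_real ((1 - s) * \<gamma>)) (rad \<gamma> s). A + B * z \<noteq> 0"
  shows "integral {0..1} (\<lambda>t. four g n (pt (circ \<gamma> s t) (c * (circ \<gamma> s t - of_real \<gamma>))) * (P (circ \<gamma> s t) * ecis t / (A + B * circ \<gamma> s t))) = 0"
proof -
  have s': "s \<in> {start \<gamma><..1}" "s \<in> {start \<gamma>..1}" using s by auto
  define Z where "Z = circ \<gamma> s"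
  define Q where "Q z = P z / (A + B * z)" for z
  let ?D = "cball (of_real ((1 - s) * \<gamma>)) (rad \<gamma> s) :: complex set"
  have ZD: "Z t \<in> ?D" for t
    unfolding Z_def circ_def using rad_nonneg[OF s'(2)] by (simp add: dist_norm norm_mult)
  have cP: "continuous_on ?D P"
    by (rule continuous_on_subset[OF holomorphic_on_imp_continuous_on[OF P] subset_UNIV])
  have cQ: "continuous_on ?D Q"
    unfolding Q_def
    by (intro continuous_on_divide continuous_on_add continuous_on_mult continuous_on_const continuous_on_id cP AB)
  have hP: "P holomorphic_on ball (of_real ((1 - s) * \<gamma>)) (rad \<gamma> s)"
    by (rule holomorphic_on_subset[OF P subset_UNIV])
  have hQ: "Q holomorphic_on ball (of_real ((1 - s) * \<gamma>)) (rad \<gamma> s)"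
    unfolding Q_def
    by (intro holomorphic_on_divide holomorphic_on_add holomorphic_on_mult holomorphic_on_const holomorphic_on_ident hP bspec[OF AB])
      (rule subsetD[OF ball_subset_cball])
  have zero: "integral {0..1} (\<lambda>t. g (pt (Z t) (d * (Z t - of_real \<gamma>))) * (Q (Z t) * ecis t)) = 0"
    if d: "norm d ^ 2 = (1 - s) / s" for d
  proof -
    obtain G where "continuous_on ?D G \<and>
          G holomorphic_on ball (of_real ((1 - s) * \<gamma>)) (rad \<gamma> s) \<and>
          (\<forall>z. norm (z - of_real ((1 - s) * \<gamma>)) = rad \<gamma> s \<longrightarrow> G z = g (pt z (d * (z - of_real \<gamma>))))"
      using bspec[OF ext[unfolded ext_pencil_def] s, rule_format, OF d] ..
    then have G: "continuous_on ?D G" "G holomorphic_on ball (of_real ((1 - s) * \<gamma>)) (rad \<gamma> s)"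
      "\<And>z. norm (z - of_real ((1 - s) * \<gamma>)) = rad \<gamma> s \<Longrightarrow> G z = g (pt z (d * (z - of_real \<gamma>)))" by blast+
    have "integral {0..1} (\<lambda>t. (G (of_real ((1 - s) * \<gamma>) + of_real (rad \<gamma> s) * ecis t) * Q (of_real ((1 - s) * \<gamma>) + of_real (rad \<gamma> s) * ecis t)) * ecis t) = 0"
      by (rule circle_integral_zero[where G = "\<lambda>z. G z * Q z"])
        (intro rad_pos s'(1) continuous_on_mult holomorphic_on_mult G(1,2) cQ hQ)+
    moreover have "G (Z t) = g (pt (Z t) (d * (Z t - of_real \<gamma>)))" for t
      by (rule G(3)) (use rad_nonneg[OF s'(2)] in \<open>simp add: Z_def circ_def norm_mult\<close>)
    ultimately show ?thesis unfolding circ_def[symmetric] Z_def[symmetric] by (simp only: mult.assoc)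
  qed
  define k where "k t \<tau> = g (pt (Z t) (ecis \<tau> * (c * (Z t - of_real \<gamma>)))) * ecis (- (of_int n * \<tau>)) * (Q (Z t) * ecis t)" for t \<tau>
  have ck: "continuous_on (cbox (0, 0) (1, 1)) (\<lambda>(t, \<tau>). k t \<tau>)"
  proof -
    have n1: "norm (pt (Z t) (ecis \<tau> * (c * (Z t - of_real \<gamma>)))) = 1" for t \<tau>
      using circle_on_sphere[OF s c, of t] by (simp add: Z_def)
    have cZ: "continuous_on S (\<lambda>x. Z (f x))" if "continuous_on S f" for S f
      unfolding Z_def using that by (intro continuous_on_circ continuous_on_const)
    have "continuous_on (cbox (0, 0) (1, 1)) (\<lambda>x::real \<times> real. g (pt (Z (fst x)) (ecis (snd x) * (c * (Z (fst x) - of_real \<gamma>)))))"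
    proof (rule continuous_on_compose2[OF g])
      show "continuous_on (cbox (0, 0) (1, 1)) (\<lambda>x::real \<times> real. pt (Z (fst x)) (ecis (snd x) * (c * (Z (fst x) - of_real \<gamma>))))"
        by (intro continuous_on_pt continuous_on_mult continuous_on_diff continuous_on_const continuous_on_ecis cZ continuous_on_fst continuous_on_snd continuous_on_id)
    qed (use n1 in auto)
    moreover have "continuous_on (cbox (0, 0) (1, 1)) (\<lambda>x::real \<times> real. Q (Z (fst x)))"
      by (rule continuous_on_compose2[OF cQ]) (use ZD in \<open>auto intro!: cZ continuous_intros\<close>)
    ultimately show ?thesis
      unfolding k_def case_prod_unfold
      by (intro continuous_on_mult continuous_on_ecis continuous_on_minus continuous_on_fst continuous_on_snd continuous_on_id continuous_on_const)
  qed
  have "integral {0..1} (\<lambda>t. four g n (pt (Z t) (c * (Z t - of_real \<gamma>))) * (Q (Z t) * ecis t)) = integral {0..1} (\<lambda>t. integral {0..1} (k t))"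
    unfolding four_def pt_nth k_def integral_mult_left ..
  also have "\<dots> = integral {0..1} (\<lambda>\<tau>. integral {0..1} (\<lambda>t. k t \<tau>))"
    using integral_swap_continuous[OF ck] by (simp only: cbox_interval)
  also have "(\<lambda>\<tau>. integral {0..1} (\<lambda>t. k t \<tau>)) = (\<lambda>\<tau>. 0)"
  proof
    fix \<tau>
    have "k t \<tau> = ecis (- (of_int n * \<tau>)) * (g (pt (Z t) ((ecis \<tau> * c) * (Z t - of_real \<gamma>))) * (Q (Z t) * ecis t))" for t
      unfolding k_def by (simp only: mult_ac)
    moreover have "norm (ecis \<tau> * c) ^ 2 = (1 - s) / s" using c by (simp add: norm_mult)
    ultimately show "integral {0..1} (\<lambda>t. k t \<tau>) = 0"
      using zero[of "ecis \<tau> * c"] by (simp only: integral_mult_right mult_zero_right)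
  qed
  finally show ?thesis unfolding Z_def Q_def by simp
qed

lemma polar_ecis: "\<exists>s\<in>{0..1}. w = ecis s * of_real (norm w)"
proof (cases "w = 0")
  case True
  then show ?thesis by (intro bexI[of _ 0]) auto
next
  case False
  then have "norm (w / of_real (norm w)) = 1" by (simp add: norm_divide)
  then obtain s where s: "s \<in> {0..1}" "w / of_real (norm w) = ecis s" by (rule ecis_surj)
  then have "w = ecis s * of_real (norm w)" using False by (simp add: field_simps)
  then show ?thesis using s(1) by blast
qed

definition four_abs :: "(complex^2 \<Rightarrow> complex) \<Rightarrow> int \<Rightarrow> complex \<Rightarrow> complex" where
  "four_abs g n z = four g n (pt z (of_real (sqrt (1 - norm z ^ 2))))"

lemma sphere_sqrt:
  fixes z :: "complex^2"
  assumes "norm z = 1"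
  shows "norm (z $ 2) = sqrt (1 - norm (z $ 1) ^ 2)"
proof -
  have "norm (z $ 2) ^ 2 = 1 - norm (z $ 1) ^ 2" using norm_vec2[of z] unfolding assms by simp
  from real_sqrt_unique[OF this norm_ge_zero] show ?thesis by (rule sym)
qed

lemma norm_pt_sqrt:
  assumes "norm z \<le> 1"
  shows "norm (pt z (of_real (sqrt (1 - norm z ^ 2)))) = 1"
proof -
  have "norm z ^ 2 \<le> 1" using assms by (simp add: power_le_one)
  then show ?thesis unfolding norm_pt_eq_1 norm_of_real power2_abs by simp
qed

lemma four_eq_abs:
  assumes g: "continuous_on (sphere 0 1) g" and z: "norm z = 1"
    and s: "s \<in> {0..1}" "z $ 2 = ecis s * of_real (norm (z $ 2))"
  shows "four g n z = ecis (of_int n * s) * four_abs g n (z $ 1)"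
proof -
  have z1: "norm (z $ 1) \<le> 1" using Finite_Cartesian_Product.norm_nth_le[of z 1] z by simp
  have "four g n z = four g n (pt (z $ 1) (ecis s * of_real (norm (z $ 2))))"
    unfolding s(2)[symmetric] by simp
  also have "\<dots> = ecis (of_int n * s) * four_abs g n (z $ 1)"
    unfolding sphere_sqrt[OF z] four_abs_def
    by (rule four_rotate[OF g norm_pt_sqrt[OF z1]]) (use s(1) in auto)
  finally show ?thesis .
qed

lemma continuous_on_sqrt_norm: "continuous_on S (\<lambda>z::complex. sqrt (1 - norm z ^ 2))"
  by (intro continuous_intros)

lemma continuous_on_four_abs:
  assumes g: "continuous_on (sphere 0 1) g"
  shows "continuous_on (cball 0 1) (four_abs g n)"
  unfolding four_abs_def[abs_def] four_def pt_nth cbox_interval[symmetric]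
proof (rule integral_continuous_on_param)
  have "continuous_on (cball 0 1 \<times> cbox 0 1) (\<lambda>x::complex \<times> real. g (pt (fst x) (ecis (snd x) * of_real (sqrt (1 - norm (fst x) ^ 2)))))"
  proof (rule continuous_on_compose2[OF g])
    show "continuous_on (cball 0 1 \<times> cbox 0 1) (\<lambda>x::complex \<times> real. pt (fst x) (ecis (snd x) * of_real (sqrt (1 - norm (fst x) ^ 2))))"
      by (intro continuous_intros)
    show "(\<lambda>x::complex \<times> real. pt (fst x) (ecis (snd x) * of_real (sqrt (1 - norm (fst x) ^ 2)))) ` (cball 0 1 \<times> cbox 0 1) \<subseteq> sphere 0 1"
    proof (rule image_subsetI)
      fix x :: "complex \<times> real" assume "x \<in> cball 0 1 \<times> cbox 0 1"
      then have "norm (fst x) \<le> 1" by (auto simp: mem_Times_iff)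
      from norm_pt_sqrt[OF this]
      show "pt (fst x) (ecis (snd x) * of_real (sqrt (1 - norm (fst x) ^ 2))) \<in> sphere 0 1" by simp
    qed
  qed
  then show "continuous_on (cball 0 1 \<times> cbox 0 1) (\<lambda>(x, t). g (pt x (ecis t * of_real (sqrt (1 - norm x ^ 2)))) * ecis (- (of_int n * t)))"
    unfolding case_prod_unfold by (intro continuous_on_mult) (assumption, intro continuous_intros)
qed

text \<open>The difficulty is the rim, where \<open>z $ 2 = 0\<close>. In the integration by parts
  formula for \<open>Suc n\<close>, the first term is divisible by the induction hypothesis. The
  second involves a coefficient of frequency \<open>n + 2\<close>, which by
  \<open>four_decay\<close> vanishes to that order, so after division by the power
  \<open>Suc n\<close> it still tends to 0.\<close>

lemma four_quotient_continuous:
  assumes "smooth_near g U"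
  shows "\<exists>H. continuous_on (cball 0 1) H \<and> (\<forall>z. norm z = 1 \<longrightarrow> four g (int n) z = H (z $ 1) * (z $ 2) ^ n)"
  using assms
proof (induction n arbitrary: g)
  case 0
  note g = smooth_near_continuous[OF 0]
  have "four g (int 0) z = four_abs g 0 (z $ 1) * (z $ 2) ^ 0" if z: "norm z = 1" for z
  proof -
    obtain s where "s \<in> {0..1}" "z $ 2 = ecis s * of_real (norm (z $ 2))" using polar_ecis[of "z $ 2"] by blast
    from four_eq_abs[OF g z this, of 0] show ?thesis by simp
  qed
  then show ?case using continuous_on_four_abs[OF g] by blast
next
  case (Suc n)
  let ?r = "\<lambda>z::complex. sqrt (1 - norm z ^ 2)"
  obtain H1 where H1: "continuous_on (cball 0 1) H1"
    "\<forall>z. norm z = 1 \<longrightarrow> four (dz2 g) (int n) z = H1 (z $ 1) * (z $ 2) ^ n"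
    using Suc.IH[OF smooth_near_derivs(1)[OF Suc.prems]] by blast
  note gb = smooth_near_derivs(2)[OF Suc.prems]
  obtain C where C: "C \<ge> 0" "\<forall>m z. int (n + 2) \<le> m \<and> norm z = 1 \<longrightarrow> norm (four (dbar2 g) m z) \<le> C * norm (z $ 2) ^ (n + 2)"
    using four_decay[OF gb, of "n + 2"] by blast
  define q where "q = four_abs (dbar2 g) (int n + 2)"
  have cq: "continuous_on (cball 0 1) q"
    unfolding q_def by (rule continuous_on_four_abs[OF smooth_near_continuous[OF gb]])
  \<comment> \<open>At the rim this is a division by zero and has the value 0, which is also the
    limit.\<close>
  define K where "K z = q z * of_real (?r z) / of_real (?r z ^ Suc n)" for z
  have r0: "?r z \<ge> 0" if "norm z \<le> 1" for z using that by (simp add: power_le_one)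
  have qb: "norm (q z) \<le> C * ?r z ^ (n + 2)" if z: "norm z \<le> 1" for z
    using C(2)[rule_format, of "int n + 2" "pt z (of_real (?r z))"] norm_pt_sqrt[OF z] r0[OF z]
    unfolding q_def four_abs_def by simp
  have Kb: "norm (K z) \<le> C * ?r z ^ 2" if z: "norm z \<le> 1" for z
  proof (cases "?r z = 0")
    case True
    then show ?thesis unfolding K_def by simp
  next
    case False
    then have p: "?r z > 0" using r0[OF z] by simp
    have "norm (K z) = norm (q z) * ?r z / ?r z ^ Suc n"
      unfolding K_def norm_divide norm_mult norm_of_real using p by simp
    also have "\<dots> \<le> (C * ?r z ^ (n + 2)) * ?r z / ?r z ^ Suc n"
      using p qb[OF z] by (intro divide_right_mono mult_right_mono) auto
    also have "\<dots> = C * ?r z ^ 2" using p by (simp add: power2_eq_square)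
    finally show ?thesis .
  qed
  have cr: "continuous_on (cball 0 1) (\<lambda>z. complex_of_real (?r z))"
    by (intro continuous_on_of_real continuous_on_sqrt_norm)
  have cK: "continuous_on (cball 0 1) K"
    unfolding continuous_on_eq_continuous_within
  proof
    fix x :: complex assume x: "x \<in> cball 0 1"
    show "continuous (at x within cball 0 1) K"
    proof (cases "?r x = 0")
      case False
      have "continuous (at x within cball 0 1) q" "continuous (at x within cball 0 1) (\<lambda>z. complex_of_real (?r z))"
        using cq cr x unfolding continuous_on_eq_continuous_within by blast+
      then show ?thesis
        unfolding K_def[abs_def] of_real_power using False
        by (intro continuous_at_within_divide continuous_mult continuous_power) auto
    next
      case True
      have "(K \<longlongrightarrow> 0) (at x within cball 0 1)"
      proof (rule Lim_null_comparison)
        show "\<forall>\<^sub>F z in at x within cball 0 1. norm (K z) \<le> C * ?r z ^ 2"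
          unfolding eventually_at_filter using Kb by (intro always_eventually) auto
        have "continuous_on (cball 0 1) (\<lambda>z. C * ?r z ^ 2)"
          by (intro continuous_on_mult continuous_on_const continuous_on_power continuous_on_sqrt_norm)
        then have "((\<lambda>z. C * ?r z ^ 2) \<longlongrightarrow> C * ?r x ^ 2) (at x within cball 0 1)"
          using x unfolding continuous_on_def by blast
        then show "((\<lambda>z. C * ?r z ^ 2) \<longlongrightarrow> 0) (at x within cball 0 1)" unfolding True by simp
      qed
      moreover have "K x = 0" unfolding K_def True by simp
      ultimately show ?thesis unfolding continuous_within by simp
    qed
  qed
  have "four g (int (Suc n)) z = ((H1 (z $ 1) - K (z $ 1)) / of_nat (Suc n)) * (z $ 2) ^ Suc n" if z: "norm z = 1" for z
  proof -
    obtain s where s: "s \<in> {0..1}" "z $ 2 = ecis s * of_real (norm (z $ 2))" using polar_ecis[of "z $ 2"] by blast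
    define r where "r = norm (z $ 2)"
    have r: "r = ?r (z $ 1)" unfolding r_def by (rule sphere_sqrt[OF z])
    have z2: "z $ 2 = ecis s * of_real r" using s(2) by (simp only: r_def)
    have K: "cnj (z $ 2) * four (dbar2 g) (int n + 2) z = K (z $ 1) * (z $ 2) ^ Suc n"
    proof (cases "r = 0")
      case True
      then show ?thesis unfolding z2 by simp
    next
      case False
      have "four (dbar2 g) (int n + 2) z = ecis (of_int (int n + 2) * s) * q (z $ 1)"
        unfolding q_def by (rule four_eq_abs[OF smooth_near_continuous[OF gb] z s])
      also have "ecis (of_int (int n + 2) * s) = ecis s * ecis s ^ Suc n"
        unfolding ecis_power ecis_add[symmetric] by (simp add: algebra_simps)
      finally have "cnj (z $ 2) * four (dbar2 g) (int n + 2) z = (cnj (ecis s) * ecis s) * (of_real r * ecis s ^ Suc n * q (z $ 1))"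
        unfolding z2 complex_cnj_mult complex_cnj_complex_of_real by (simp only: mult_ac)
      moreover have "K (z $ 1) * (z $ 2) ^ Suc n = of_real r * ecis s ^ Suc n * q (z $ 1)"
        unfolding K_def r[symmetric] z2 power_mult_distrib of_real_power using False by (simp add: field_simps)
      ultimately show ?thesis unfolding ecis_mult_cnj by simp
    qed
    have "of_int (int (Suc n)) * four g (int (Suc n)) z = z $ 2 * four (dz2 g) (int n) z - cnj (z $ 2) * four (dbar2 g) (int n + 2) z"
      using four_parts[OF Suc.prems z, of "int (Suc n)"] by (simp add: add.commute)
    also have "\<dots> = (H1 (z $ 1) - K (z $ 1)) * (z $ 2) ^ Suc n"
      unfolding K H1(2)[rule_format, OF z] by (simp add: algebra_simps)
    finally show ?thesis
      by (simp add: field_simps del: of_nat_Suc)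
  qed
  moreover have "continuous_on (cball 0 1) (\<lambda>z. (H1 z - K z) / of_nat (Suc n))"
    by (intro continuous_on_divide continuous_on_diff H1(1) cK continuous_on_const) (simp del: of_nat_Suc)
  ultimately show ?case by blast
qed

text \<open>The product with \<open>(z $ 2) ^ m\<close> is invariant under rotations, hence a
  function \<open>k\<close> of \<open>z $ 1\<close>. On each line \<open>z $ 2\<close> is affine in
  \<open>z $ 1\<close>, so this factor preserves the moment conditions and \<open>k\<close> is
  holomorphic; it also makes \<open>k\<close> vanish on the unit circle.\<close>

lemma four_negative_vanish:
  fixes \<alpha> \<beta> :: real
  assumes ab: "\<beta> < 0" "0 < \<alpha>" and g: "smooth_near g U" and ext: "ext_pencil \<alpha> g" "ext_pencil \<beta> g"
    and m: "m > 0" and z: "norm z = 1"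
  shows "four g (- int m) z = 0"
proof (cases "z $ 2 = 0")
  case True
  \<comment> \<open>On the rim both terms on the right of the integration by parts formula contain a
    factor 0.\<close>
  from four_parts[OF g z, of "- int m"] m show ?thesis unfolding True by simp
next
  case False
  note gc = smooth_near_continuous[OF g]
  define k where "k z = four_abs g (- int m) z * of_real (sqrt (1 - norm z ^ 2)) ^ m" for z
  have k: "four g (- int m) z * (z $ 2) ^ m = k (z $ 1)" if z: "norm z = 1" for z
  proof -
    obtain s where s: "s \<in> {0..1}" "z $ 2 = ecis s * of_real (norm (z $ 2))" using polar_ecis[of "z $ 2"] by blast
    have z2: "z $ 2 = ecis s * of_real (sqrt (1 - norm (z $ 1) ^ 2))" using s(2) unfolding sphere_sqrt[OF z] .
    have "ecis (of_int (- int m) * s) * ecis s ^ m = 1"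
      unfolding ecis_power ecis_add[symmetric] by simp
    then have "(ecis (of_int (- int m) * s) * ecis s ^ m) * k (z $ 1) = k (z $ 1)" by simp
    then show ?thesis
      unfolding four_eq_abs[OF gc z s] z2 k_def power_mult_distrib by (simp only: mult_ac)
  qed
  have ck: "continuous_on (cball 0 1) k"
    unfolding k_def by (intro continuous_on_mult continuous_on_power continuous_on_four_abs gc continuous_on_of_real continuous_on_sqrt_norm)
  have pk: "pencil_holomorphic \<gamma> k" if "ext_pencil \<gamma> g" for \<gamma>
    unfolding pencil_holomorphic_def
  proof (intro ballI allI impI)
    fix s and A B :: complex assume s: "s \<in> {start \<gamma><..<1}" and AB: "\<forall>z\<in>cball (of_real ((1 - s) * \<gamma>)) (rad \<gamma> s). A + B * z \<noteq> 0"
    have s0: "s > 0" using s start_bounds(1)[of \<gamma>] by auto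
    define c where "c = complex_of_real (sqrt ((1 - s) / s))"
    have c: "norm c ^ 2 = (1 - s) / s" unfolding c_def norm_of_real power2_abs using s0 s by simp
    have "k (circ \<gamma> s t) * ecis t / (A + B * circ \<gamma> s t) = four g (- int m) (pt (circ \<gamma> s t) (c * (circ \<gamma> s t - of_real \<gamma>))) *
      ((c * (circ \<gamma> s t - of_real \<gamma>)) ^ m * ecis t / (A + B * circ \<gamma> s t))" for t
      using k[OF circle_on_sphere[OF s c, of t]] unfolding pt_nth by (simp add: mult.assoc[symmetric])
    then show "integral {0..1} (\<lambda>t. k (circ \<gamma> s t) * ecis t / (A + B * circ \<gamma> s t)) = 0"
      using four_pencil_moment[OF gc that s c _ AB, of "\<lambda>z. (c * (z - of_real \<gamma>)) ^ m" "- int m"]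
      by (simp only: holomorphic_on_power holomorphic_on_mult holomorphic_on_diff holomorphic_on_const holomorphic_on_ident)
  qed
  have hk: "k holomorphic_on ball 0 1"
    by (rule pencil_holomorphic_imp_holomorphic[OF ab ck pk[OF ext(1)] pk[OF ext(2)]])
  have kz: "norm (k w) \<le> 0" if "w \<in> ball 0 1" for w
  proof (rule maximum_modulus_frontier[of k "ball 0 1"])
    show "norm (k z) \<le> 0" if "z \<in> frontier (ball 0 1)" for z
    proof -
      have "norm z = 1" using that by simp
      then show ?thesis unfolding k_def using m by simp
    qed
    show "k holomorphic_on interior (ball 0 1)" using hk by simp
    show "continuous_on (closure (ball 0 1)) k" using ck by simp
  qed (use that in simp_all)
  have "norm (z $ 1) ^ 2 + norm (z $ 2) ^ 2 = 1" unfolding norm_vec2[symmetric] z by simp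
  moreover have "norm (z $ 2) ^ 2 > 0" using False by simp
  ultimately have "norm (z $ 1) ^ 2 < 1" by linarith
  then have "norm (z $ 1) < 1" using power_less_imp_less_base[of "norm (z $ 1)" 2 1] by simp
  then have "k (z $ 1) = 0" using kz[of "z $ 1"] by simp
  then show ?thesis using k[OF z] False by simp
qed

text \<open>On the pencil of \<open>\<gamma>\<close>, \<open>(z $ 2) ^ n\<close> is a constant times
  \<open>(z $ 1 - \<gamma>) ^ n\<close>, so it is \<open>H\<close> times this power that satisfies
  the moment conditions. Including the powers for both base points makes one function serve both
  pencils; dividing them off leaves at most two singularities, removable by continuity of
  \<open>H\<close>.\<close>

lemma four_quotient_holomorphic:
  fixes \<alpha> \<beta> :: real
  assumes ab: "\<beta> < 0" "0 < \<alpha>" and g: "smooth_near g U" and ext: "ext_pencil \<alpha> g" "ext_pencil \<beta> g"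
    and H: "continuous_on (cball 0 1) H" "\<And>z. norm z = 1 \<Longrightarrow> four g (int n) z = H (z $ 1) * (z $ 2) ^ n"
  shows "H holomorphic_on ball 0 1"
proof -
  note gc = smooth_near_continuous[OF g]
  define h where "h z = H z * ((z - of_real \<alpha>) ^ n * (z - of_real \<beta>) ^ n)" for z
  have ch: "continuous_on (cball 0 1) h"
    unfolding h_def by (intro continuous_on_mult H(1) continuous_on_power continuous_on_diff continuous_on_id continuous_on_const)
  have ph: "pencil_holomorphic \<gamma> h" if ext\<gamma>: "ext_pencil \<gamma> g" and hh: "\<And>z. h z = H z * ((z - of_real \<gamma>) ^ n * (z - of_real \<gamma>') ^ n)" for \<gamma> \<gamma>' :: real
    unfolding pencil_holomorphic_def
  proof (intro ballI allI impI)
    fix s and A B :: complex assume s: "s \<in> {start \<gamma><..<1}" and AB: "\<forall>z\<in>cball (of_real ((1 - s) * \<gamma>)) (rad \<gamma> s). A + B * z \<noteq> 0"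
    have s0: "s > 0" "s < 1" using s start_bounds(1)[of \<gamma>] by auto
    define c where "c = complex_of_real (sqrt ((1 - s) / s))"
    have c: "norm c ^ 2 = (1 - s) / s" unfolding c_def norm_of_real power2_abs using s0 by simp
    have c0: "c ^ n \<noteq> 0" unfolding c_def using s0 by simp
    let ?I = "\<lambda>t. four g (int n) (pt (circ \<gamma> s t) (c * (circ \<gamma> s t - of_real \<gamma>))) * ((circ \<gamma> s t - of_real \<gamma>') ^ n * ecis t / (A + B * circ \<gamma> s t))"
    have "integral {0..1} ?I = 0"
      by (rule four_pencil_moment[OF gc ext\<gamma> s c _ AB, of "\<lambda>z. (z - of_real \<gamma>') ^ n"])
        (intro holomorphic_on_power holomorphic_on_diff holomorphic_on_const holomorphic_on_ident)
    moreover have "?I t = c ^ n * (h (circ \<gamma> s t) * ecis t / (A + B * circ \<gamma> s t))" for t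
      unfolding H(2)[OF circle_on_sphere[OF s c]] pt_nth hh power_mult_distrib by simp
    ultimately show "integral {0..1} (\<lambda>t. h (circ \<gamma> s t) * ecis t / (A + B * circ \<gamma> s t)) = 0"
      using c0 by (simp only: integral_mult_right mult_eq_0_iff simp_thms)
  qed
  have hol: "h holomorphic_on ball 0 1"
  proof (rule pencil_holomorphic_imp_holomorphic[OF ab ch])
    show "pencil_holomorphic \<alpha> h" by (rule ph[OF ext(1)]) (rule h_def)
    show "pencil_holomorphic \<beta> h" by (rule ph[OF ext(2), of \<alpha>]) (simp only: h_def mult.commute)
  qed
  let ?K = "{complex_of_real \<alpha>, complex_of_real \<beta>}"
  have "(\<lambda>z. h z / ((z - of_real \<alpha>) ^ n * (z - of_real \<beta>) ^ n)) holomorphic_on (ball 0 1 - ?K)"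
    by (intro holomorphic_on_divide holomorphic_on_subset[OF hol] holomorphic_on_mult holomorphic_on_power holomorphic_on_diff holomorphic_on_const holomorphic_on_ident) auto
  then have "H holomorphic_on (ball 0 1 - ?K)"
    by (rule holomorphic_transform) (simp add: h_def)
  then show ?thesis
    by (rule no_isolated_singularity[OF continuous_on_subset[OF H(1) ball_subset_cball]]) simp_all
qed

theorem ext_pencil_imp_extends:
  fixes \<alpha> \<beta> :: real
  assumes ab: "\<beta> < 0" "0 < \<alpha>" and f: "smooth_on_sphere f" and ext: "ext_pencil \<alpha> f" "ext_pencil \<beta> f"
  shows "extends_holomorphically_through_ball f"
proof -
  from f obtain U g where Ug: "open U" "sphere 0 1 \<subseteq> U" "\<forall>k. C_k_on k g U" "\<forall>z\<in>sphere 0 1. g z = f z"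
    unfolding smooth_on_sphere_def by blast
  then have g: "smooth_near g U" unfolding smooth_near_def by blast
  have extg: "ext_pencil \<gamma> g" if e: "ext_pencil \<gamma> f" for \<gamma>
    unfolding ext_pencil_def
  proof (intro ballI allI impI)
    fix s and c :: complex assume s: "s \<in> {start \<gamma><..<1}" and c: "norm c ^ 2 = (1 - s) / s"
    obtain G where G: "continuous_on (cball (of_real ((1 - s) * \<gamma>)) (rad \<gamma> s)) G \<and>
          G holomorphic_on ball (of_real ((1 - s) * \<gamma>)) (rad \<gamma> s) \<and>
          (\<forall>z. norm (z - of_real ((1 - s) * \<gamma>)) = rad \<gamma> s \<longrightarrow> G z = f (pt z (c * (z - of_real \<gamma>))))"
      using bspec[OF e[unfolded ext_pencil_def] s, rule_format, OF c] ..
    have s0: "s > 0" "s \<in> {start \<gamma>..1}" using s start_bounds(1)[of \<gamma>] by auto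
    have "g (pt z (c * (z - of_real \<gamma>))) = f (pt z (c * (z - of_real \<gamma>)))" if "norm (z - of_real ((1 - s) * \<gamma>)) = rad \<gamma> s" for z
    proof -
      have "norm (pt z (c * (z - of_real \<gamma>))) = 1"
        unfolding norm_pt_eq_1 circle_equation[OF s0(1) c] that rad_sq[OF s0(2)] by simp
      then show ?thesis using Ug(4) by simp
    qed
    then show "\<exists>G. continuous_on (cball (of_real ((1 - s) * \<gamma>)) (rad \<gamma> s)) G \<and>
          G holomorphic_on ball (of_real ((1 - s) * \<gamma>)) (rad \<gamma> s) \<and>
          (\<forall>z. norm (z - of_real ((1 - s) * \<gamma>)) = rad \<gamma> s \<longrightarrow> G z = g (pt z (c * (z - of_real \<gamma>))))"
      using G by (intro exI[of _ G]) simp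
  qed
  define H where "H n = (SOME H. continuous_on (cball 0 1) H \<and> (\<forall>z. norm z = 1 \<longrightarrow> four g (int n) z = H (z $ 1) * (z $ 2) ^ n))" for n
  have H: "continuous_on (cball 0 1) (H n) \<and> (\<forall>z. norm z = 1 \<longrightarrow> four g (int n) z = H n (z $ 1) * (z $ 2) ^ n)" for n
    unfolding H_def by (rule someI_ex[OF four_quotient_continuous[OF g]])
  have "extends_holomorphically_through_ball g"
  proof (rule extension_of_four_coefficients[OF g])
    show "four g n z = 0" if "n < 0" "norm z = 1" for n z
      using four_negative_vanish[OF ab g extg[OF ext(1)] extg[OF ext(2)] _ that(2), of "nat (- n)"] that(1) by simp
    show "continuous_on (cball 0 1) (H n)" for n by (rule conjunct1[OF H])
    show "four g (int n) z = H n (z $ 1) * (z $ 2) ^ n" if "norm z = 1" for n z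
      by (rule conjunct2[OF H, rule_format, OF that])
    then show "H n holomorphic_on ball 0 1" for n
      by (rule four_quotient_holomorphic[OF ab g extg[OF ext(1)] extg[OF ext(2)] conjunct1[OF H]])
  qed
  then obtain G where G: "continuous_on (cball 0 1) G \<and> (\<forall>z\<in>sphere 0 1. G z = g z) \<and> holomorphic2_on G (ball 0 1)"
    unfolding extends_holomorphically_through_ball_def ..
  have "\<forall>z\<in>sphere 0 1. G z = f z"
  proof
    fix z :: "complex^2" assume z: "z \<in> sphere 0 1"
    show "G z = f z" using bspec[OF conjunct1[OF conjunct2[OF G]] z] bspec[OF Ug(4) z] by (simp only:)
  qed
  with G show ?thesis
    unfolding extends_holomorphically_through_ball_def by blast
qed

lemma lines_through_cases:
  assumes "L \<in> lines_through p"
  obtains v where "v \<noteq> 0" "L = range (\<lambda>\<zeta>. p + \<zeta> *s v)"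
proof -
  from assms obtain q v \<zeta>0 where pv: "v \<noteq> 0" "L = range (\<lambda>\<zeta>. q + \<zeta> *s v)" "p = q + \<zeta>0 *s v"
    unfolding lines_through_def complex_line_def by blast
  have 1: "q + \<zeta> *s v = p + (\<zeta> - \<zeta>0) *s v" and 2: "p + \<zeta> *s v = q + (\<zeta> + \<zeta>0) *s v" for \<zeta>
    unfolding pv(3) by (simp_all add: vec_eq_iff algebra_simps)
  have "L = range (\<lambda>\<zeta>. p + \<zeta> *s v)"
    unfolding pv(2)
  proof (intro equalityI image_subsetI)
    show "q + \<zeta> *s v \<in> range (\<lambda>\<zeta>. p + \<zeta> *s v)" for \<zeta> by (subst 1) (rule rangeI)
    show "p + \<zeta> *s v \<in> range (\<lambda>\<zeta>. q + \<zeta> *s v)" for \<zeta> by (subst 2) (rule rangeI)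
  qed
  then show thesis using that pv(1) by blast
qed

subsection \<open>Projective automorphisms of the ball\<close>

definition aff :: "complex \<Rightarrow> complex \<Rightarrow> complex \<Rightarrow> complex^2 \<Rightarrow> complex" where
  "aff c0 c1 c2 z = c0 + c1 * z $ 1 + c2 * z $ 2"

lemma aff_line: "aff c0 c1 c2 (p + \<zeta> *s v) = aff c0 c1 c2 p + \<zeta> * aff 0 c1 c2 v"
  by (simp add: aff_def algebra_simps)

lemma aff_linear_smult: "aff 0 c1 c2 (c *s h) = c * aff 0 c1 c2 h"
  by (simp add: aff_def algebra_simps)

lemma bounded_linear_aff: "bounded_linear (aff 0 c1 c2)"
proof -
  have "linear (aff 0 c1 c2)"
    by (rule linearI) (simp_all add: aff_def algebra_simps)
  then show ?thesis by (simp add: linear_conv_bounded_linear)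
qed

lemma aff_has_derivative: "(aff c0 c1 c2 has_derivative aff 0 c1 c2) (at z within S)"
proof -
  have "((\<lambda>z. c0 + aff 0 c1 c2 z) has_derivative (\<lambda>h. 0 + aff 0 c1 c2 h)) (at z within S)"
    by (intro has_derivative_add has_derivative_const bounded_linear_imp_has_derivative bounded_linear_aff)
  moreover have "(\<lambda>z. c0 + aff 0 c1 c2 z) = aff c0 c1 c2" by (simp add: fun_eq_iff aff_def)
  ultimately show ?thesis by simp
qed

lemma continuous_on_aff [continuous_intros]: "continuous_on S (aff c0 c1 c2)"
  by (rule has_derivative_continuous_on) (rule aff_has_derivative)

lemma C_k_on_aff: "open U \<Longrightarrow> C_k_on k (aff c0 c1 c2) U"
proof -
  assume U: "open U"
  have "C_k_on k (\<lambda>z. c0 + aff 0 c1 c2 z) U"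
    by (rule C_k_on_add[OF U C_k_on_const[OF U] C_k_on_bounded_linear[OF U bounded_linear_aff]])
  moreover have "(\<lambda>z. c0 + aff 0 c1 c2 z) = aff c0 c1 c2" by (simp add: fun_eq_iff aff_def)
  ultimately show ?thesis by simp
qed

lemma bounded_linear_pt1: "bounded_linear (\<lambda>w. pt w 0)"
proof -
  have "linear (\<lambda>w. pt w 0)"
    by (rule linearI) (simp_all add: pt_add pt_scaleR)
  then show ?thesis by (simp add: linear_conv_bounded_linear)
qed

lemma C_k_on_pt:
  assumes "open U" "C_k_on k f U" "C_k_on k g U"
  shows "C_k_on k (\<lambda>x. pt (f x) (g x)) U"
proof -
  have "C_k_on k (\<lambda>x. pt (f x) 0 + pt 0 (g x)) U"
    by (rule C_k_on_add[OF assms(1) C_k_on_compose_bounded_linear[OF assms(1) bounded_linear_pt1 assms(2)] C_k_on_compose_bounded_linear[OF assms(1) bounded_linear_pt assms(3)]])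
  then show ?thesis by (simp add: pt_add)
qed

lemma pt_has_derivative:
  assumes "(f has_derivative f') F" "(g has_derivative g') F"
  shows "((\<lambda>x. pt (f x) (g x)) has_derivative (\<lambda>h. pt (f' h) (g' h))) F"
proof -
  have "((\<lambda>x. pt (f x) 0 + pt 0 (g x)) has_derivative (\<lambda>h. pt (f' h) 0 + pt 0 (g' h))) F"
    by (rule has_derivative_add[OF bounded_linear.has_derivative[OF bounded_linear_pt1 assms(1)] bounded_linear.has_derivative[OF bounded_linear_pt assms(2)]])
  then show ?thesis by (simp add: pt_add)
qed

text \<open>With affine arguments and their common denominator this is a projective transformation
  written in an affine chart.\<close>

definition pmap :: "(complex^2 \<Rightarrow> complex) \<Rightarrow> (complex^2 \<Rightarrow> complex) \<Rightarrow> (complex^2 \<Rightarrow> complex) \<Rightarrow> complex^2 \<Rightarrow> complex^2" where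
  "pmap f g d z = pt (f z / d z) (g z / d z)"

definition ball_map :: "(complex^2 \<Rightarrow> complex^2) \<Rightarrow> bool" where
  "ball_map S \<longleftrightarrow> (\<forall>z. norm z < 1 \<longrightarrow> norm (S z) < 1) \<and> (\<forall>z. norm z = 1 \<longrightarrow> norm (S z) = 1)"

lemma ball_map_le: "ball_map S \<Longrightarrow> norm z \<le> 1 \<Longrightarrow> norm (S z) \<le> 1"
  unfolding ball_map_def by (cases "norm z = 1") (simp_all add: less_imp_le)

abbreviation (input) test_pair :: "complex^2 \<Rightarrow> complex^2 \<Rightarrow> bool" where
  "test_pair a b \<equiv> test_family (lines_through a \<union> lines_through b)"

context
  fixes ax ay az ex ey ez dx dy dz :: complex and S
  assumes S: "S = pmap (aff ax ay az) (aff ex ey ez) (aff dx dy dz)"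
    and d: "\<forall>z. norm z \<le> 1 \<longrightarrow> aff dx dy dz z \<noteq> 0"
    and bm: "ball_map S"
begin

lemma denominator_nonzero: "norm z \<le> 1 \<Longrightarrow> aff dx dy dz z \<noteq> 0"
  using d by blast

lemma pmap_continuous: "continuous_on (cball 0 1) S"
  unfolding S pmap_def[abs_def]
  by (intro continuous_on_pt continuous_on_divide continuous_on_aff ballI denominator_nonzero) simp_all

lemma pmap_holomorphic2_compose:
  assumes "holomorphic2_on F (ball 0 1)"
  shows "holomorphic2_on (\<lambda>z. F (S z)) (ball 0 1)"
  unfolding holomorphic2_on_def
proof
  fix z :: "complex^2" assume "z \<in> ball 0 1"
  then have z: "norm z < 1" by simp
  have Dz: "aff dx dy dz z \<noteq> 0" using denominator_nonzero[OF less_imp_le[OF z]] .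
  have "S z \<in> ball 0 1" using bm z unfolding ball_map_def by simp
  then obtain F' where F': "(F has_derivative F') (at (S z)) \<and> (\<forall>c h. F' (c *s h) = c * F' h)"
    using bspec[OF assms[unfolded holomorphic2_on_def]] by blast
  define q where "q c0 c1 c2 h = (aff 0 c1 c2 h * aff dx dy dz z - aff c0 c1 c2 z * aff 0 dy dz h) / (aff dx dy dz z * aff dx dy dz z)" for c0 c1 c2 h
  have q: "((\<lambda>z. aff c0 c1 c2 z / aff dx dy dz z) has_derivative q c0 c1 c2) (at z)" for c0 c1 c2
    using has_derivative_divide'[OF aff_has_derivative[of c0 c1 c2 z UNIV] aff_has_derivative[of dx dy dz z UNIV] Dz]
    unfolding q_def by simp
  have qs: "q c0 c1 c2 (c *s h) = c * q c0 c1 c2 h" for c0 c1 c2 c h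
    unfolding q_def aff_linear_smult by (simp add: algebra_simps)
  define S' where "S' h = pt (q ax ay az h) (q ex ey ez h)" for h
  have "(S has_derivative S') (at z)"
    unfolding S pmap_def[abs_def] S'_def by (intro pt_has_derivative q)
  from has_derivative_compose[OF this conjunct1[OF F']]
  have 1: "((\<lambda>z. F (S z)) has_derivative (\<lambda>h. F' (S' h))) (at z)" .
  have "S' (c *s h) = c *s S' h" for c h
    unfolding S'_def qs by (simp add: vec_eq_iff forall_2)
  then have 2: "F' (S' (c *s h)) = c * F' (S' h)" for c h
    using conjunct2[OF F', rule_format, of c "S' h"] by (simp only:)
  show "\<exists>f'. ((\<lambda>z. F (S z)) has_derivative f') (at z) \<and> (\<forall>c h. f' (c *s h) = c * f' h)"
    by (rule exI, rule conjI, rule 1, intro allI, rule 2)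
qed

lemma pmap_smooth:
  assumes "smooth_on_sphere f"
  shows "smooth_on_sphere (\<lambda>z. f (S z))"
proof -
  obtain U g where U: "open U" "sphere 0 1 \<subseteq> U" "\<forall>k. C_k_on k g U" "\<forall>z\<in>sphere 0 1. g z = f z"
    using assms unfolding smooth_on_sphere_def by blast
  define V0 where "V0 = {z. aff dx dy dz z \<noteq> 0}"
  have oV0: "open V0"
    unfolding V0_def by (rule open_Collect_neq) (intro continuous_on_aff continuous_on_const)+
  have q: "C_k_on k (\<lambda>z. aff c0 c1 c2 z / aff dx dy dz z) V0" for k c0 c1 c2
    unfolding divide_inverse by (intro C_k_on_mult C_k_on_inverse C_k_on_aff oV0) (simp add: V0_def)
  have SC: "C_k_on k S V0" for k
    unfolding S pmap_def[abs_def] by (intro C_k_on_pt q oV0)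
  have cS: "continuous_on V0 S" by (rule C_k_on_imp_continuous_on[OF SC])
  define V where "V = V0 \<inter> S -` U"
  have oV: "open V" unfolding V_def by (rule continuous_open_preimage[OF cS oV0 U(1)])
  have SV: "C_k_on k S V" for k
  proof -
    have res: "C_k_on k f V" if "C_k_on k f V0" for f :: "complex^2 \<Rightarrow> complex^2"
      using that
    proof (induction k arbitrary: f)
      case 0
      then show ?case by (auto simp: V_def intro: continuous_on_subset)
    next
      case (Suc k)
      then show ?case by (auto simp: V_def)
    qed
    show ?thesis by (rule res[OF SC])
  qed
  have sub: "sphere 0 1 \<subseteq> V"
  proof
    fix z :: "complex^2" assume "z \<in> sphere 0 1"
    then have z: "norm z = 1" by simp
    have "norm (S z) = 1" using bm z unfolding ball_map_def by simp
    then have "S z \<in> U" using U(2) by auto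
    then show "z \<in> V" using denominator_nonzero[of z] z by (simp add: V_def V0_def)
  qed
  have "C_k_on k (\<lambda>z. g (S z)) V" for k
    by (rule C_k_on_compose[OF U(1) oV _ _ SV]) (use U(3) in \<open>auto simp: V_def\<close>)
  moreover have "g (S z) = f (S z)" if "z \<in> sphere 0 1" for z
    using that bm U(4) unfolding ball_map_def by simp
  ultimately show ?thesis
    unfolding smooth_on_sphere_def using oV sub by blast
qed

text \<open>Lines go to lines, and in line coordinates the map is the fractional linear function
  \<open>\<eta>\<close>, so extensions can be pulled back. The base point \<open>p\<close> may lie
  outside the ball; the condition on the denominator makes its image a finite point.\<close>

lemma pmap_line:
  assumes p: "aff dx dy dz p \<noteq> 0" and inj: "inj_on S (ball 0 1)"
    and L: "L \<in> lines_through p" "L \<inter> ball 0 1 \<noteq> {}"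
    and ext: "\<And>L'. L' \<in> lines_through (S p) \<Longrightarrow> L' \<inter> ball 0 1 \<noteq> {} \<Longrightarrow> extends_holomorphically_along f L'"
  shows "extends_holomorphically_along (\<lambda>z. f (S z)) L"
proof -
  from L(1) obtain v where pv: "v \<noteq> 0" and L: "L = range (\<lambda>\<zeta>. p + \<zeta> *s v)"
    by (rule lines_through_cases)
  define l where "l c1 c2 = aff 0 c1 c2 v" for c1 c2
  define v' where "v' = pt (l ay az - l dy dz * S p $ 1) (l ey ez - l dy dz * S p $ 2)"
  define \<eta> where "\<eta> \<zeta> = \<zeta> / aff dx dy dz (p + \<zeta> *s v)" for \<zeta>
  have Sline: "S (p + \<zeta> *s v) = S p + \<eta> \<zeta> *s v'" if nz: "aff dx dy dz (p + \<zeta> *s v) \<noteq> 0" for \<zeta>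
  proof -
    have "aff c0 c1 c2 (p + \<zeta> *s v) / aff dx dy dz (p + \<zeta> *s v) =
      aff c0 c1 c2 p / aff dx dy dz p + \<eta> \<zeta> * (l c1 c2 - l dy dz * (aff c0 c1 c2 p / aff dx dy dz p))" for c0 c1 c2
      using nz p unfolding \<eta>_def aff_line l_def[symmetric] by (simp add: divide_simps) (simp add: algebra_simps)
    then show ?thesis
      unfolding v'_def S pmap_def by (simp add: vec_eq_iff forall_2)
  qed
  have nz: "aff dx dy dz (p + \<zeta> *s v) \<noteq> 0" if "norm (p + \<zeta> *s v) \<le> 1" for \<zeta>
    by (rule denominator_nonzero[OF that])
  obtain \<zeta>1 where \<zeta>1: "norm (p + \<zeta>1 *s v) < 1"
    using assms(4) unfolding L by auto
  \<comment> \<open>Otherwise the line would collapse to a point. The number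
    \<open>\<epsilon>\<close> yields a second point of the line inside the ball, half way from the
    first one to the sphere at most, and contradicts injectivity.\<close>
  have v': "v' \<noteq> 0"
  proof
    assume v0: "v' = 0"
    define \<epsilon> where "\<epsilon> = (1 - norm (p + \<zeta>1 *s v)) / (2 * norm v)"
    have \<epsilon>: "\<epsilon> > 0" using \<zeta>1 pv by (simp add: \<epsilon>_def)
    have "p + (\<zeta>1 + of_real \<epsilon>) *s v = (p + \<zeta>1 *s v) + of_real \<epsilon> *s v"
      by (simp add: vec_eq_iff algebra_simps)
    then have "norm (p + (\<zeta>1 + of_real \<epsilon>) *s v) \<le> norm (p + \<zeta>1 *s v) + \<epsilon> * norm v"
      using norm_triangle_ineq[of "p + \<zeta>1 *s v" "of_real \<epsilon> *s v"] \<epsilon> by (simp only: norm_smult_vec norm_of_real abs_of_pos)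
    also have "\<epsilon> * norm v = (1 - norm (p + \<zeta>1 *s v)) / 2" using pv by (simp add: \<epsilon>_def)
    finally have \<zeta>2: "norm (p + (\<zeta>1 + of_real \<epsilon>) *s v) < 1" using \<zeta>1 by (simp add: field_simps)
    have "S (p + \<zeta>1 *s v) = S (p + (\<zeta>1 + of_real \<epsilon>) *s v)"
      unfolding Sline[OF nz[OF less_imp_le[OF \<zeta>1]]] Sline[OF nz[OF less_imp_le[OF \<zeta>2]]] v0 by simp
    then have "p + \<zeta>1 *s v = p + (\<zeta>1 + of_real \<epsilon>) *s v"
      by (rule inj_onD[OF inj]) (use \<zeta>1 \<zeta>2 in simp_all)
    then have "of_real \<epsilon> *s v = 0" by (simp add: vec_eq_iff algebra_simps)
    then have "norm (complex_of_real \<epsilon> *s v) = 0" by simp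
    then show False unfolding norm_smult_vec using \<epsilon> pv by simp
  qed
  define L' where "L' = range (\<lambda>\<eta>. S p + \<eta> *s v')"
  have SL: "S z \<in> L'" if "z \<in> L" "norm z \<le> 1" for z
    using that nz Sline unfolding L L'_def by auto
  have "S p + 0 *s v' \<in> L'" unfolding L'_def by (rule rangeI)
  then have "L' \<in> lines_through (S p)"
    unfolding lines_through_def complex_line_def L'_def using v' by auto
  moreover have "S (p + \<zeta>1 *s v) \<in> L' \<inter> ball 0 1"
    using SL[of "p + \<zeta>1 *s v"] \<zeta>1 bm unfolding L ball_map_def by auto
  ultimately obtain G where G: "continuous_on (L' \<inter> cball 0 1) G" "\<forall>z\<in>L' \<inter> sphere 0 1. G z = f z"
    "holomorphic_on_line G L' (L' \<inter> ball 0 1)"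
    using ext[of L'] unfolding extends_holomorphically_along_def by blast
  have c: "continuous_on (L \<inter> cball 0 1) (\<lambda>z. G (S z))"
  proof (rule continuous_on_compose2[OF G(1)])
    show "continuous_on (L \<inter> cball 0 1) S" by (rule continuous_on_subset[OF pmap_continuous]) simp
    show "S ` (L \<inter> cball 0 1) \<subseteq> L' \<inter> cball 0 1"
      using SL ball_map_le[OF bm] by auto
  qed
  have e: "\<forall>z\<in>L \<inter> sphere 0 1. G (S z) = f (S z)"
  proof
    fix z assume "z \<in> L \<inter> sphere 0 1"
    then have "S z \<in> L' \<inter> sphere 0 1" using SL[of z] bm unfolding ball_map_def by simp
    then show "G (S z) = f (S z)" using G(2) by blast
  qed
  have "(\<lambda>\<eta>. G (S p + \<eta> *s v')) holomorphic_on {\<eta>. S p + \<eta> *s v' \<in> L' \<inter> ball 0 1}"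
    using holomorphic_on_line_iff[OF v' L'_def] G(3) by blast
  moreover have "\<eta> holomorphic_on {\<zeta>. p + \<zeta> *s v \<in> L \<inter> ball 0 1}"
    unfolding \<eta>_def[abs_def] aff_line
    by (intro holomorphic_on_divide holomorphic_on_add holomorphic_on_mult holomorphic_on_const holomorphic_on_ident)
      (use nz in \<open>simp add: aff_line\<close>)
  moreover have "\<eta> ` {\<zeta>. p + \<zeta> *s v \<in> L \<inter> ball 0 1} \<subseteq> {\<eta>. S p + \<eta> *s v' \<in> L' \<inter> ball 0 1}"
  proof (rule image_subsetI)
    fix \<zeta> assume "\<zeta> \<in> {\<zeta>. p + \<zeta> *s v \<in> L \<inter> ball 0 1}"
    then have z: "p + \<zeta> *s v \<in> L" "norm (p + \<zeta> *s v) < 1" by simp_all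
    have "S (p + \<zeta> *s v) \<in> L' \<inter> ball 0 1"
      using SL[OF z(1)] z(2) bm unfolding ball_map_def by simp
    then show "\<eta> \<zeta> \<in> {\<eta>. S p + \<eta> *s v' \<in> L' \<inter> ball 0 1}"
      unfolding Sline[OF nz[OF less_imp_le[OF z(2)]]] by simp
  qed
  ultimately have "((\<lambda>\<eta>. G (S p + \<eta> *s v')) \<circ> \<eta>) holomorphic_on {\<zeta>. p + \<zeta> *s v \<in> L \<inter> ball 0 1}"
    by (intro holomorphic_on_compose_gen)
  then have "(\<lambda>\<zeta>. G (S (p + \<zeta> *s v))) holomorphic_on {\<zeta>. p + \<zeta> *s v \<in> L \<inter> ball 0 1}"
  proof (rule holomorphic_transform)
    fix \<zeta> assume "\<zeta> \<in> {\<zeta>. p + \<zeta> *s v \<in> L \<inter> ball 0 1}"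
    then have "norm (p + \<zeta> *s v) \<le> 1" by simp
    from Sline[OF nz[OF this]] show "((\<lambda>\<eta>. G (S p + \<eta> *s v')) \<circ> \<eta>) \<zeta> = G (S (p + \<zeta> *s v))" by simp
  qed
  then have "holomorphic_on_line (\<lambda>z. G (S z)) L (L \<inter> ball 0 1)"
    using holomorphic_on_line_iff[OF pv L, of "\<lambda>z. G (S z)"] by blast
  then show ?thesis
    unfolding extends_holomorphically_along_def using c e by blast
qed

end

text \<open>A function is pulled back by \<open>S\<close>, extended, and the extension is carried
  back by the inverse \<open>T\<close>. The two maps are inverse to each other on the closed ball,
  while \<open>a\<close> and \<open>b\<close> may lie outside it.\<close>

lemma test_pair_pmap:
  assumes S: "S = pmap (aff ax ay az) (aff ex ey ez) (aff dx dy dz)" "\<forall>z. norm z \<le> 1 \<longrightarrow> aff dx dy dz z \<noteq> 0" "ball_map S"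
    and T: "T = pmap (aff ax' ay' az') (aff ex' ey' ez') (aff dx' dy' dz')" "\<forall>z. norm z \<le> 1 \<longrightarrow> aff dx' dy' dz' z \<noteq> 0" "ball_map T"
    and ST: "\<And>z. norm z \<le> 1 \<Longrightarrow> S (T z) = z" and TS: "\<And>z. norm z \<le> 1 \<Longrightarrow> T (S z) = z"
    and a: "aff dx dy dz a \<noteq> 0" and b: "aff dx dy dz b \<noteq> 0" and test_pair: "test_pair a b"
  shows "test_pair (S a) (S b)"
  unfolding test_family_def
proof (intro allI impI, elim conjE)
  fix f assume f: "smooth_on_sphere f"
    and ext: "\<forall>L\<in>lines_through (S a) \<union> lines_through (S b). L \<inter> ball 0 1 \<noteq> {} \<longrightarrow> extends_holomorphically_along f L"
  have inj: "inj_on S (ball 0 1)"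
  proof (rule inj_onI)
    fix x y assume xy: "x \<in> ball 0 1" "y \<in> ball 0 1" "S x = S y"
    have n: "norm x \<le> 1" "norm y \<le> 1" using xy(1,2) by simp_all
    show "x = y" using arg_cong[OF xy(3), of T] unfolding TS[OF n(1)] TS[OF n(2)] .
  qed
  have "extends_holomorphically_along (\<lambda>z. f (S z)) L" if L: "L \<in> lines_through a \<union> lines_through b" "L \<inter> ball 0 1 \<noteq> {}" for L
    using L(1)
  proof
    assume "L \<in> lines_through a"
    then show ?thesis
      by (rule pmap_line[OF S a inj _ L(2)]) (use ext in blast)
  next
    assume "L \<in> lines_through b"
    then show ?thesis
      by (rule pmap_line[OF S b inj _ L(2)]) (use ext in blast)
  qed
  then have "extends_holomorphically_through_ball (\<lambda>z. f (S z))"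
    using test_pair pmap_smooth[OF S f] unfolding test_family_def by blast
  then obtain F where F: "continuous_on (cball 0 1) F" "\<forall>z\<in>sphere 0 1. F z = f (S z)" "holomorphic2_on F (ball 0 1)"
    unfolding extends_holomorphically_through_ball_def by blast
  have "continuous_on (cball 0 1) (\<lambda>z. F (T z))"
    by (rule continuous_on_compose2[OF F(1) pmap_continuous[OF T]]) (use ball_map_le[OF T(3)] in auto)
  moreover have "F (T z) = f z" if z: "z \<in> sphere 0 1" for z
  proof -
    have "T z \<in> sphere 0 1" using z T(3) unfolding ball_map_def by simp
    then have "F (T z) = f (S (T z))" using F(2) by blast
    then show ?thesis unfolding ST[of z, OF eq_refl[OF z[unfolded mem_sphere_0]]] .
  qed
  moreover have "holomorphic2_on (\<lambda>z. F (T z)) (ball 0 1)"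
    by (rule pmap_holomorphic2_compose[OF T F(3)])
  ultimately show "extends_holomorphically_through_ball f"
    unfolding extends_holomorphically_through_ball_def by blast
qed

section \<open>Unitary maps and ball automorphisms along an axis\<close>

definition umap :: "complex \<Rightarrow> complex \<Rightarrow> complex^2 \<Rightarrow> complex^2" where
  "umap n1 n2 z = pt (n1 * z $ 1 - cnj n2 * z $ 2) (n2 * z $ 1 + cnj n1 * z $ 2)"

lemma test_pair_umap:
  assumes n: "norm n1 ^ 2 + norm n2 ^ 2 = 1" and test_pair: "test_pair a b"
  shows "test_pair (umap n1 n2 a) (umap n1 n2 b)"
proof (rule test_pair_pmap[where dx = 1 and dy = 0 and dz = 0 and dx' = 1 and dy' = 0 and dz' = 0 and
      ax = 0 and ay = n1 and az = "- cnj n2" and ex = 0 and ey = n2 and ez = "cnj n1" and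
      ax' = 0 and ay' = "cnj n1" and az' = "cnj n2" and ex' = 0 and ey' = "- n2" and ez' = n1 and
      T = "umap (cnj n1) (- n2)" and S = "umap n1 n2" and a = a and b = b])
  have nn: "cnj n1 * n1 + cnj n2 * n2 = 1" "n1 * cnj n1 + n2 * cnj n2 = 1"
    using arg_cong[OF n, of complex_of_real] by (simp_all only: of_real_add complex_norm_square of_real_1 mult.commute)
  have norm: "norm (umap m1 m2 z) ^ 2 = norm z ^ 2" if m: "norm m1 ^ 2 + norm m2 ^ 2 = 1" for m1 m2 and z :: "complex^2"
  proof -
    have "norm (umap m1 m2 z) ^ 2 = (norm m1 ^ 2 + norm m2 ^ 2) * norm z ^ 2"
      unfolding umap_def norm_vec2 pt_nth cmod_power2 by (simp add: algebra_simps power2_eq_square)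
    then show ?thesis using m by simp
  qed
  have bm: "ball_map (umap m1 m2)" if m: "norm m1 ^ 2 + norm m2 ^ 2 = 1" for m1 m2
  proof -
    have "norm (umap m1 m2 z) = norm z" for z
      by (rule power2_eq_imp_eq[OF norm[OF m]]) simp_all
    then show ?thesis unfolding ball_map_def by simp
  qed
  show "ball_map (umap n1 n2)" by (rule bm[OF n])
  show "ball_map (umap (cnj n1) (- n2))" by (rule bm) (use n in simp)
  show "umap n1 n2 (umap (cnj n1) (- n2) z) = z" for z
  proof -
    have "n1 * (cnj n1 * x - cnj (- n2) * y) - cnj n2 * (- n2 * x + cnj (cnj n1) * y) = (n1 * cnj n1 + n2 * cnj n2) * x"
      "n2 * (cnj n1 * x - cnj (- n2) * y) + cnj n1 * (- n2 * x + cnj (cnj n1) * y) = (n1 * cnj n1 + n2 * cnj n2) * y" for x y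
      by (simp_all add: algebra_simps)
    then show ?thesis unfolding umap_def pt_nth nn by (simp add: vec_eq_iff forall_2)
  qed
  show "umap (cnj n1) (- n2) (umap n1 n2 z) = z" for z
  proof -
    have "cnj n1 * (n1 * x - cnj n2 * y) - cnj (- n2) * (n2 * x + cnj n1 * y) = (cnj n1 * n1 + cnj n2 * n2) * x"
      "- n2 * (n1 * x - cnj n2 * y) + cnj (cnj n1) * (n2 * x + cnj n1 * y) = (cnj n1 * n1 + cnj n2 * n2) * y" for x y
      by (simp_all add: algebra_simps)
    then show ?thesis unfolding umap_def pt_nth nn by (simp add: vec_eq_iff forall_2)
  qed
qed (simp_all add: umap_def pmap_def aff_def fun_eq_iff test_pair)

text \<open>The ball automorphism that carries the origin to \<open>(\<tau>, 0)\<close>. On the axis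
  \<open>z $ 2 = 0\<close> it is the disc automorphism, on the line \<open>z $ 1 = 0\<close> a
  contraction followed by a translation to \<open>z $ 1 = \<tau>\<close>.\<close>

definition mmap :: "complex \<Rightarrow> complex^2 \<Rightarrow> complex^2" where
  "mmap \<tau> z = pt ((z $ 1 + \<tau>) / (1 + cnj \<tau> * z $ 1)) (of_real (sqrt (1 - norm \<tau> ^ 2)) * z $ 2 / (1 + cnj \<tau> * z $ 1))"

lemma mmap_denominator:
  assumes "norm \<tau> < 1" "norm (z :: complex^2) \<le> 1"
  shows "1 + cnj \<tau> * z $ 1 \<noteq> 0"
proof
  assume "1 + cnj \<tau> * z $ 1 = 0"
  then have "cnj \<tau> * z $ 1 = - 1" by (simp add: add_eq_0_iff)
  then have "norm (cnj \<tau> * z $ 1) = 1" by simp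
  then have "norm \<tau> * norm (z $ 1) = 1" by (simp add: norm_mult)
  moreover have "norm (z $ 1) \<le> 1" using Finite_Cartesian_Product.norm_nth_le[of z 1] assms(2) by linarith
  then have "norm \<tau> * norm (z $ 1) \<le> norm \<tau> * 1" by (intro mult_left_mono) auto
  ultimately show False using assms(1) by simp
qed

lemma mmap_ball_map:
  assumes \<tau>: "norm \<tau> < 1"
  shows "ball_map (mmap \<tau>)"
proof -
  have \<tau>2: "norm \<tau> ^ 2 < 1" using \<tau> by (simp add: power_less_one_iff)
  have eq: "norm (mmap \<tau> z) ^ 2 = 1 - (1 - norm \<tau> ^ 2) * (1 - norm z ^ 2) / norm (1 + cnj \<tau> * z $ 1) ^ 2"
    and D: "norm (1 + cnj \<tau> * z $ 1) ^ 2 > 0" if z: "norm z \<le> 1" for z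
  proof -
    show D: "norm (1 + cnj \<tau> * z $ 1) ^ 2 > 0" using mmap_denominator[OF \<tau> z] by simp
    have "norm (z $ 1 + \<tau>) ^ 2 + (1 - norm \<tau> ^ 2) * norm (z $ 2) ^ 2 = norm (1 + cnj \<tau> * z $ 1) ^ 2 - (1 - norm \<tau> ^ 2) * (1 - norm z ^ 2)"
      unfolding norm_vec2 cmod_power2 by (simp add: algebra_simps power2_eq_square)
    moreover have "norm (mmap \<tau> z) ^ 2 = (norm (z $ 1 + \<tau>) ^ 2 + (1 - norm \<tau> ^ 2) * norm (z $ 2) ^ 2) / norm (1 + cnj \<tau> * z $ 1) ^ 2"
      unfolding mmap_def norm_pt norm_divide norm_mult power_divide power_mult_distrib norm_of_real power2_abs
      using \<tau>2 by (simp add: add_divide_distrib)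
    ultimately show "norm (mmap \<tau> z) ^ 2 = 1 - (1 - norm \<tau> ^ 2) * (1 - norm z ^ 2) / norm (1 + cnj \<tau> * z $ 1) ^ 2"
      using D by (simp add: diff_divide_distrib)
  qed
  have "norm (mmap \<tau> z) < 1" if z: "norm z < 1" for z
  proof -
    have "norm z ^ 2 < 1" using z by (simp add: power_less_one_iff)
    then have "(1 - norm \<tau> ^ 2) * (1 - norm z ^ 2) / norm (1 + cnj \<tau> * z $ 1) ^ 2 > 0"
      using \<tau>2 D[OF less_imp_le[OF z]] by (intro divide_pos_pos mult_pos_pos) auto
    then have "norm (mmap \<tau> z) ^ 2 < 1 ^ 2" using eq[OF less_imp_le[OF z]] by simp
    then show ?thesis by (rule power_less_imp_less_base) simp
  qed
  moreover have "norm (mmap \<tau> z) = 1" if z: "norm z = 1" for z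
  proof -
    have "norm (mmap \<tau> z) ^ 2 = 1 ^ 2" using eq[of z] z by simp
    then show ?thesis by (rule power2_eq_imp_eq) simp_all
  qed
  ultimately show ?thesis unfolding ball_map_def by blast
qed

lemma mmap_inverse:
  assumes \<tau>: "norm \<tau> < 1" and z: "norm z \<le> 1"
  shows "mmap (- \<tau>) (mmap \<tau> z) = z"
proof -
  have D: "1 + cnj \<tau> * z $ 1 \<noteq> 0" by (rule mmap_denominator[OF \<tau> z])
  define D' where "D' = 1 + cnj \<tau> * z $ 1"
  define m where "m = complex_of_real (sqrt (1 - norm \<tau> ^ 2))"
  have \<tau>2: "norm \<tau> ^ 2 < 1" using \<tau> by (simp add: power_less_one_iff)
  have mm: "m * m = 1 - \<tau> * cnj \<tau>"
  proof -
    have "m * m = of_real (1 - norm \<tau> ^ 2)" unfolding m_def of_real_mult[symmetric] using \<tau>2 by simp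
    then show ?thesis by (simp only: of_real_diff of_real_1 complex_norm_square)
  qed
  have m0: "m \<noteq> 0" unfolding m_def using \<tau>2 by simp
  have den: "1 + cnj (- \<tau>) * ((z $ 1 + \<tau>) / D') = m * m / D'"
    unfolding mm using D unfolding D'_def by (simp add: field_simps)
  have num: "(z $ 1 + \<tau>) / D' + - \<tau> = m * m * z $ 1 / D'"
    unfolding mm using D unfolding D'_def by (simp add: field_simps)
  show ?thesis
    unfolding mmap_def pt_nth norm_minus_cancel m_def[symmetric] D'_def[symmetric] den num
    using D m0 unfolding D'_def[symmetric] by (simp add: vec_eq_iff forall_2)
qed

lemma test_pair_mmap:
  assumes \<tau>: "norm \<tau> < 1" and a: "1 + cnj \<tau> * a $ 1 \<noteq> 0" and b: "1 + cnj \<tau> * b $ 1 \<noteq> 0" and test_pair: "test_pair a b"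
  shows "test_pair (mmap \<tau> a) (mmap \<tau> b)"
proof (rule test_pair_pmap[where dx = 1 and dy = "cnj \<tau>" and dz = 0 and dx' = 1 and dy' = "cnj (- \<tau>)" and dz' = 0 and
      ax = \<tau> and ay = 1 and az = 0 and ex = 0 and ey = 0 and ez = "of_real (sqrt (1 - norm \<tau> ^ 2))" and
      ax' = "- \<tau>" and ay' = 1 and az' = 0 and ex' = 0 and ey' = 0 and ez' = "of_real (sqrt (1 - norm (- \<tau>) ^ 2))" and
      T = "mmap (- \<tau>)" and S = "mmap \<tau>" and a = a and b = b])
  have \<tau>': "norm (- \<tau>) < 1" using \<tau> by simp
  show "ball_map (mmap \<tau>)" "ball_map (mmap (- \<tau>))" by (rule mmap_ball_map[OF \<tau>], rule mmap_ball_map[OF \<tau>'])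
  show "mmap (- \<tau>) (mmap \<tau> z) = z" if "norm z \<le> 1" for z by (rule mmap_inverse[OF \<tau> that])
  show "mmap \<tau> (mmap (- \<tau>) z) = z" if "norm z \<le> 1" for z using mmap_inverse[OF \<tau>' that] by simp
  show "\<forall>z. norm z \<le> 1 \<longrightarrow> aff 1 (cnj \<tau>) 0 z \<noteq> 0" using mmap_denominator[OF \<tau>] by (simp add: aff_def)
  show "\<forall>z. norm z \<le> 1 \<longrightarrow> aff 1 (cnj (- \<tau>)) 0 z \<noteq> 0" using mmap_denominator[OF \<tau>'] by (simp add: aff_def)
  show "mmap \<tau> = pmap (aff \<tau> 1 0) (aff 0 0 (of_real (sqrt (1 - norm \<tau> ^ 2)))) (aff 1 (cnj \<tau>) 0)"
    by (simp add: mmap_def pmap_def aff_def fun_eq_iff add.commute)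
  show "mmap (- \<tau>) = pmap (aff (- \<tau>) 1 0) (aff 0 0 (of_real (sqrt (1 - norm (- \<tau>) ^ 2)))) (aff 1 (cnj (- \<tau>)) 0)"
    by (simp add: mmap_def pmap_def aff_def fun_eq_iff)
  show "aff 1 (cnj \<tau>) 0 a \<noteq> 0" "aff 1 (cnj \<tau>) 0 b \<noteq> 0" using a b by (simp_all add: aff_def)
qed (rule test_pair)

section \<open>From special pairs of base points to arbitrary ones\<close>

lemma ext_pencil_of_lines:
  assumes ext: "\<And>L. L \<in> lines_through (pt (of_real \<gamma>) 0) \<Longrightarrow> L \<inter> ball 0 1 \<noteq> {} \<Longrightarrow> extends_holomorphically_along f L"
  shows "ext_pencil \<gamma> f"
  unfolding ext_pencil_def
proof (intro ballI allI impI)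
  fix s and c :: complex assume s: "s \<in> {start \<gamma><..<1}" and c: "norm c ^ 2 = (1 - s) / s"
  have s0: "s > 0" "s \<in> {start \<gamma>..1}" "s \<in> {start \<gamma><..1}" using s start_bounds(1)[of \<gamma>] by auto
  define m where "m = complex_of_real ((1 - s) * \<gamma>)"
  define r where "r = rad \<gamma> s"
  define v where "v = pt 1 c"
  \<comment> \<open>The point of the line over \<open>z $ 1 = 0\<close>; with it the parameter of
    the line is the coordinate \<open>z $ 1\<close>.\<close>
  define p where "p = pt 0 (- c * of_real \<gamma>)"
  define L where "L = range (\<lambda>\<zeta>. p + \<zeta> *s v)"
  have r: "r > 0" unfolding r_def by (rule rad_pos[OF s0(3)])
  have r2: "rad2 \<gamma> s = r ^ 2" unfolding r_def rad_sq[OF s0(2)] ..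
  have pv: "p + \<zeta> *s v = pt \<zeta> (c * (\<zeta> - of_real \<gamma>))" for \<zeta>
    unfolding p_def v_def by (simp add: vec_eq_iff forall_2 algebra_simps)
  have eq: "norm \<zeta> ^ 2 + norm (c * (\<zeta> - of_real \<gamma>)) ^ 2 = 1 + (norm (\<zeta> - m) ^ 2 - r ^ 2) / s" for \<zeta>
    unfolding m_def r2[symmetric] by (rule circle_equation[OF s0(1) c])
  have le: "norm (pt \<zeta> (c * (\<zeta> - of_real \<gamma>))) \<le> 1 \<longleftrightarrow> norm (\<zeta> - m) \<le> r" for \<zeta>
    unfolding norm_pt_le_1 eq using s0(1) r power_mono_iff[of "norm (\<zeta> - m)" r 2] by (simp add: divide_le_0_iff)
  have less: "norm (pt \<zeta> (c * (\<zeta> - of_real \<gamma>))) < 1 \<longleftrightarrow> norm (\<zeta> - m) < r" for \<zeta>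
    unfolding norm_pt_less_1 eq using s0(1) r power_mono_iff[of r "norm (\<zeta> - m)" 2] by (simp add: zero_le_divide_iff not_le[symmetric])
  have v0: "v \<noteq> 0" unfolding v_def by (simp add: vec_eq_iff forall_2)
  have mem: "pt \<zeta> (c * (\<zeta> - of_real \<gamma>)) \<in> L" for \<zeta>
    unfolding pv[symmetric] L_def by (rule rangeI)
  have "pt (of_real \<gamma>) 0 \<in> L" using mem[of "of_real \<gamma>"] by simp
  then have "L \<in> lines_through (pt (of_real \<gamma>) 0)"
    unfolding lines_through_def complex_line_def L_def using v0 by blast
  moreover have "pt m (c * (m - of_real \<gamma>)) \<in> L \<inter> ball 0 1"
    using mem[of m] less[of m] r by simp
  ultimately obtain g where g: "continuous_on (L \<inter> cball 0 1) g" "\<forall>z\<in>L \<inter> sphere 0 1. g z = f z"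
    "holomorphic_on_line g L (L \<inter> ball 0 1)"
    using ext[of L] unfolding extends_holomorphically_along_def by blast
  have 1: "continuous_on (cball m r) (\<lambda>z. g (pt z (c * (z - of_real \<gamma>))))"
  proof (rule continuous_on_compose2[OF g(1)])
    show "continuous_on (cball m r) (\<lambda>z. pt z (c * (z - of_real \<gamma>)))"
      by (intro continuous_on_pt continuous_on_mult continuous_on_diff continuous_on_const continuous_on_id)
    show "(\<lambda>z. pt z (c * (z - of_real \<gamma>))) ` cball m r \<subseteq> L \<inter> cball 0 1"
      using mem le by (auto simp: dist_norm norm_minus_commute)
  qed
  have "(\<lambda>\<zeta>. g (p + \<zeta> *s v)) holomorphic_on {\<zeta>. p + \<zeta> *s v \<in> L \<inter> ball 0 1}"
    using holomorphic_on_line_iff[OF v0 L_def] g(3) by blast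
  moreover have "{\<zeta>. p + \<zeta> *s v \<in> L \<inter> ball 0 1} = ball m r"
    unfolding pv using mem less by (auto simp: dist_norm norm_minus_commute)
  ultimately have 2: "(\<lambda>z. g (pt z (c * (z - of_real \<gamma>)))) holomorphic_on ball m r"
    unfolding pv by simp
  have 3: "\<forall>z. norm (z - m) = r \<longrightarrow> g (pt z (c * (z - of_real \<gamma>))) = f (pt z (c * (z - of_real \<gamma>)))"
  proof (intro allI impI)
    fix z assume "norm (z - m) = r"
    then have "norm (pt z (c * (z - of_real \<gamma>))) = 1" unfolding norm_pt_eq_1 eq by simp
    then show "g (pt z (c * (z - of_real \<gamma>))) = f (pt z (c * (z - of_real \<gamma>)))"
      using g(2) mem[of z] by simp
  qed
  from 1 2 3 show "\<exists>G. continuous_on (cball (of_real ((1 - s) * \<gamma>)) (rad \<gamma> s)) G \<and>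
          G holomorphic_on ball (of_real ((1 - s) * \<gamma>)) (rad \<gamma> s) \<and>
          (\<forall>z. norm (z - of_real ((1 - s) * \<gamma>)) = rad \<gamma> s \<longrightarrow> G z = f (pt z (c * (z - of_real \<gamma>))))"
    unfolding m_def[symmetric] r_def[symmetric] by blast
qed

lemma test_pair_real:
  fixes \<alpha> \<beta> :: real
  assumes "\<beta> < 0" "0 < \<alpha>"
  shows "test_pair (pt (of_real \<alpha>) 0) (pt (of_real \<beta>) 0)"
  unfolding test_family_def
proof (intro allI impI, elim conjE)
  fix f assume f: "smooth_on_sphere f"
    and ext: "\<forall>L\<in>lines_through (pt (of_real \<alpha>) 0) \<union> lines_through (pt (of_real \<beta>) 0). L \<inter> ball 0 1 \<noteq> {} \<longrightarrow> extends_holomorphically_along f L"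
  have "ext_pencil \<alpha> f" by (rule ext_pencil_of_lines) (use ext in blast)
  moreover have "ext_pencil \<beta> f" by (rule ext_pencil_of_lines) (use ext in blast)
  ultimately show "extends_holomorphically_through_ball f"
    by (rule ext_pencil_imp_extends[OF assms f])
qed

lemma one_minus_mult_cnj_nonzero:
  fixes \<tau> :: complex
  assumes "norm \<tau> < 1"
  shows "1 - \<tau> * cnj \<tau> \<noteq> 0"
proof
  assume "1 - \<tau> * cnj \<tau> = 0"
  then have "\<tau> * cnj \<tau> = 1" by simp
  then have "norm (\<tau> * cnj \<tau>) = 1" by simp
  then have "norm \<tau> ^ 2 = 1 ^ 2" by (simp add: norm_mult power2_eq_square)
  then have "norm \<tau> = 1" by (rule power2_eq_imp_eq) simp_all
  then show False using assms by simp
qed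

text \<open>Disc automorphisms commute with the reflection in the unit circle. If the reflected
  point comes from \<open>e * t\<close> with \<open>norm e = 1\<close>, then \<open>z\<close> itself
  comes from \<open>e / t\<close>, with a parameter of the same sign.\<close>

lemma moebius_preimage:
  fixes \<tau> z z0 e :: complex and t :: real
  assumes \<tau>: "norm \<tau> < 1" and e: "norm e = 1" and t: "t \<noteq> 0"
    and w: "e * of_real t * (1 - cnj \<tau> * z0) = z0 - \<tau>" and nz: "1 - cnj \<tau> * z0 \<noteq> 0"
    and z: "z0 = (if norm z \<le> 1 then z else 1 / cnj z)"
  shows "\<exists>r::real. sgn r = sgn t \<and> 1 + cnj \<tau> * (e * of_real r) \<noteq> 0 \<and>
    (e * of_real r + \<tau>) / (1 + cnj \<tau> * (e * of_real r)) = z"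
proof -
  define W where "W = e * of_real t"
  have w': "W * (1 - cnj \<tau> * z0) = z0 - \<tau>" using w unfolding W_def .
  have e0: "e \<noteq> 0" using e by auto
  have ee: "e * cnj e = 1" using complex_norm_square[of e] e by simp
  have W0: "W \<noteq> 0" unfolding W_def using e0 t by simp
  have "(1 + cnj \<tau> * W) * (1 - cnj \<tau> * z0) = 1 - cnj \<tau> * z0 + cnj \<tau> * (W * (1 - cnj \<tau> * z0))"
    by (simp add: algebra_simps)
  also have "\<dots> = 1 - \<tau> * cnj \<tau>" unfolding w' by (simp add: algebra_simps)
  finally have A: "(1 + cnj \<tau> * W) * (1 - cnj \<tau> * z0) = 1 - \<tau> * cnj \<tau>" .
  then have D: "1 + cnj \<tau> * W \<noteq> 0" using one_minus_mult_cnj_nonzero[OF \<tau>] by auto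
  have "(W + \<tau>) * (1 - cnj \<tau> * z0) = W * (1 - cnj \<tau> * z0) + \<tau> - \<tau> * cnj \<tau> * z0"
    by (simp add: algebra_simps)
  also have "\<dots> = z0 * (1 - \<tau> * cnj \<tau>)" unfolding w' by (simp add: algebra_simps)
  also have "\<dots> = z0 * (1 + cnj \<tau> * W) * (1 - cnj \<tau> * z0)" unfolding A[symmetric] by (simp only: mult.assoc)
  finally have B: "W + \<tau> = z0 * (1 + cnj \<tau> * W)" using nz by simp
  show ?thesis
  proof (cases "norm z \<le> 1")
    case True
    then have "z0 = z" using z by simp
    then show ?thesis using B D unfolding W_def by (intro exI[of _ t]) simp
  next
    case False
    then have z0: "z0 = 1 / cnj z" and "z \<noteq> 0" using z by auto
    then have zz: "z0 \<noteq> 0" "cnj z0 = 1 / z" by simp_all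
    have W': "e * of_real (1 / t) = 1 / cnj W"
      unfolding W_def using ee e0 t by (simp add: field_simps)
    have B': "cnj W + cnj \<tau> = cnj z0 * (1 + \<tau> * cnj W)" using arg_cong[OF B, of cnj] by simp
    have D': "1 + \<tau> * cnj W \<noteq> 0" using arg_cong[of _ _ cnj] D
      by (metis complex_cnj_add complex_cnj_cnj complex_cnj_mult complex_cnj_one complex_cnj_zero)
    have "1 + cnj \<tau> * (1 / cnj W) = (cnj W + cnj \<tau>) / cnj W" using W0 by (simp add: field_simps)
    also have "\<dots> \<noteq> 0" unfolding B' using W0 D' zz(1) by simp
    finally have 1: "1 + cnj \<tau> * (1 / cnj W) \<noteq> 0" .
    have "1 / cnj W + \<tau> = (1 + \<tau> * cnj W) / cnj W" using W0 by (simp add: field_simps)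
    also have "\<dots> = z * ((cnj W + cnj \<tau>) / cnj W)" unfolding B' zz(2) using \<open>z \<noteq> 0\<close> by simp
    also have "(cnj W + cnj \<tau>) / cnj W = 1 + cnj \<tau> * (1 / cnj W)" using W0 by (simp add: field_simps)
    finally have "(1 / cnj W + \<tau>) / (1 + cnj \<tau> * (1 / cnj W)) = z" using 1 by simp
    then show ?thesis using 1 by (intro exI[of _ "1 / t"]) (simp add: W'[simplified] sgn_if)
  qed
qed

text \<open>Points outside the disc are replaced by their reflections, and the condition on
  \<open>\<alpha> * cnj \<beta>\<close> keeps the two resulting points \<open>a\<close> and
  \<open>b\<close> apart. A disc automorphism then moves them to opposite sides of 0 on one
  diameter.\<close>

lemma test_pair_axis:
  fixes \<alpha> \<beta> :: complex
  assumes ne: "\<alpha> \<noteq> \<beta>" and dual: "norm \<alpha> < 1 \<or> norm \<beta> < 1 \<Longrightarrow> \<alpha> * cnj \<beta> \<noteq> 1"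
  shows "test_pair (pt \<alpha> 0) (pt \<beta> 0)"
proof -
  define red where "red z = (if norm z \<le> 1 then z else 1 / cnj z)" for z :: complex
  define a where "a = red \<alpha>"
  define b where "b = red \<beta>"
  have red1: "norm (red z) \<le> 1" for z
    by (auto simp: red_def norm_divide divide_le_eq_1)
  have a1: "norm a ^ 2 \<le> 1" and b1: "norm b ^ 2 \<le> 1"
    unfolding a_def b_def by (simp_all add: red1 power_le_one)
  have mixed: "z * cnj w = 1 \<and> norm z < 1" if "norm z \<le> 1" "\<not> norm w \<le> 1" "z = 1 / cnj w" for z w :: complex
  proof
    have "w \<noteq> 0" using that(2) by auto
    then show "z * cnj w = 1" using that(3) by simp
    show "norm z < 1" unfolding that(3) using that(2) by (auto simp: norm_divide divide_less_eq_1 not_le)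
  qed
  have ab: "a \<noteq> b"
  proof
    assume eq: "a = b"
    consider "norm \<alpha> \<le> 1" "norm \<beta> \<le> 1" | "\<not> norm \<alpha> \<le> 1" "\<not> norm \<beta> \<le> 1"
      | "norm \<alpha> \<le> 1" "\<not> norm \<beta> \<le> 1" | "\<not> norm \<alpha> \<le> 1" "norm \<beta> \<le> 1" by blast
    then show False
    proof cases
      case 1
      then show False using eq ne by (simp add: a_def b_def red_def)
    next
      case 2
      then have "1 / cnj \<alpha> = 1 / cnj \<beta>" using eq by (simp add: a_def b_def red_def)
      then show False using ne by simp
    next
      case 3
      then have "\<alpha> = 1 / cnj \<beta>" using eq by (simp add: a_def b_def red_def)
      then show False using mixed[OF 3] dual by blast
    next
      case 4
      then have "\<beta> = 1 / cnj \<alpha>" using eq by (simp add: a_def b_def red_def)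
      then have m: "\<beta> * cnj \<alpha> = 1" "norm \<beta> < 1" using mixed[OF 4(2,1)] by blast+
      from arg_cong[OF m(1), of cnj] have "\<alpha> * cnj \<beta> = 1" by (simp add: mult.commute)
      then show False using m(2) dual by blast
    qed
  qed
  define k where "k = 1 - a * cnj b"
  define N where "N = norm k"
  have "N ^ 2 = norm (a - b) ^ 2 + (1 - norm a ^ 2) * (1 - norm b ^ 2)"
    unfolding N_def k_def cmod_power2 by (simp add: algebra_simps power2_eq_square)
  moreover have "norm (a - b) ^ 2 > 0" using ab by simp
  moreover have "(1 - norm a ^ 2) * (1 - norm b ^ 2) \<ge> 0" using a1 b1 by (intro mult_nonneg_nonneg) auto
  ultimately have "N ^ 2 > 0" by linarith
  then have N: "N > 0" unfolding N_def by simp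
  define \<omega> where "\<omega> = k / of_real N"
  have \<omega>1: "norm \<omega> = 1" unfolding \<omega>_def norm_divide using N by (simp add: N_def)
  have \<omega>\<omega>: "\<omega> * cnj \<omega> = 1" using complex_norm_square[of \<omega>] \<omega>1 by simp
  have k: "k = of_real N * \<omega>" unfolding \<omega>_def using N by simp
  have ck: "cnj k = of_real N * cnj \<omega>" unfolding k by simp
  have "norm (a * cnj b) \<le> 1 * 1"
    unfolding norm_mult complex_mod_cnj a_def b_def by (intro mult_mono red1) auto
  then have "Re k \<ge> 0" unfolding k_def using complex_Re_le_cmod[of "a * cnj b"] by simp
  then have "Re \<omega> \<ge> 0" unfolding \<omega>_def using N by simp
  then have w0: "1 + \<omega> \<noteq> 0" by (auto simp: complex_eq_iff)
  have cw: "1 + cnj \<omega> = (1 + \<omega>) / \<omega>" using \<omega>\<omega> w0 by (cases "\<omega> = 0") (auto simp: field_simps)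
  have cw0: "1 + cnj \<omega> \<noteq> 0" using w0 by (metis complex_cnj_add complex_cnj_one complex_cnj_zero_iff)
  \<comment> \<open>In homogeneous coordinates the Hermitian form preserved by disc automorphisms
    takes the value \<open>k\<close> on \<open>(a, 1)\<close> and \<open>(b, 1)\<close>. The phase
    \<open>\<omega>\<close> makes its value on \<open>(a, 1)\<close> and \<open>\<omega>\<close>
    times \<open>(b, 1)\<close> the positive number \<open>N\<close>; the sum of these two vectors
    then represents a point strictly between \<open>a\<close> and \<open>b\<close> on the hyperbolic
    line through them, possibly with ideal endpoints.\<close>
  define \<tau> where "\<tau> = (a + \<omega> * b) / (1 + \<omega>)"
  have c\<tau>: "cnj \<tau> = (cnj a + cnj \<omega> * cnj b) / (1 + cnj \<omega>)" unfolding \<tau>_def by simp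
  have "norm (1 + \<omega>) ^ 2 - norm (a + \<omega> * b) ^ 2 = (1 - norm a ^ 2) + norm \<omega> ^ 2 * (1 - norm b ^ 2) + 2 * Re (cnj \<omega> * k)"
    unfolding k_def cmod_power2 by (simp add: algebra_simps power2_eq_square)
  also have "cnj \<omega> * k = of_real N" unfolding k using \<omega>\<omega> by (simp add: mult.left_commute mult.commute)
  finally have "norm (a + \<omega> * b) ^ 2 < norm (1 + \<omega>) ^ 2" using a1 b1 N \<omega>1 by simp
  then have "norm (a + \<omega> * b) < norm (1 + \<omega>)" by (rule power_less_imp_less_base) simp
  then have \<tau>: "norm \<tau> < 1" unfolding \<tau>_def norm_divide using w0 by simp
  \<comment> \<open>The automorphism that sends \<open>\<tau>\<close> to 0 sends \<open>a\<close> to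
    \<open>(a - b) / Xa\<close> and \<open>b\<close> to \<open>- (a - b) / Xb\<close>. Since
    \<open>Xa\<close> and \<open>Xb\<close> are positive, the images lie on opposite rays.\<close>
  define Xa where "Xa = 1 - norm a ^ 2 + N"
  define Xb where "Xb = 1 - norm b ^ 2 + N"
  have X: "Xa > 0" "Xb > 0" unfolding Xa_def Xb_def using a1 b1 N by auto
  have Xa: "complex_of_real Xa = 1 - a * cnj a + cnj \<omega> * k" and Xb: "complex_of_real Xb = 1 - b * cnj b + \<omega> * cnj k"
    unfolding Xa_def Xb_def ck k using \<omega>\<omega> by (simp_all add: complex_norm_square[symmetric] mult.left_commute mult.commute)
  define D where "D = norm (a - b)"
  have D: "D > 0" unfolding D_def using ab by simp
  define e where "e = (a - b) / of_real D"
  have e1: "norm e = 1" unfolding e_def norm_divide using D by (simp add: D_def)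
  have w00: "\<omega> \<noteq> 0" using \<omega>1 by auto
  have A1: "1 - cnj \<tau> * a = \<omega> * of_real Xa / (1 + \<omega>)"
  proof -
    have "1 - cnj \<tau> * a = ((1 + cnj \<omega>) - (cnj a + cnj \<omega> * cnj b) * a) / (1 + cnj \<omega>)"
      unfolding c\<tau> using cw0 by (simp add: diff_divide_distrib)
    also have "(1 + cnj \<omega>) - (cnj a + cnj \<omega> * cnj b) * a = of_real Xa"
      unfolding Xa k_def by (simp add: algebra_simps)
    finally show ?thesis unfolding cw using w00 by simp
  qed
  have A2: "1 - cnj \<tau> * b = of_real Xb / (1 + \<omega>)"
  proof -
    have "1 - cnj \<tau> * b = ((1 + cnj \<omega>) - (cnj a + cnj \<omega> * cnj b) * b) / (1 + cnj \<omega>)"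
      unfolding c\<tau> using cw0 by (simp add: diff_divide_distrib)
    also have "(1 + cnj \<omega>) - (cnj a + cnj \<omega> * cnj b) * b = cnj \<omega> * (1 - b * cnj b) + cnj k"
      unfolding k_def by (simp add: algebra_simps)
    also have "\<dots> = cnj \<omega> * (1 - b * cnj b) + (\<omega> * cnj \<omega>) * cnj k" unfolding \<omega>\<omega> by simp
    also have "\<dots> = cnj \<omega> * of_real Xb" unfolding Xb by (simp add: algebra_simps)
    also have "cnj \<omega> * of_real Xb / (1 + cnj \<omega>) = (\<omega> * cnj \<omega>) * of_real Xb / (1 + \<omega>)"
      unfolding cw using w00 by (simp add: mult_ac)
    finally show ?thesis unfolding \<omega>\<omega> by simp
  qed
  have B1: "a - \<tau> = \<omega> * (a - b) / (1 + \<omega>)" and B2: "b - \<tau> = - (a - b) / (1 + \<omega>)"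
    unfolding \<tau>_def using w0 by (simp_all add: field_simps)
  have "\<exists>r::real. sgn r = sgn (D / Xa) \<and> 1 + cnj \<tau> * (e * of_real r) \<noteq> 0 \<and>
    (e * of_real r + \<tau>) / (1 + cnj \<tau> * (e * of_real r)) = \<alpha>"
  proof (rule moebius_preimage[OF \<tau> e1, where ?z0.0 = a])
    show "e * of_real (D / Xa) * (1 - cnj \<tau> * a) = a - \<tau>"
      unfolding A1 B1 e_def using D X by simp
    show "1 - cnj \<tau> * a \<noteq> 0" unfolding A1 using w00 w0 X by simp
  qed (use D X in \<open>simp_all add: a_def red_def\<close>)
  then obtain r1 where r1: "sgn r1 = sgn (D / Xa)" "1 + cnj \<tau> * (e * of_real r1) \<noteq> 0"
    "(e * of_real r1 + \<tau>) / (1 + cnj \<tau> * (e * of_real r1)) = \<alpha>" by blast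
  have "\<exists>r::real. sgn r = sgn (- (D / Xb)) \<and> 1 + cnj \<tau> * (e * of_real r) \<noteq> 0 \<and>
    (e * of_real r + \<tau>) / (1 + cnj \<tau> * (e * of_real r)) = \<beta>"
  proof (rule moebius_preimage[OF \<tau> e1, where ?z0.0 = b])
    show "e * of_real (- (D / Xb)) * (1 - cnj \<tau> * b) = b - \<tau>"
      unfolding A2 B2 e_def using D X by simp
    show "1 - cnj \<tau> * b \<noteq> 0" unfolding A2 using w0 X by simp
  qed (use D X in \<open>simp_all add: b_def red_def\<close>)
  then obtain r2 where r2: "sgn r2 = sgn (- (D / Xb))" "1 + cnj \<tau> * (e * of_real r2) \<noteq> 0"
    "(e * of_real r2 + \<tau>) / (1 + cnj \<tau> * (e * of_real r2)) = \<beta>" by blast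
  have "D / Xa > 0" "D / Xb > 0" using D X by simp_all
  then have "r2 < 0" "0 < r1" using r1(1) r2(1) by (auto simp: sgn_if split: if_splits)
  then have "test_pair (umap e 0 (pt (of_real r1) 0)) (umap e 0 (pt (of_real r2) 0))"
    by (intro test_pair_umap test_pair_real) (simp add: e1)
  then have g: "test_pair (pt (e * of_real r1) 0) (pt (e * of_real r2) 0)"
    by (simp only: umap_def pt_nth mult_zero_left mult_zero_right complex_cnj_zero diff_0_right add_0)
  have "test_pair (mmap \<tau> (pt (e * of_real r1) 0)) (mmap \<tau> (pt (e * of_real r2) 0))"
    by (rule test_pair_mmap[OF \<tau> _ _ g]) (use r1(2) r2(2) in simp_all)
  then show ?thesis
    by (simp only: mmap_def pt_nth r1(3) r2(3) mult_zero_right div_0)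
qed

text \<open>In unitary coordinates \<open>u\<close>, \<open>x\<close> the line through
  \<open>a\<close> and \<open>b\<close> is a line of constant \<open>u\<close>. As it meets the
  ball, the constant has modulus less than 1, and \<open>mmap\<close> takes the axis
  \<open>u = 0\<close> to this line with scale \<open>\<mu>\<close>. The duality condition is
  preserved because \<open>hermitian_inner a b - 1\<close> equals
  \<open>x a * cnj (x b) - \<mu>\<^sup>2\<close>.\<close>

lemma test_family_two_pencils:
  assumes ab: "a \<noteq> b" and meet: "line_joining a b \<inter> ball 0 1 \<noteq> {}"
    and dual: "a \<in> ball 0 1 \<or> b \<in> ball 0 1 \<Longrightarrow> hermitian_inner a b \<noteq> 1"
  shows "test_family (lines_through a \<union> lines_through b)"
proof -
  define l where "l = norm (b - a)"
  have l: "l > 0" unfolding l_def using ab by simp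
  define m1 where "m1 = (b $ 1 - a $ 1) / of_real l"
  define m2 where "m2 = (b $ 2 - a $ 2) / of_real l"
  have b1: "b $ 1 = a $ 1 + of_real l * m1" and b2: "b $ 2 = a $ 2 + of_real l * m2"
    unfolding m1_def m2_def using l by simp_all
  have "norm (b - a) ^ 2 = (norm m1 ^ 2 + norm m2 ^ 2) * l ^ 2"
    unfolding norm_vec2 vector_minus_component b1 b2 by (simp add: norm_mult power_mult_distrib distrib_right distrib_left mult.commute)
  then have "l ^ 2 = (norm m1 ^ 2 + norm m2 ^ 2) * l ^ 2" unfolding l_def .
  then have m: "norm m1 ^ 2 + norm m2 ^ 2 = 1" using l by simp
  have mm: "m1 * cnj m1 + m2 * cnj m2 = 1"
    using arg_cong[OF m, of complex_of_real] by (simp only: of_real_add complex_norm_square of_real_1)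
  define u where "u z = m2 * z $ 1 - m1 * z $ 2" for z :: "complex^2"
  define x where "x z = cnj m1 * z $ 1 + cnj m2 * z $ 2" for z :: "complex^2"
  have inner: "hermitian_inner z w = u z * cnj (u w) + x z * cnj (x w)" for z w
  proof -
    have "u z * cnj (u w) + x z * cnj (x w) = (m1 * cnj m1 + m2 * cnj m2) * hermitian_inner z w"
      unfolding u_def x_def hermitian_inner_def by (simp add: algebra_simps)
    then show ?thesis unfolding mm by simp
  qed
  have norm: "norm z ^ 2 = norm (u z) ^ 2 + norm (x z) ^ 2" for z
  proof -
    have "complex_of_real (norm z ^ 2) = hermitian_inner z z"
      unfolding norm_vec2 hermitian_inner_def of_real_add complex_norm_square ..
    also have "\<dots> = complex_of_real (norm (u z) ^ 2 + norm (x z) ^ 2)"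
      unfolding inner of_real_add complex_norm_square ..
    finally show ?thesis by (simp only: of_real_eq_iff)
  qed
  have line: "u (a + \<zeta> *s (b - a)) = u a" for \<zeta>
    unfolding u_def vector_add_component vector_smult_component vector_minus_component b1 b2 by (simp add: algebra_simps)
  have ub: "u b = u a" unfolding u_def b1 b2 by (simp add: algebra_simps)
  have "x b = x a + of_real l * (m1 * cnj m1 + m2 * cnj m2)" unfolding x_def b1 b2 by (simp add: algebra_simps)
  then have xb: "x b = x a + of_real l" unfolding mm by simp
  obtain \<zeta> where "norm (a + \<zeta> *s (b - a)) < 1"
    using meet unfolding line_joining_def by auto
  then have "norm (a + \<zeta> *s (b - a)) ^ 2 < 1" by (simp add: power_less_one_iff)
  then have u2: "norm (u a) ^ 2 < 1" using norm[of "a + \<zeta> *s (b - a)"] unfolding line by (smt (verit) zero_le_power2)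
  then have u1: "norm (u a) < 1" using power_less_imp_less_base[of "norm (u a)" 2 1] by simp
  define \<mu> where "\<mu> = sqrt (1 - norm (u a) ^ 2)"
  have \<mu>: "\<mu> > 0" unfolding \<mu>_def using u2 by simp
  have \<mu>2: "\<mu> ^ 2 = 1 - norm (u a) ^ 2" unfolding \<mu>_def using u2 by simp
  have ball: "z \<in> ball 0 1" if "norm (x z / of_real \<mu>) < 1" "u z = u a" for z
  proof -
    have "norm (x z) < \<mu>" using that(1) \<mu> by (simp add: norm_divide)
    then have "norm (x z) ^ 2 < \<mu> ^ 2" by (intro power_strict_mono) auto
    then have "norm z ^ 2 < 1 ^ 2" unfolding norm[of z] \<mu>2 that(2) by simp
    then have "norm z < 1" by (rule power_less_imp_less_base) simp
    then show ?thesis by simp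
  qed
  have "test_pair (pt (x a / of_real \<mu>) 0) (pt (x b / of_real \<mu>) 0)"
  proof (rule test_pair_axis)
    show "x a / of_real \<mu> \<noteq> x b / of_real \<mu>" unfolding xb using l \<mu> by (simp add: add_divide_distrib)
    assume "norm (x a / of_real \<mu>) < 1 \<or> norm (x b / of_real \<mu>) < 1"
    then have "hermitian_inner a b \<noteq> 1" using ball[of a] ball[of b] ub dual by blast
    then have ne: "x a * cnj (x b) \<noteq> 1 - u a * cnj (u a)" unfolding inner ub by (auto simp: algebra_simps)
    have "x a / of_real \<mu> * cnj (x b / of_real \<mu>) = x a * cnj (x b) / of_real (\<mu> ^ 2)"
      by (simp add: power2_eq_square)
    also have "\<dots> \<noteq> 1"
    proof
      assume "x a * cnj (x b) / of_real (\<mu> ^ 2) = 1"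
      then have "x a * cnj (x b) = of_real (\<mu> ^ 2)" using \<mu> by (simp add: divide_eq_1_iff)
      also have "\<dots> = 1 - u a * cnj (u a)" unfolding \<mu>2 of_real_diff complex_norm_square of_real_1 ..
      finally show False using ne by blast
    qed
    finally show "x a / of_real \<mu> * cnj (x b / of_real \<mu>) \<noteq> 1" .
  qed
  then have "test_pair (umap 0 1 (pt (x a / of_real \<mu>) 0)) (umap 0 1 (pt (x b / of_real \<mu>) 0))"
    by (intro test_pair_umap) simp
  then have g1: "test_pair (pt 0 (x a / of_real \<mu>)) (pt 0 (x b / of_real \<mu>))"
    by (simp only: umap_def pt_nth mult_zero_left mult_zero_right complex_cnj_zero diff_0_right add_0_right mult_1)
  have "test_pair (mmap (u a) (pt 0 (x a / of_real \<mu>))) (mmap (u a) (pt 0 (x b / of_real \<mu>)))"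
    by (rule test_pair_mmap[OF u1 _ _ g1]) simp_all
  moreover have "mmap (u a) (pt 0 (w / of_real \<mu>)) = pt (u a) w" for w
    unfolding mmap_def pt_nth \<mu>_def[symmetric] using \<mu> by (simp add: vec_eq_iff forall_2)
  ultimately have g2: "test_pair (pt (u a) (x a)) (pt (u b) (x b))" unfolding ub by (simp only:)
  have "umap (cnj m2) (- cnj m1) (pt (u z) (x z)) = z" for z
  proof -
    have "cnj m2 * u z - cnj (- cnj m1) * x z = (m1 * cnj m1 + m2 * cnj m2) * z $ 1"
      "- cnj m1 * u z + cnj (cnj m2) * x z = (m1 * cnj m1 + m2 * cnj m2) * z $ 2"
      unfolding u_def x_def by (simp_all add: algebra_simps)
    then show ?thesis unfolding umap_def pt_nth mm by (simp add: vec_eq_iff forall_2)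
  qed
  moreover have "test_pair (umap (cnj m2) (- cnj m1) (pt (u a) (x a))) (umap (cnj m2) (- cnj m1) (pt (u b) (x b)))"
    by (rule test_pair_umap[OF _ g2]) (use m in simp)
  ultimately show ?thesis by (simp only:)
qed

subsection \<open>Counterexamples\<close>

text \<open>Lagrange's identity. It yields the Cauchy-Schwarz inequality and, in
  \<open>counterexample_disjoint\<close>, the distance of a line from the origin.\<close>

lemma hermitian_inner_identity:
  "norm z ^ 2 * norm w ^ 2 = norm (hermitian_inner z w) ^ 2 + norm (w $ 2 * z $ 1 - w $ 1 * z $ 2) ^ 2"
  unfolding norm_vec2 hermitian_inner_def cmod_power2 by (simp add: algebra_simps power2_eq_square)

lemma norm_hermitian_inner_le: "norm (hermitian_inner z w) \<le> norm z * norm w"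
proof (rule power2_le_imp_le)
  show "norm (hermitian_inner z w) ^ 2 \<le> (norm z * norm w) ^ 2"
    unfolding power_mult_distrib hermitian_inner_identity[of z w] by simp
qed simp

lemma hermitian_inner_self: "hermitian_inner z z = of_real (norm z ^ 2)"
  unfolding norm_vec2 hermitian_inner_def of_real_add complex_norm_square ..

lemma hermitian_inner_commute: "hermitian_inner w z = cnj (hermitian_inner z w)"
  by (simp add: hermitian_inner_def mult.commute)

lemma hermitian_inner_line: "hermitian_inner (p + \<zeta> *s v) w = hermitian_inner p w + \<zeta> * hermitian_inner v w"
  by (simp add: hermitian_inner_def algebra_simps)

lemma one_minus_hermitian_inner: "1 - hermitian_inner z w = aff 1 (- cnj (w $ 1)) (- cnj (w $ 2)) z"
  by (simp add: hermitian_inner_def aff_def algebra_simps)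

lemma one_minus_hermitian_inner_nonzero:
  assumes "norm p < 1" "norm z \<le> 1"
  shows "1 - hermitian_inner z p \<noteq> 0"
proof
  assume "1 - hermitian_inner z p = 0"
  then have "hermitian_inner z p = 1" by simp
  then have "1 \<le> norm z * norm p" using norm_hermitian_inner_le[of z p] by simp
  also have "\<dots> \<le> 1 * norm p" using assms(2) by (intro mult_right_mono) auto
  finally show False using assms(1) by simp
qed

lemma C_k_on_cnj: "open U \<Longrightarrow> C_k_on k f U \<Longrightarrow> C_k_on k (\<lambda>x. cnj (f x)) U"
  by (rule C_k_on_compose_bounded_linear[OF _ bounded_linear_cnj])

text \<open>The maximum principle on the slice of the ball by the line. Two lines through
  \<open>p\<close> with different boundary constants therefore rule out an extension through the
  ball.\<close>

lemma value_of_constant_on_line: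
  assumes F: "continuous_on (cball 0 1) F" "holomorphic2_on F (ball 0 1)"
    and p: "norm p < 1" and v: "v \<noteq> 0"
    and const: "\<And>\<zeta>. norm (p + \<zeta> *s v) = 1 \<Longrightarrow> F (p + \<zeta> *s v) = c"
  shows "F p = c"
proof -
  define A where "A = {\<zeta>. norm (p + \<zeta> *s v) < 1}"
  have cl: "continuous_on S (\<lambda>\<zeta>::complex. p + \<zeta> *s v)" for S
    by (rule has_derivative_continuous_on[OF has_derivative_affine_line])
  have oA: "open A"
    unfolding A_def by (intro open_Collect_less continuous_on_norm cl continuous_on_const)
  have "closed {\<zeta>. norm (p + \<zeta> *s v) \<le> 1}"
    by (intro closed_Collect_le continuous_on_norm cl continuous_on_const)
  moreover have "A \<subseteq> {\<zeta>. norm (p + \<zeta> *s v) \<le> 1}" unfolding A_def by auto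
  ultimately have clA: "closure A \<subseteq> {\<zeta>. norm (p + \<zeta> *s v) \<le> 1}" by (simp add: closure_minimal)
  have "norm (F (p + 0 *s v) - c) \<le> 0"
  proof (rule maximum_modulus_frontier[where f = "\<lambda>\<zeta>. F (p + \<zeta> *s v) - c" and S = A])
    have "(\<lambda>\<zeta>. F (p + \<zeta> *s v)) holomorphic_on A"
      by (rule holomorphic2_on_line[OF F(2) _ oA]) (simp add: A_def)
    then show "(\<lambda>\<zeta>. F (p + \<zeta> *s v) - c) holomorphic_on interior A"
      unfolding interior_open[OF oA] by (intro holomorphic_on_diff holomorphic_on_const)
    have "continuous_on (closure A) (\<lambda>\<zeta>. F (p + \<zeta> *s v))"
      by (rule continuous_on_compose2[OF F(1) cl]) (use clA in auto)
    then show "continuous_on (closure A) (\<lambda>\<zeta>. F (p + \<zeta> *s v) - c)"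
      by (intro continuous_on_diff continuous_on_const)
    have "norm \<zeta> \<le> 2 / norm v" if "\<zeta> \<in> A" for \<zeta>
    proof -
      have "norm \<zeta> * norm v = norm ((p + \<zeta> *s v) - p)" by (simp add: norm_smult_vec)
      also have "\<dots> \<le> norm (p + \<zeta> *s v) + norm p" by (rule norm_triangle_ineq4)
      also have "\<dots> \<le> 2" using that p unfolding A_def by simp
      finally show ?thesis using v by (simp add: field_simps)
    qed
    then show "bounded A" by (rule boundedI)
    show "0 \<in> A" using p by (simp add: A_def)
    fix \<zeta> assume "\<zeta> \<in> frontier A"
    then have "\<zeta> \<in> closure A" "\<zeta> \<notin> A" unfolding frontier_def interior_open[OF oA] by blast+
    then have "norm (p + \<zeta> *s v) = 1" using clA unfolding A_def by auto
    then show "norm (F (p + \<zeta> *s v) - c) \<le> 0" using const by simp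
  qed
  then show ?thesis by simp
qed

lemma extends_along_quotient:
  assumes f: "\<And>z. z \<in> L \<Longrightarrow> norm z = 1 \<Longrightarrow> f z = c + k * aff n0 n1 n2 z / aff d0 d1 d2 z"
    and d: "\<And>z. norm z \<le> 1 \<Longrightarrow> aff d0 d1 d2 z \<noteq> 0"
  shows "extends_holomorphically_along f L"
  unfolding extends_holomorphically_along_def
proof (intro exI conjI)
  show "continuous_on (L \<inter> cball 0 1) (\<lambda>z. c + k * aff n0 n1 n2 z / aff d0 d1 d2 z)"
    by (intro continuous_on_add continuous_on_mult continuous_on_divide continuous_on_const continuous_on_aff) (use d in auto)
  show "\<forall>z\<in>L \<inter> sphere 0 1. c + k * aff n0 n1 n2 z / aff d0 d1 d2 z = f z"
    using f by simp
  show "holomorphic_on_line (\<lambda>z. c + k * aff n0 n1 n2 z / aff d0 d1 d2 z) L (L \<inter> ball 0 1)"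
    unfolding holomorphic_on_line_def
  proof (intro allI impI)
    fix p v :: "complex^2"
    have "aff d0 d1 d2 p + \<zeta> * aff 0 d1 d2 v \<noteq> 0" if "\<zeta> \<in> {\<zeta>. p + \<zeta> *s v \<in> L \<inter> ball 0 1}" for \<zeta>
      unfolding aff_line[symmetric] by (rule d) (use that in simp)
    then show "(\<lambda>\<zeta>. c + k * aff n0 n1 n2 (p + \<zeta> *s v) / aff d0 d1 d2 (p + \<zeta> *s v)) holomorphic_on {\<zeta>. p + \<zeta> *s v \<in> L \<inter> ball 0 1}"
      unfolding aff_line
      by (intro holomorphic_on_add holomorphic_on_mult holomorphic_on_divide holomorphic_on_const holomorphic_on_ident)
  qed
qed

lemma extends_along_constant:
  assumes "\<And>z. z \<in> L \<Longrightarrow> norm z = 1 \<Longrightarrow> f z = c"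
  shows "extends_holomorphically_along f L"
  by (rule extends_along_quotient[where c = c and k = 0 and ?d0.0 = 1 and ?d1.0 = 0 and ?d2.0 = 0]) (simp_all add: assms aff_def)

abbreviation (input) not_test_pair :: "complex^2 \<Rightarrow> complex^2 \<Rightarrow> bool" where
  "not_test_pair a b \<equiv> \<exists>f. smooth_on_sphere f \<and>
     (\<forall>L \<in> lines_through a \<union> lines_through b. L \<inter> ball 0 1 \<noteq> {} \<longrightarrow> extends_holomorphically_along f L) \<and>
     \<not> extends_holomorphically_through_ball f"

text \<open>The equation of the sphere eliminates the real part of \<open>t\<close>. What remains is
  the squared modulus of \<open>\<zeta>\<close> times a quantity that depends on the direction of
  the line only.\<close>

lemma sphere_inner_identity:
  assumes z: "norm (c + \<zeta> *s v) = 1"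
  shows "norm (1 - hermitian_inner (c + \<zeta> *s v) c) ^ 2 =
    norm \<zeta> ^ 2 * ((1 - norm c ^ 2) * norm v ^ 2 + norm (hermitian_inner v c) ^ 2)"
proof -
  define t where "t = \<zeta> * hermitian_inner v c"
  define A where "A = 1 - norm c ^ 2"
  have "norm (c + \<zeta> *s v) ^ 2 = norm c ^ 2 + 2 * Re t + norm \<zeta> ^ 2 * norm v ^ 2"
    unfolding t_def norm_vec2 hermitian_inner_def cmod_power2 by (simp add: algebra_simps power2_eq_square)
  then have A: "A = 2 * Re t + norm \<zeta> ^ 2 * norm v ^ 2" unfolding z A_def by simp
  have "1 - hermitian_inner (c + \<zeta> *s v) c = of_real A - t"
    unfolding hermitian_inner_line hermitian_inner_self t_def A_def by simp
  also have "norm (of_real A - t) ^ 2 = A * (A - 2 * Re t) + norm t ^ 2"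
    unfolding cmod_power2 by (simp add: algebra_simps power2_eq_square)
  also have "A - 2 * Re t = norm \<zeta> ^ 2 * norm v ^ 2" using A by simp
  also have "norm t ^ 2 = norm \<zeta> ^ 2 * norm (hermitian_inner v c) ^ 2"
    unfolding t_def norm_mult power_mult_distrib ..
  finally show ?thesis unfolding A_def by (simp add: algebra_simps)
qed

text \<open>By duality \<open>1 - hermitian_inner z b\<close> is a multiple of
  \<open>\<zeta>\<close> on each line through \<open>a\<close>, and likewise with \<open>a\<close>
  and \<open>b\<close> exchanged. The other factor of the quotient is controlled by
  \<open>sphere_inner_identity\<close>, so that the squared modulus of \<open>\<zeta>\<close>
  cancels in both cases.\<close>

lemma counterexample_dual:
  assumes a: "norm a < 1" and ab: "hermitian_inner a b = 1"
  shows "not_test_pair a b"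
proof -
  have ba: "hermitian_inner b a = 1" using hermitian_inner_commute[of b a] ab by simp
  have a2: "norm a ^ 2 < 1" using a by (simp add: power_less_one_iff)
  define f where "f z = complex_of_real (norm (1 - hermitian_inner z b) ^ 2 / norm (1 - hermitian_inner z a) ^ 2)" for z
  define U where "U = {z. 1 - hermitian_inner z a \<noteq> 0}"
  have oU: "open U"
    unfolding U_def one_minus_hermitian_inner by (intro open_Collect_neq continuous_on_aff continuous_on_const)
  have nz: "1 - hermitian_inner z a \<noteq> 0" if "norm z = 1" for z
    by (rule one_minus_hermitian_inner_nonzero[OF a]) (use that in simp)
  have fe: "f z = ((1 - hermitian_inner z b) * cnj (1 - hermitian_inner z b)) * inverse ((1 - hermitian_inner z a) * cnj (1 - hermitian_inner z a))" for z
    unfolding f_def of_real_divide complex_norm_square by (rule divide_inverse)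
  have h: "C_k_on k (\<lambda>z. 1 - hermitian_inner z c) U" for k c
    unfolding one_minus_hermitian_inner by (rule C_k_on_aff[OF oU])
  have "C_k_on k f U" for k
    unfolding fe[abs_def]
    by (rule C_k_on_mult[OF oU C_k_on_mult[OF oU h C_k_on_cnj[OF oU h]] C_k_on_inverse[OF oU C_k_on_mult[OF oU h C_k_on_cnj[OF oU h]]]])
      (auto simp: U_def)
  moreover have "sphere 0 1 \<subseteq> U" unfolding U_def using nz by auto
  ultimately have smooth: "smooth_on_sphere f" unfolding smooth_on_sphere_def using oU by blast
  define ca where "ca v = complex_of_real (norm (hermitian_inner v b) ^ 2 / ((1 - norm a ^ 2) * norm v ^ 2 + norm (hermitian_inner v a) ^ 2))" for v
  have fa: "f (a + \<zeta> *s v) = ca v" if "norm (a + \<zeta> *s v) = 1" for \<zeta> v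
  proof -
    have "\<zeta> \<noteq> 0" using that a by auto
    moreover have "norm (1 - hermitian_inner (a + \<zeta> *s v) b) ^ 2 = norm \<zeta> ^ 2 * norm (hermitian_inner v b) ^ 2"
      unfolding hermitian_inner_line ab by (simp add: norm_mult power_mult_distrib)
    ultimately show ?thesis unfolding f_def ca_def sphere_inner_identity[OF that] by simp
  qed
  define cb where "cb v = complex_of_real (((1 - norm b ^ 2) * norm v ^ 2 + norm (hermitian_inner v b) ^ 2) / norm (hermitian_inner v a) ^ 2)" for v
  have fb: "f (b + \<zeta> *s v) = cb v" if "norm (b + \<zeta> *s v) = 1" for \<zeta> v
  proof -
    have 1: "1 - hermitian_inner (b + \<zeta> *s v) a = - (\<zeta> * hermitian_inner v a)" unfolding hermitian_inner_line ba by simp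
    then have "\<zeta> \<noteq> 0" using nz[OF that] by auto
    then show ?thesis unfolding f_def cb_def sphere_inner_identity[OF that] 1 by (simp add: norm_mult power_mult_distrib)
  qed
  have "extends_holomorphically_along f L" if "L \<in> lines_through a \<union> lines_through b" for L
    using that
  proof
    assume "L \<in> lines_through a"
    then obtain v where L: "L = range (\<lambda>\<zeta>. a + \<zeta> *s v)" by (rule lines_through_cases)
    show ?thesis by (rule extends_along_constant[where c = "ca v"]) (use fa L in auto)
  next
    assume "L \<in> lines_through b"
    then obtain v where L: "L = range (\<lambda>\<zeta>. b + \<zeta> *s v)" by (rule lines_through_cases)
    show ?thesis by (rule extends_along_constant[where c = "cb v"]) (use fb L in auto)
  qed
  moreover have "\<not> extends_holomorphically_through_ball f"
  proof
    assume "extends_holomorphically_through_ball f"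
    then obtain F where F: "continuous_on (cball 0 1) F" "\<forall>z\<in>sphere 0 1. F z = f z" "holomorphic2_on F (ball 0 1)"
      unfolding extends_holomorphically_through_ball_def by blast
    have Fa: "F a = ca v" if "v \<noteq> 0" for v
      by (rule value_of_constant_on_line[OF F(1,3) a that]) (use F(2) fa in simp)
    have b0: "b \<noteq> 0" using ab by (auto simp: hermitian_inner_def)
    \<comment> \<open>A direction orthogonal to \<open>b\<close> gives the boundary constant 0, the
      direction \<open>b\<close> a nonzero one; both would have to equal \<open>F a\<close>.\<close>
    define v where "v = pt (cnj (b $ 2)) (- cnj (b $ 1))"
    have "v \<noteq> 0" using b0 unfolding v_def by (auto simp: vec_eq_iff forall_2)
    moreover have "hermitian_inner v b = 0" unfolding v_def hermitian_inner_def by simp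
    ultimately have "F a = 0" using Fa[of v] unfolding ca_def by simp
    moreover have "F a \<noteq> 0"
    proof -
      have "(1 - norm a ^ 2) * norm b ^ 2 > 0" using a2 b0 by simp
      then have "(1 - norm a ^ 2) * norm b ^ 2 + norm (hermitian_inner b a) ^ 2 \<noteq> 0"
        using zero_le_power2[of "norm (hermitian_inner b a)"] by linarith
      moreover have "hermitian_inner b b \<noteq> 0" unfolding hermitian_inner_self using b0 by simp
      ultimately show ?thesis unfolding Fa[OF b0] ca_def of_real_eq_0_iff by simp
    qed
    ultimately show False by simp
  qed
  ultimately show ?thesis using smooth by blast
qed

text \<open>Expanding \<open>hermitian_inner z z = 1\<close> in barycentric coordinates gives
  \<open>key\<close>, by which \<open>f\<close> is on the sphere also 1 minus the analogous
  expression with \<open>y\<close> and \<open>a\<close> in place of \<open>w\<close> and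
  \<open>b\<close>. The first form is holomorphic along lines through \<open>a\<close>, where
  \<open>w / x\<close> is constant, the second along lines through \<open>b\<close>, where
  \<open>y / x\<close> is constant.\<close>

lemma counterexample_disjoint:
  assumes ne: "a \<noteq> b" and disj: "line_joining a b \<inter> cball 0 1 = {}"
  shows "not_test_pair a b"
proof -
  define d where "d = b - a"
  have d0: "norm d > 0" unfolding d_def using ne by simp
  define u where "u z = d $ 2 * z $ 1 - d $ 1 * z $ 2" for z :: "complex^2"
  define l where "l = u a"
  have b: "b = a + 1 *s d" unfolding d_def by simp
  have ub: "u b = l" unfolding l_def u_def b by (simp add: algebra_simps)
  \<comment> \<open>The quotient \<open>norm l / norm d\<close> is the distance of the line from the
    origin; \<open>z\<close> is the foot of the perpendicular.\<close>
  have big: "norm l ^ 2 > norm d ^ 2"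
  proof -
    define \<zeta> where "\<zeta> = - hermitian_inner a d / of_real (norm d ^ 2)"
    define z where "z = a + \<zeta> *s d"
    have "hermitian_inner z d = 0"
      unfolding z_def hermitian_inner_line hermitian_inner_self \<zeta>_def using d0 by simp
    moreover have "u z = l" unfolding z_def u_def l_def by (simp add: algebra_simps)
    ultimately have "norm z ^ 2 * norm d ^ 2 = norm l ^ 2"
      using hermitian_inner_identity[of z d] unfolding u_def by simp
    moreover have "z \<in> line_joining a b" unfolding z_def d_def line_joining_def by (rule rangeI)
    then have "norm z > 1" using disj by auto
    then have "norm z ^ 2 > 1" by (simp add: one_less_power)
    then have "norm z ^ 2 * norm d ^ 2 > 1 * norm d ^ 2" using d0 by (intro mult_strict_right_mono) auto
    ultimately show ?thesis by simp
  qed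
  have l0: "l \<noteq> 0" using big by auto
  define p where "p = pt (cnj (d $ 2) / cnj l) (- cnj (d $ 1) / cnj l)"
  have up: "hermitian_inner z p = u z / l" for z
    unfolding hermitian_inner_def p_def u_def by (simp add: diff_divide_distrib mult.commute)
  have pa: "hermitian_inner a p = 1" and pb: "hermitian_inner b p = 1"
    unfolding up ub l_def[symmetric] using l0 by simp_all
  have "norm p ^ 2 = norm d ^ 2 / norm l ^ 2"
    unfolding p_def norm_pt norm_vec2[of d] by (simp add: norm_divide power_divide add_divide_distrib)
  also have "\<dots> < 1 ^ 2" using big l0 by simp
  finally have p1: "norm p < 1" by (rule power_less_imp_less_base) simp
  then have p2: "norm p ^ 2 < 1" by (simp add: power_less_one_iff)
  define P where "P = complex_of_real (1 - norm p ^ 2)"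
  have P0: "P \<noteq> 0" unfolding P_def of_real_eq_0_iff using p2 by simp
  have Pp: "hermitian_inner p p = 1 - P" unfolding P_def hermitian_inner_self by simp
  define c where "c = a - p"
  define e where "e = b - p"
  \<comment> \<open>A nonzero value says that \<open>p\<close>, \<open>a\<close>, \<open>b\<close>
    are affinely independent. It holds because \<open>p\<close> lies in the ball and so not on the
    line through \<open>a\<close> and \<open>b\<close>.\<close>
  define \<Delta> where "\<Delta> = c $ 1 * e $ 2 - c $ 2 * e $ 1"
  have "\<Delta> = u a - u p" unfolding \<Delta>_def c_def e_def b u_def by (simp add: algebra_simps)
  also have "u p = l * hermitian_inner p p" unfolding up using l0 by simp
  finally have "\<Delta> = l * P" unfolding Pp l_def[symmetric] by (simp add: algebra_simps)
  then have \<Delta>0: "\<Delta> \<noteq> 0" using l0 P0 by simp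
  define Y where "Y v = (e $ 2 * v $ 1 - e $ 1 * v $ 2) / \<Delta>" for v :: "complex^2"
  define W where "W v = (c $ 1 * v $ 2 - c $ 2 * v $ 1) / \<Delta>" for v :: "complex^2"
  have YW: "v = Y v *s c + W v *s e" for v
  proof -
    have "(Y v * c $ 1 + W v * e $ 1) * \<Delta> = v $ 1 * \<Delta>" "(Y v * c $ 2 + W v * e $ 2) * \<Delta> = v $ 2 * \<Delta>"
      unfolding Y_def W_def distrib_right mult.assoc using \<Delta>0
      by (simp_all add: \<Delta>_def[symmetric]) (simp_all add: \<Delta>_def algebra_simps)
    then show ?thesis using \<Delta>0 by (simp add: vec_eq_iff forall_2)
  qed
  have lin: "Y (v + \<zeta> *s w) = Y v + \<zeta> * Y w" "W (v + \<zeta> *s w) = W v + \<zeta> * W w" for v w \<zeta>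
    unfolding Y_def W_def by (simp_all add: add_divide_distrib[symmetric] diff_divide_distrib[symmetric] algebra_simps)
  have val: "Y c = 1" "W c = 0" "Y e = 0" "W e = 1"
    unfolding Y_def W_def using \<Delta>0 by (simp_all add: \<Delta>_def mult.commute)
  define y where "y z = Y (z - p)" for z
  define w where "w z = W (z - p)" for z
  define x where "x z = 1 - y z - w z" for z
  define D where "D z = 1 - hermitian_inner z p" for z
  have zdec: "z = p + y z *s c + w z *s e" for z
    using YW[of "z - p"] unfolding y_def w_def by (simp add: algebra_simps)
  have cp: "hermitian_inner c p = P" "hermitian_inner e p = P"
  proof -
    have "hermitian_inner c p = hermitian_inner a p - hermitian_inner p p" "hermitian_inner e p = hermitian_inner b p - hermitian_inner p p"
      unfolding c_def e_def hermitian_inner_def by (simp_all add: algebra_simps)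
    then show "hermitian_inner c p = P" "hermitian_inner e p = P" unfolding pa pb Pp by simp_all
  qed
  have Dx: "D z = x z * P" for z
  proof -
    have "hermitian_inner z p = 1 - P + y z * P + w z * P"
      by (subst zdec[of z]) (simp only: hermitian_inner_line Pp cp)
    then show ?thesis unfolding D_def x_def by (simp add: algebra_simps)
  qed
  have Dn: "D z \<noteq> 0" if "norm z \<le> 1" for z
    unfolding D_def by (rule one_minus_hermitian_inner_nonzero[OF p1 that])
  have xn: "x z \<noteq> 0" if "norm z \<le> 1" for z using Dn[OF that] unfolding Dx by simp
  have key: "cnj (y z) * (hermitian_inner z a - 1) + cnj (w z) * (hermitian_inner z b - 1) = cnj (x z) * D z"
    if "norm z = 1" for z
  proof -
    have 1: "z = x z *s p + y z *s a + w z *s b"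
      using zdec[of z] unfolding x_def c_def e_def by (simp add: vec_eq_iff algebra_simps)
    have "hermitian_inner z (X *s p + Y' *s a + W' *s b) = cnj X * hermitian_inner z p + cnj Y' * hermitian_inner z a + cnj W' * hermitian_inner z b" for X Y' W'
      by (simp add: hermitian_inner_def algebra_simps)
    from this[of "x z" "y z" "w z"] have "hermitian_inner z z = cnj (x z) * hermitian_inner z p + cnj (y z) * hermitian_inner z a + cnj (w z) * hermitian_inner z b"
      unfolding 1[symmetric] .
    moreover have "hermitian_inner z z = cnj (x z) + cnj (y z) + cnj (w z)"
      unfolding hermitian_inner_self that x_def by simp
    ultimately show ?thesis unfolding D_def by (simp add: algebra_simps)
  qed
  define f where "f z = (cnj P * cnj (w z) * inverse (cnj (D z))) * ((hermitian_inner z b - 1) * inverse (D z))" for z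
  have Pc: "cnj P = P" unfolding P_def by simp
  have f1: "f z = cnj (w z / x z) * (hermitian_inner z b - 1) / D z" if "norm z \<le> 1" for z
    unfolding f_def using xn[OF that] Dn[OF that] P0 by (simp add: Dx field_simps)
  have f2: "f z = 1 - cnj (y z / x z) * (hermitian_inner z a - 1) / D z" if "norm z = 1" for z
  proof -
    have n: "norm z \<le> 1" using that by simp
    have "cnj (w z) * (hermitian_inner z b - 1) = cnj (x z) * D z - cnj (y z) * (hermitian_inner z a - 1)"
      using key[OF that] by (simp add: algebra_simps)
    then have "f z = (cnj (x z) * D z - cnj (y z) * (hermitian_inner z a - 1)) / (cnj (x z) * D z)"
      unfolding f1[OF n] by simp
    then show ?thesis using xn[OF n] Dn[OF n] by (simp add: diff_divide_distrib)
  qed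
  define U where "U = {z. D z \<noteq> 0}"
  have D_aff: "D z = aff 1 (- cnj (p $ 1)) (- cnj (p $ 2)) z" for z unfolding D_def by (rule one_minus_hermitian_inner)
  have w_aff: "w z = aff ((c $ 2 * p $ 1 - c $ 1 * p $ 2) / \<Delta>) (- c $ 2 / \<Delta>) (c $ 1 / \<Delta>) z" for z
    unfolding w_def W_def aff_def by (simp add: add_divide_distrib[symmetric] diff_divide_distrib[symmetric] algebra_simps)
  have h_aff: "hermitian_inner z v - 1 = aff (- 1) (cnj (v $ 1)) (cnj (v $ 2)) z" for z v
    by (simp add: hermitian_inner_def aff_def algebra_simps)
  have oU: "open U"
    unfolding U_def D_aff by (intro open_Collect_neq continuous_on_aff continuous_on_const)
  have "C_k_on k f U" for k
  proof -
    have CD: "C_k_on k D U" and Cw: "C_k_on k w U" and Ch: "C_k_on k (\<lambda>z. hermitian_inner z b - 1) U"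
      unfolding D_aff[abs_def] w_aff[abs_def] h_aff by (rule C_k_on_aff[OF oU])+
    show ?thesis
      unfolding f_def[abs_def]
      by (rule C_k_on_mult[OF oU C_k_on_mult[OF oU C_k_on_mult[OF oU C_k_on_const[OF oU] C_k_on_cnj[OF oU Cw]] C_k_on_inverse[OF oU C_k_on_cnj[OF oU CD]]]
              C_k_on_mult[OF oU Ch C_k_on_inverse[OF oU CD]]]) (auto simp: U_def)
  qed
  moreover have "sphere 0 1 \<subseteq> U" unfolding U_def using Dn by auto
  ultimately have smooth: "smooth_on_sphere f" unfolding smooth_on_sphere_def using oU by blast
  have "extends_holomorphically_along f L" if "L \<in> lines_through a \<union> lines_through b" for L
    using that
  proof
    assume "L \<in> lines_through a"
    then obtain v where L: "L = range (\<lambda>\<zeta>. a + \<zeta> *s v)" by (rule lines_through_cases)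
    \<comment> \<open>\<open>Y v + W v = 0\<close> would mean that the line joins \<open>a\<close>
      and \<open>b\<close>; it then has no point on the sphere, so the division by zero never
      matters.\<close>
    have wx: "w (a + \<zeta> *s v) / x (a + \<zeta> *s v) = - W v / (Y v + W v)" if "norm (a + \<zeta> *s v) = 1" for \<zeta>
    proof -
      have 1: "a + \<zeta> *s v - p = c + \<zeta> *s v" unfolding c_def by simp
      have 2: "x (a + \<zeta> *s v) = - \<zeta> * (Y v + W v)" "w (a + \<zeta> *s v) = \<zeta> * W v"
        unfolding x_def y_def w_def 1 lin val by (simp_all add: algebra_simps)
      then have "\<zeta> \<noteq> 0" using xn[of "a + \<zeta> *s v"] that by auto
      then show ?thesis unfolding 2 by simp
    qed
    show ?thesis
    proof (rule extends_along_quotient[where c = 0 and k = "cnj (- W v / (Y v + W v))"])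
      fix z assume "z \<in> L" and n: "norm z = 1"
      then obtain \<zeta> where "z = a + \<zeta> *s v" unfolding L by blast
      then have "w z / x z = - W v / (Y v + W v)" using wx n by simp
      then show "f z = 0 + cnj (- W v / (Y v + W v)) * aff (- 1) (cnj (b $ 1)) (cnj (b $ 2)) z / aff 1 (- cnj (p $ 1)) (- cnj (p $ 2)) z"
        using f1[of z] n unfolding h_aff D_aff by simp
    qed (use Dn D_aff in simp)
  next
    assume "L \<in> lines_through b"
    then obtain v where L: "L = range (\<lambda>\<zeta>. b + \<zeta> *s v)" by (rule lines_through_cases)
    have yx: "y (b + \<zeta> *s v) / x (b + \<zeta> *s v) = - Y v / (Y v + W v)" if "norm (b + \<zeta> *s v) = 1" for \<zeta>
    proof -
      have 1: "b + \<zeta> *s v - p = e + \<zeta> *s v" unfolding e_def by simp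
      have 2: "x (b + \<zeta> *s v) = - \<zeta> * (Y v + W v)" "y (b + \<zeta> *s v) = \<zeta> * Y v"
        unfolding x_def y_def w_def 1 lin val by (simp_all add: algebra_simps)
      then have "\<zeta> \<noteq> 0" using xn[of "b + \<zeta> *s v"] that by auto
      then show ?thesis unfolding 2 by simp
    qed
    show ?thesis
    proof (rule extends_along_quotient[where c = 1 and k = "- cnj (- Y v / (Y v + W v))"])
      fix z assume "z \<in> L" and n: "norm z = 1"
      then obtain \<zeta> where "z = b + \<zeta> *s v" unfolding L by blast
      then have "y z / x z = - Y v / (Y v + W v)" using yx n by simp
      then show "f z = 1 + - cnj (- Y v / (Y v + W v)) * aff (- 1) (cnj (a $ 1)) (cnj (a $ 2)) z / aff 1 (- cnj (p $ 1)) (- cnj (p $ 2)) z"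
        using f2[OF n] unfolding h_aff D_aff by simp
    qed (use Dn D_aff in simp)
  qed
  moreover have "\<not> extends_holomorphically_through_ball f"
  proof
    assume "extends_holomorphically_through_ball f"
    then obtain F where F: "continuous_on (cball 0 1) F" "\<forall>z\<in>sphere 0 1. F z = f z" "holomorphic2_on F (ball 0 1)"
      unfolding extends_holomorphically_through_ball_def by blast
    have c0: "c \<noteq> 0" "e \<noteq> 0" using val unfolding Y_def W_def by auto
    have lp: "Y (\<zeta> *s v) = \<zeta> * Y v" "W (\<zeta> *s v) = \<zeta> * W v" for \<zeta> v
      using lin[of 0 \<zeta> v] by (simp_all add: Y_def W_def)
    have "F p = 0"
    proof (rule value_of_constant_on_line[OF F(1,3) p1 c0(1)])
      fix \<zeta> assume n: "norm (p + \<zeta> *s c) = 1"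
      have "w (p + \<zeta> *s c) = 0" unfolding w_def by (simp add: lp val)
      then show "F (p + \<zeta> *s c) = 0" using F(2) n f1[of "p + \<zeta> *s c"] by simp
    qed
    moreover have "F p = 1"
    proof (rule value_of_constant_on_line[OF F(1,3) p1 c0(2)])
      fix \<zeta> assume n: "norm (p + \<zeta> *s e) = 1"
      have "y (p + \<zeta> *s e) = 0" unfolding y_def by (simp add: lp val)
      then show "F (p + \<zeta> *s e) = 1" using F(2) n f2[OF n] by simp
    qed
    ultimately show False by simp
  qed
  ultimately show ?thesis using smooth by blast
qed

theorem theorem1p2:
  fixes a b :: "complex^2"
  assumes "a \<noteq> b"
  shows
    "(a \<in> ball 0 1 \<or> b \<in> ball 0 1 \<longrightarrow>
        (hermitian_inner a b \<noteq> 1 \<longrightarrow> test_family (lines_through a \<union> lines_through b)) \<and>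
        (hermitian_inner a b = 1 \<longrightarrow>
           (\<exists>f. smooth_on_sphere f \<and>
                (\<forall>L \<in> lines_through a \<union> lines_through b.
                   L \<inter> ball 0 1 \<noteq> {} \<longrightarrow> extends_holomorphically_along f L) \<and>
                \<not> extends_holomorphically_through_ball f))) \<and>
     (a \<notin> ball 0 1 \<and> b \<notin> ball 0 1 \<longrightarrow>
        (line_joining a b \<inter> ball 0 1 \<noteq> {} \<longrightarrow>
           test_family (lines_through a \<union> lines_through b)) \<and>
        (line_joining a b \<inter> cball 0 1 = {} \<longrightarrow>
           (\<exists>f. smooth_on_sphere f \<and>
                (\<forall>L \<in> lines_through a \<union> lines_through b.
                   L \<inter> ball 0 1 \<noteq> {} \<longrightarrow> extends_holomorphically_along f L) \<and>
                \<not> extends_holomorphically_through_ball f)))"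
proof -
  have "a + 0 *s (b - a) \<in> line_joining a b" "a + 1 *s (b - a) \<in> line_joining a b"
    unfolding line_joining_def by (rule rangeI)+
  then have meet: "line_joining a b \<inter> ball 0 1 \<noteq> {}" if "a \<in> ball 0 1 \<or> b \<in> ball 0 1"
    using that by auto
  have A1: "test_pair a b" if "a \<in> ball 0 1 \<or> b \<in> ball 0 1" "hermitian_inner a b \<noteq> 1"
    using test_family_two_pencils[OF assms meet[OF that(1)]] that(2) by blast
  have A2: "not_test_pair a b" if "a \<in> ball 0 1 \<or> b \<in> ball 0 1" "hermitian_inner a b = 1"
    using that(1)
  proof
    assume "a \<in> ball 0 1"
    then show ?thesis using counterexample_dual[of a b] that(2) by simp
  next
    assume "b \<in> ball 0 1"
    moreover have "hermitian_inner b a = 1" using hermitian_inner_commute[of b a] that(2) by simp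
    ultimately have "not_test_pair b a" using counterexample_dual[of b a] by simp
    then show ?thesis by (simp only: Un_commute)
  qed
  have B1: "test_pair a b" if "a \<notin> ball 0 1" "b \<notin> ball 0 1" "line_joining a b \<inter> ball 0 1 \<noteq> {}"
    using test_family_two_pencils[OF assms that(3)] that(1,2) by blast
  have B2: "not_test_pair a b" if "line_joining a b \<inter> cball 0 1 = {}"
    by (rule counterexample_disjoint[OF assms that])
  show ?thesis
    by (intro conjI impI; (elim conjE)?) (rule A1 A2 B1 B2; assumption)+
qed

end
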